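(* Let $\Omega \subset \mathbb{R}^n$ be an $(\epsilon,\delta)$-domain. Then there exists a linear extension operator $T$ (that is, $T$ is defined on $\mathrm{bmo}(\Omega)$, maps functions on $\Omega$ to functions on $\mathbb{R}^n$, and $Tf = f$ on $\Omega$) such that (i) $T:\mathrm{bmo}(\Omega) \to \mathrm{bmo}(\mathbb{R}^n)$ is bounded; (ii) $T:\mathrm{vmo}(\Omega) \to \mathrm{vmo}(\mathbb{R}^n)$ is bounded; (iii) $T:\mathrm{cmo}(\Omega) \to \mathrm{cmo}(\mathbb{R}^n)$ is bounded; (iv) $T:\mathrm{Lip}_b(\Omega) \to \mathrm{Lip}_b(\mathbb{R}^n)$ is bounded. Boundedness in (i)-(iii) refers to the $\mathrm{bmo}$ norms, while in (iv) it is with respect to the norm $\|\cdot\|_{\mathrm{Lip}_b}$.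
   Context: A domain is a connected open set. Given $\epsilon\in(0,1]$ and $\delta>0$, a domain $\Omega\subset\mathbb{R}^n$ is an $(\epsilon,\delta)$-domain if every pair of points $x,y\in\Omega$ with $|x-y|<\delta$ may be joined by a rectifiable curve $\gamma$ lying in $\Omega$ with $\mathrm{arclength}(\gamma)\le \epsilon^{-1}|x-y|$ and such that $\mathrm{dist}(z,\partial\Omega)\ge \epsilon\frac{|z-x||z-y|}{|x-y|}$ for every point $z$ on $\gamma$. All cubes $Q$ have sides parallel to the axes; $\ell(Q)$ is the sidelength and $f_Q = \frac{1}{|Q|}\int_Q f$. For an open set $\Omega$, $\omega_\Omega(f,t) := \sup_{Q \subset \Omega,\ \ell(Q)<t} \frac{1}{|Q|}\int_Q |f-f_Q|$, and for $\lambda>0$, $\mathrm{bmo}_\lambda(\Omega)$ is the set of functions $f$ integrable on every cube $Q\subset\Omega$ with $$\|f\|_{\mathrm{bmo}_\lambda(\Omega)} := \omega_\Omega(f,\lambda) + \sup_{Q\subset\Omega,\ \ell(Q)\ge\lambda} |f|_Q < \infty$$ (a supremum over an empty family is $0$). For an $(\epsilon,\delta)$-domain $\Omega$ put $\lambda_{\epsilon,\delta} := \frac{\epsilon^2\delta}{320n(1+\sqrt{n}\,\epsilon)}$; the set $\mathrm{bmo}_\lambda(\Omega)$ is the same, with equivalent norms, for all $0<\lambda\le\lambda_{\epsilon,\delta}$, and $\mathrm{bmo}(\Omega) := \mathrm{bmo}_{\lambda_{\epsilon,\delta}}(\Omega)$ with its norm. On $\mathbb{R}^n$, $\mathrm{bmo}(\mathbb{R}^n)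 := \mathrm{bmo}_1(\mathbb{R}^n)$ (any other finite scale gives the same space with an equivalent norm). For $\Omega$ an $(\epsilon,\delta)$-domain or $\Omega=\mathbb{R}^n$: $\mathrm{vmo}(\Omega)$ is the subspace of those $f\in\mathrm{bmo}(\Omega)$ with $\lim_{t\to0^+}\omega_\Omega(f,t)=0$; $\mathrm{cmo}(\Omega)$ is the closure in $\mathrm{bmo}(\Omega)$ of $C_c(\Omega)$, the continuous functions with compact support in $\Omega$; both carry the $\mathrm{bmo}$ norm. $\mathrm{Lip}_b(\Omega)$ denotes the bounded Lipschitz functions on $\Omega$, with norm $\|f\|_{\mathrm{Lip}_b} := \|f\|_\infty + \sup_{x\ne y}\frac{|f(x)-f(y)|}{|x-y|}$.
   Formalization: The formal theorem assumes in addition that a non-empty Ω contains a cube of side at least λ_{ε,δ}; otherwise the constant 1 has bmo(Ω) norm 0 and (i) is false, e.g. for Ω=(0,1), ε=1, δ=10^6. *)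

theory Defs
  imports "HOL-Analysis.Analysis"
begin

section \<open>Rectifiable curves and locally uniform domains\<close>

definition arclength :: "(real \<Rightarrow> 'a::metric_space) \<Rightarrow> ennreal" where
  "arclength g =
     (SUP ts \<in> {ts. sorted ts \<and> set ts \<subseteq> {0..1}}.
        \<Sum>i<length ts - 1. ennreal (dist (g (ts ! i)) (g (ts ! Suc i))))"

definition rectifiable :: "(real \<Rightarrow> 'a::metric_space) \<Rightarrow> bool" where
  "rectifiable g \<longleftrightarrow> path g \<and> arclength g < \<infinity>"

text \<open>Unlike \<^const>\<open>infdist\<close>, the distance to the empty set is infinite here. This matters
  for the whole space, whose frontier is empty.\<close>

definition dist_to_set :: "'a::metric_space \<Rightarrow> 'a set \<Rightarrow> ennreal" where
  "dist_to_set z A = (INF w\<in>A. ennreal (dist z w))"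

definition eps_delta_domain :: "real \<Rightarrow> real \<Rightarrow> (real ^ 'n) set \<Rightarrow> bool" where
  "eps_delta_domain \<epsilon> \<delta> \<Omega> \<longleftrightarrow>
     open \<Omega> \<and> connected \<Omega> \<and>
     (\<forall>x\<in>\<Omega>. \<forall>y\<in>\<Omega>. norm (x - y) < \<delta> \<longrightarrow>
        (\<exists>\<gamma>. rectifiable \<gamma> \<and> pathstart \<gamma> = x \<and> pathfinish \<gamma> = y \<and> path_image \<gamma> \<subseteq> \<Omega> \<and>
             arclength \<gamma> \<le> ennreal (norm (x - y) / \<epsilon>) \<and>
             (\<forall>z\<in>path_image \<gamma>.
                ennreal (\<epsilon> * (norm (z - x) * norm (z - y) / norm (x - y)))
                  \<le> dist_to_set z (frontier \<Omega>))))"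

section \<open>Cubes and mean oscillation\<close>

definition cube :: "real ^ 'n \<Rightarrow> real \<Rightarrow> (real ^ 'n) set" where
  "cube a l = cbox a (\<chi> i. a $ i + l)"

definition cubes_in :: "(real ^ 'n) set \<Rightarrow> ((real ^ 'n) \<times> real) set" where
  "cubes_in \<Omega> = {(a, l). 0 < l \<and> cube a l \<subseteq> \<Omega>}"

definition avg :: "(real ^ 'n \<Rightarrow> real) \<Rightarrow> (real ^ 'n) set \<Rightarrow> real" where
  "avg f Q = (LINT x:Q|lebesgue. f x) / measure lebesgue Q"

definition mean_osc :: "(real ^ 'n \<Rightarrow> real) \<Rightarrow> (real ^ 'n) set \<Rightarrow> real" where
  "mean_osc f Q = avg (\<lambda>x. \<bar>f x - avg f Q\<bar>) Q"

text \<open>Suprema are taken in \<^typ>\<open>ennreal\<close>, so that they may be infinite and the supremum of an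
  empty family is 0.\<close>

definition osc_modulus :: "(real ^ 'n) set \<Rightarrow> (real ^ 'n \<Rightarrow> real) \<Rightarrow> real \<Rightarrow> ennreal" where
  "osc_modulus \<Omega> f t =
     (SUP (a, l) \<in> {(a, l). (a, l) \<in> cubes_in \<Omega> \<and> l < t}. ennreal (mean_osc f (cube a l)))"

section \<open>Function spaces\<close>

text \<open>A function on \<open>\<Omega>\<close> is represented by a total function, of which only the values on \<open>\<Omega>\<close> are
  relevant.\<close>

definition bmo_norm :: "real \<Rightarrow> (real ^ 'n) set \<Rightarrow> (real ^ 'n \<Rightarrow> real) \<Rightarrow> ennreal" where
  "bmo_norm \<rho> \<Omega> f =
     osc_modulus \<Omega> f \<rho> +
     (SUP (a, l) \<in> {(a, l). (a, l) \<in> cubes_in \<Omega> \<and> \<rho> \<le> l}.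
        ennreal (avg (\<lambda>x. \<bar>f x\<bar>) (cube a l)))"

definition bmo :: "real \<Rightarrow> (real ^ 'n) set \<Rightarrow> (real ^ 'n \<Rightarrow> real) set" where
  "bmo \<rho> \<Omega> =
     {f. (\<forall>(a, l) \<in> cubes_in \<Omega>. set_integrable lebesgue (cube a l) f) \<and> bmo_norm \<rho> \<Omega> f < \<infinity>}"

definition vmo :: "real \<Rightarrow> (real ^ 'n) set \<Rightarrow> (real ^ 'n \<Rightarrow> real) set" where
  "vmo \<rho> \<Omega> = {f \<in> bmo \<rho> \<Omega>. (osc_modulus \<Omega> f \<longlongrightarrow> 0) (at_right 0)}"

definition cont_compact_support :: "(real ^ 'n) set \<Rightarrow> (real ^ 'n \<Rightarrow> real) set" where
  "cont_compact_support \<Omega> =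
     {g. continuous_on \<Omega> g \<and> (\<exists>K. compact K \<and> K \<subseteq> \<Omega> \<and> (\<forall>x\<in>\<Omega> - K. g x = 0))}"

definition cmo :: "real \<Rightarrow> (real ^ 'n) set \<Rightarrow> (real ^ 'n \<Rightarrow> real) set" where
  "cmo \<rho> \<Omega> =
     {f \<in> bmo \<rho> \<Omega>. \<forall>e>0. \<exists>g\<in>cont_compact_support \<Omega>. bmo_norm \<rho> \<Omega> (\<lambda>x. f x - g x) < e}"

definition Lip_b :: "(real ^ 'n) set \<Rightarrow> (real ^ 'n \<Rightarrow> real) set" where
  "Lip_b \<Omega> = {f. bounded (f ` \<Omega>) \<and> (\<exists>L. L-lipschitz_on \<Omega> f)}"

definition Lip_b_norm :: "(real ^ 'n) set \<Rightarrow> (real ^ 'n \<Rightarrow> real) \<Rightarrow> ennreal" where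
  "Lip_b_norm \<Omega> f =
     (SUP x\<in>\<Omega>. ennreal \<bar>f x\<bar>) +
     (SUP (x, y) \<in> {(x, y). x \<in> \<Omega> \<and> y \<in> \<Omega> \<and> x \<noteq> y}. ennreal (\<bar>f x - f y\<bar> / norm (x - y)))"

text \<open>The default scale for an \<open>(\<epsilon>, \<delta>)\<close>-domain in dimension \<open>n\<close>.\<close>

definition bmo_scale :: "nat \<Rightarrow> real \<Rightarrow> real \<Rightarrow> real" where
  "bmo_scale n \<epsilon> \<delta> = \<epsilon>\<^sup>2 * \<delta> / (320 * real n * (1 + sqrt (real n) * \<epsilon>))"

section \<open>Extension operators\<close>

text \<open>The first clause says that \<open>T f\<close> depends only on the restriction of \<open>f\<close> to \<open>\<Omega>\<close>.\<close>

definition linear_extension_operator ::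
  "(real ^ 'n) set \<Rightarrow> (real ^ 'n \<Rightarrow> real) set \<Rightarrow>
     ((real ^ 'n \<Rightarrow> real) \<Rightarrow> (real ^ 'n \<Rightarrow> real)) \<Rightarrow> bool" where
  "linear_extension_operator \<Omega> X T \<longleftrightarrow>
     (\<forall>f\<in>X. \<forall>g\<in>X. (\<forall>x\<in>\<Omega>. f x = g x) \<longrightarrow> T f = T g) \<and>
     (\<forall>f\<in>X. \<forall>g\<in>X. T (\<lambda>x. f x + g x) = (\<lambda>x. T f x + T g x)) \<and>
     (\<forall>f\<in>X. \<forall>c. T (\<lambda>x. c * f x) = (\<lambda>x. c * T f x)) \<and>
     (\<forall>f\<in>X. \<forall>x\<in>\<Omega>. T f x = f x)"

definition bounded_map ::
  "('a \<Rightarrow> 'b) \<Rightarrow> 'a set \<Rightarrow> ('a \<Rightarrow> ennreal) \<Rightarrow> 'b set \<Rightarrow> ('b \<Rightarrow> ennreal) \<Rightarrow> bool" where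
  "bounded_map T X N Y M \<longleftrightarrow> T ` X \<subseteq> Y \<and> (\<exists>C::real. \<forall>f\<in>X. M (T f) \<le> ennreal C * N f)"

end

(* Outside the closure of Omega, at distance d = dist(x, Omega), the extension is a cutoff in d times
   the average of f over the points y of Omega with |y - x| < 4d and dist(y, complement) > eps d / 8,
   taken with respect to a weight that is Lipschitz in x; by the corkscrew property of Omega the total
   mass of the weight is comparable to d^(n+2). A Whitney decomposition with a partition of unity is not
   needed. The same averages at the centres of cubes serve as reference values.

   Two cubes well inside Omega at comparable distance and scale are joined by a chain of boundedly many
   cubes along the curve from the definition of an (eps, delta)-domain, so the means of f on them differ
   by at most a constant times the oscillation of f at that scale. Hence the averages are Lipschitz in x
   with constant (oscillation) / d. For a cube Q meeting the boundary, split Q into M^n cells. The cells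
   away from the boundary are controlled by the previous remark. By the corkscrew property at least one
   cell is of this kind, so iterating the splitting on the remaining cells yields geometric series of
   ratio 1 - M^(-n); this bounds the mean oscillation on Q and also shows that the boundary is null.

   All estimates are local in scale, which gives the statement on vmo. A continuous function with compact
   support in Omega is extended by zero near the boundary, which gives the one on cmo. For Lipschitz
   functions the averages converge at the boundary; there the extension is defined through a linear
   extension of the limit functional to all real sequences. *)
theory Submission
  imports Defs "HOL-Library.Function_Algebras"
begin

text \<open>The bmo norm controls the size of \<open>f\<close>, as opposed to its oscillation, only
  on cubes of side at least \<open>\<rho>\<close>. So chains have to reach such a cube from
  everywhere; this is the purpose of the smallness of \<open>\<rho>\<close> against
  \<open>\<epsilon> * \<delta>\<close> and of the existence of one large cube. The obstacle at the
  boundary is that integrability of the extension there is part of the conclusion. The remainder of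
  the iterated splitting therefore cannot be dismissed as a small multiple of a finite integral.
  Instead the splitting is applied to the part of a cube at distance at least \<open>t\<close> from
  the frontier, where it ends after finitely many generations without remainder. The bound does not
  depend on \<open>t\<close>, and monotone convergence gives the whole cube. For the same reason
  deviations are measured from reference values of \<open>f\<close> and not from means of the
  extension. Locality is kept by carrying two bounds: \<open>W\<close> for the oscillation below a
  chosen scale and \<open>V\<close> for the norm. On cubes small against that scale,
  \<open>V\<close> enters only with a factor proportional to the side.\<close>

lemma abs_max_0_diff_le: "\<bar>max 0 a - max 0 b\<bar> \<le> \<bar>a - b :: real\<bar>"
  by (simp add: max_def)

lemma less_of_le_half: "0 < t \<Longrightarrow> d \<le> t / 2 \<Longrightarrow> d < (t :: real)"
  by simp

section \<open>Centred cubes\<close>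

text \<open>Chains slide a cube along a curve by its centre, and comparison cubes are concentric, so
  the centre is the convenient parameter.\<close>

definition ccube :: "real ^ 'n \<Rightarrow> real \<Rightarrow> (real ^ 'n) set" where
  "ccube p s = cube (p - (\<chi> i. s / 2)) s"

lemma mem_ccube: "x \<in> ccube p s \<longleftrightarrow> (\<forall>i. \<bar>x $ i - p $ i\<bar> \<le> s / 2)"
proof -
  have "x \<in> ccube p s \<longleftrightarrow> (\<forall>i. p $ i - s/2 \<le> x $ i \<and> x $ i \<le> p $ i - s/2 + s)"
    unfolding ccube_def cube_def mem_box_cart by simp
  also have "\<dots> \<longleftrightarrow> (\<forall>i. \<bar>x $ i - p $ i\<bar> \<le> s / 2)"
    by (intro all_cong1) linarith
  finally show ?thesis .
qed

lemma cube_eq_ccube: "cube a l = ccube (a + (\<chi> i. l / 2)) l"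
  by (simp add: ccube_def)

lemma ccube_lmeasurable [simp]: "ccube p s \<in> lmeasurable"
  by (simp add: ccube_def cube_def)

lemma ccube_sets [simp]: "ccube p s \<in> sets lebesgue"
  using ccube_lmeasurable by (rule fmeasurableD)

lemma measure_ccube: "0 \<le> s \<Longrightarrow> measure lebesgue (ccube (p :: real ^ 'n) s) = s ^ CARD('n)"
proof -
  assume s: "0 \<le> s"
  have "cbox (p - (\<chi> i. s / 2)) (\<chi> i. (p - (\<chi> i. s / 2)) $ i + s) \<noteq> {}"
    using s by (auto simp: interval_ne_empty_cart)
  then show ?thesis
    unfolding ccube_def cube_def using content_cbox_cart[of "p - (\<chi> i. s / 2)" "\<chi> i. (p - (\<chi> i. s / 2)) $ i + s"]
    by (simp add: measure_completion)
qed

lemma emeasure_ccube: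
  "0 \<le> s \<Longrightarrow> emeasure lebesgue (ccube (p :: real ^ 'n) s) = ennreal (s ^ CARD('n))"
  using emeasure_eq_measure2[OF ccube_lmeasurable] measure_ccube by metis

lemma ball_subset_ccube: "ball p (s / 2) \<subseteq> ccube p s"
  unfolding mem_ccube subset_iff
  by (metis component_le_norm_cart dist_norm dist_commute mem_ball less_imp_le order_trans vector_minus_component)

lemma cball_subset_ccube: "cball p (s / 2) \<subseteq> ccube p s"
  unfolding mem_ccube subset_iff
  by (metis component_le_norm_cart dist_norm dist_commute mem_cball order_trans vector_minus_component)

lemma ccube_subset_cball: "0 \<le> s \<Longrightarrow> ccube (p :: real ^ 'n) s \<subseteq> cball p (sqrt CARD('n) * s / 2)"
proof
  fix x assume s: "0 \<le> s" and x: "x \<in> ccube p s"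
  have "norm (x - p) = L2_set (\<lambda>i. norm ((x - p) $ i)) UNIV" by (simp add: norm_vec_def)
  also have "\<dots> \<le> L2_set (\<lambda>i::'n. s / 2) UNIV"
    using x unfolding mem_ccube by (intro L2_set_mono) auto
  also have "\<dots> = sqrt CARD('n) * s / 2" using s by (simp add: L2_set_def real_sqrt_mult)
  finally show "x \<in> cball p (sqrt CARD('n) * s / 2)" by (simp add: dist_norm norm_minus_commute)
qed

lemma ccube_mono: "dist p q \<le> (t - s) / 2 \<Longrightarrow> ccube p s \<subseteq> ccube (q :: real ^ 'n) t"
  unfolding mem_ccube subset_iff
proof (intro allI impI)
  fix x i assume d: "dist p q \<le> (t - s) / 2" and x: "\<forall>i. \<bar>x $ i - p $ i\<bar> \<le> s / 2"
  have "\<bar>p $ i - q $ i\<bar> \<le> dist p q"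
    using component_le_norm_cart[of "p - q" i] by (simp add: dist_norm)
  then show "\<bar>x $ i - q $ i\<bar> \<le> t / 2" using d spec[OF x, of i] abs_triangle_ineq[of "x $ i - p $ i" "p $ i - q $ i"]
    by (simp add: diff_divide_distrib)
qed

lemma grid_point:
  fixes u h :: real and M :: nat
  assumes "0 < M" "0 < h" "0 \<le> u" "u \<le> real M * h"
  shows "\<exists>k<M. \<bar>u - (real k + 1/2) * h\<bar> \<le> h / 2"
proof -
  define v where "v = u / h"
  have v: "0 \<le> v" "v \<le> M" using assms by (auto simp: v_def field_simps)
  \<comment> \<open>The right end point \<open>u = M * h\<close> would get the index
    \<open>M\<close>; the minimum puts it into the last cell.\<close>
  define k where "k = min (M - 1) (nat \<lfloor>v\<rfloor>)"
  have k: "k < M" using assms(1) by (auto simp: k_def)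
  have "real k \<le> v" unfolding k_def using v by linarith
  moreover have "v \<le> real k + 1"
  proof (cases "nat \<lfloor>v\<rfloor> \<le> M - 1")
    case True then show ?thesis unfolding k_def using v by linarith
  next
    case False then have "k = M - 1" by (auto simp: k_def)
    then show ?thesis using v assms(1) by (simp add: of_nat_diff)
  qed
  ultimately have "\<bar>v - (real k + 1/2)\<bar> \<le> 1/2" by linarith
  then have "\<bar>v - (real k + 1/2)\<bar> * h \<le> 1/2 * h"
    using assms by (intro mult_right_mono) auto
  moreover have "\<bar>v - (real k + 1/2)\<bar> * h = \<bar>(v - (real k + 1/2)) * h\<bar>"
    using assms by (simp add: abs_mult)
  moreover have "(v - (real k + 1/2)) * h = u - (real k + 1/2) * h"
    using assms by (simp add: v_def left_diff_distrib)
  ultimately have "\<bar>u - (real k + 1/2) * h\<bar> \<le> h / 2" by simp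
  then show ?thesis using k by blast
qed

text \<open>A cover with a cardinality bound is enough: the closed cells share faces, but only
  integrals of nonnegative functions are summed over them.\<close>

lemma ccube_grid:
  fixes p :: "real ^ 'n"
  assumes M: "0 < (M :: nat)" and l: "0 < l"
  obtains C where "finite C" "card C \<le> M ^ CARD('n)" "ccube p l \<subseteq> (\<Union>c\<in>C. ccube c (l / M))"
    "\<And>c. c \<in> C \<Longrightarrow> ccube c (l / M) \<subseteq> ccube p l"
proof -
  define h where "h = l / M"
  have h: "0 < h" "real M * h = l" using M l by (auto simp: h_def)
  define I where "I = (UNIV :: 'n set) \<rightarrow>\<^sub>E {..<M}"
  define P :: "('n \<Rightarrow> nat) \<Rightarrow> real ^ 'n" where
    "P = (\<lambda>k. \<chi> i. p $ i - l / 2 + (real (k i) + 1/2) * h)"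
  have fin: "finite I" by (simp add: I_def finite_PiE)
  have cI: "card I = M ^ CARD('n)" by (simp add: I_def card_PiE)
  show thesis
    unfolding h_def[symmetric]
  proof
    show "finite (P ` I)" using fin by simp
    show "card (P ` I) \<le> M ^ CARD('n)" using card_image_le[OF fin] cI by metis
    show "ccube p l \<subseteq> (\<Union>c\<in>P ` I. ccube c (l / M))"
      unfolding h_def[symmetric]
    proof
      fix x assume x: "x \<in> ccube p l"
      have "\<exists>k<M. \<bar>(x $ i - p $ i + l / 2) - (real k + 1/2) * h\<bar> \<le> h / 2" for i
      proof -
        have "\<bar>x $ i - p $ i\<bar> \<le> l / 2" using x by (auto simp: mem_ccube)
        then have "- (l/2) \<le> x $ i - p $ i" "x $ i - p $ i \<le> l/2" by linarith+
        then show ?thesis by (intro grid_point M h) (unfold h, linarith+)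
      qed
      then obtain k where k: "\<And>i. k i < M"
        "\<And>i. \<bar>(x $ i - p $ i + l / 2) - (real (k i) + 1/2) * h\<bar> \<le> h / 2" by metis
      have "k \<in> I" using k by (auto simp: I_def)
      moreover have "x \<in> ccube (P k) h"
        unfolding mem_ccube
      proof
        fix i
        have "x $ i - P k $ i = (x $ i - p $ i + l / 2) - (real (k i) + 1/2) * h"
          by (simp add: P_def)
        then show "\<bar>x $ i - P k $ i\<bar> \<le> h / 2"
          using k(2)[of i] by metis
      qed
      ultimately show "x \<in> (\<Union>c\<in>P ` I. ccube c h)" by auto
    qed
    fix c assume "c \<in> P ` I"
    then obtain k where k: "k \<in> I" "c = P k" by auto
    show "ccube c (l / M) \<subseteq> ccube p l"
      unfolding h_def[symmetric] mem_ccube subset_iff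
    proof (intro allI impI)
      fix x i assume x: "\<forall>i. \<bar>x $ i - c $ i\<bar> \<le> h / 2"
      have "k i < M" using k by (auto simp: I_def)
      then have k1: "real (k i) + 1 \<le> M" by linarith
      have "0 \<le> real (k i) * h" using h(1) by simp
      moreover have "real (k i) * h + h \<le> l"
        using mult_right_mono[OF k1 less_imp_le[OF h(1)]] by (simp add: distrib_right h(2))
      moreover have "c $ i = p $ i - l/2 + real (k i) * h + h / 2"
        by (simp add: k(2) P_def distrib_right add_divide_distrib)
      moreover have "\<bar>x $ i - c $ i\<bar> \<le> h / 2" using x by blast
      ultimately show "\<bar>x $ i - p $ i\<bar> \<le> l / 2" by arith
    qed
  qed
qed

section \<open>Mean deviations\<close>

text \<open>Unnormalised and with values in \<open>ennreal\<close>, so that subadditivity over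
  covers can be used before integrability is known; \<open>a\<close> may be any reference
  value.\<close>

abbreviation dev :: "(real ^ 'n \<Rightarrow> real) \<Rightarrow> real \<Rightarrow> (real ^ 'n) set \<Rightarrow> ennreal" where
  "dev f a S \<equiv> (\<integral>\<^sup>+x. ennreal \<bar>f x - a\<bar> * indicator S x \<partial>lebesgue)"

lemma nn_integral_finite_cover:
  assumes "finite C" "S \<subseteq> (\<Union>c\<in>C. Q c)"
    "\<And>c. c \<in> C \<Longrightarrow> (\<lambda>x. g x * indicator (Q c) x :: ennreal) \<in> borel_measurable M"
  shows "(\<integral>\<^sup>+x. g x * indicator S x \<partial>M) \<le> (\<Sum>c\<in>C. \<integral>\<^sup>+x. g x * indicator (Q c) x \<partial>M)"
proof -
  have "(\<integral>\<^sup>+x. g x * indicator S x \<partial>M) \<le> (\<integral>\<^sup>+x. (\<Sum>c\<in>C. g x * indicator (Q c) x) \<partial>M)"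
  proof (rule nn_integral_mono)
    fix x
    show "g x * indicator S x \<le> (\<Sum>c\<in>C. g x * indicator (Q c) x)"
    proof (cases "x \<in> S")
      case True
      then obtain c where c: "c \<in> C" "x \<in> Q c" using assms(2) by auto
      have "g x * indicator (Q c) x \<le> (\<Sum>c\<in>C. g x * indicator (Q c) x)"
        using c assms(1) by (intro member_le_sum) auto
      then show ?thesis using c True by simp
    qed simp
  qed
  also have "\<dots> = (\<Sum>c\<in>C. \<integral>\<^sup>+x. g x * indicator (Q c) x \<partial>M)"
    using assms(3) by (rule nn_integral_sum)
  finally show ?thesis .
qed

lemma set_integrable_dev:
  fixes f :: "real ^ 'n \<Rightarrow> real"
  assumes "set_integrable lebesgue Q f" "Q \<in> lmeasurable"
  shows "set_integrable lebesgue Q (\<lambda>x. \<bar>f x - a\<bar>)"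
proof -
  have "set_integrable lebesgue Q (\<lambda>x. a)"
    using assms(2) by (auto simp: set_integrable_def fmeasurable_def)
  then have "set_integrable lebesgue Q (\<lambda>x. f x - a)" by (rule set_integral_diff(1)[OF assms(1)])
  then show ?thesis by (rule set_integrable_abs)
qed

lemma dev_measurable:
  fixes f :: "real ^ 'n \<Rightarrow> real"
  assumes "set_integrable lebesgue Q f" "Q \<in> lmeasurable"
  shows "(\<lambda>x. ennreal \<bar>f x - a\<bar> * indicator Q x) \<in> borel_measurable lebesgue"
proof -
  have "(\<lambda>x. indicator Q x *\<^sub>R \<bar>f x - a\<bar>) \<in> borel_measurable lebesgue"
    using set_integrable_dev[OF assms] unfolding set_integrable_def by (rule borel_measurable_integrable)
  then have "(\<lambda>x. ennreal (indicator Q x *\<^sub>R \<bar>f x - a\<bar>)) \<in> borel_measurable lebesgue" by simp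
  then show ?thesis by (rule measurable_cong[THEN iffD1, rotated]) (auto simp: indicator_def)
qed

lemma dev_eq_LINT:
  fixes f :: "real ^ 'n \<Rightarrow> real"
  assumes "set_integrable lebesgue Q f" "Q \<in> lmeasurable"
  shows "dev f a Q = ennreal (LINT x:Q|lebesgue. \<bar>f x - a\<bar>)"
proof -
  have "dev f a Q = (\<integral>\<^sup>+x. ennreal (indicator Q x *\<^sub>R \<bar>f x - a\<bar>) \<partial>lebesgue)"
    by (rule nn_integral_cong) (auto simp: indicator_def)
  also have "\<dots> = ennreal (LINT x:Q|lebesgue. \<bar>f x - a\<bar>)"
    unfolding set_lebesgue_integral_def
    using set_integrable_dev[OF assms] unfolding set_integrable_def
    by (rule nn_integral_eq_integral) auto
  finally show ?thesis .
qed

lemma dev_eq_mean_osc: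
  fixes f :: "real ^ 'n \<Rightarrow> real"
  assumes "set_integrable lebesgue Q f" "Q \<in> lmeasurable" "0 < measure lebesgue Q"
  shows "dev f (avg f Q) Q = ennreal (mean_osc f Q * measure lebesgue Q)"
  using assms(3) by (simp add: dev_eq_LINT[OF assms(1,2)] mean_osc_def avg_def[of "\<lambda>x. \<bar>f x - avg f Q\<bar>"])

lemma dev_integrand_measurable:
  assumes [measurable]: "f \<in> borel_measurable lebesgue" "S \<in> sets lebesgue"
  shows "(\<lambda>x. ennreal \<bar>f x - a\<bar> * indicator S x) \<in> borel_measurable lebesgue"
  by measurable

lemma dev_shift:
  fixes f :: "real ^ 'n \<Rightarrow> real"
  assumes "(\<lambda>x. ennreal \<bar>f x - a\<bar> * indicator Q x) \<in> borel_measurable lebesgue" "Q \<in> sets lebesgue"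
  shows "dev f b Q \<le> dev f a Q + ennreal \<bar>a - b\<bar> * emeasure lebesgue Q"
proof -
  have "dev f b Q \<le> (\<integral>\<^sup>+x. ennreal \<bar>f x - a\<bar> * indicator Q x + ennreal \<bar>a - b\<bar> * indicator Q x \<partial>lebesgue)"
    by (rule nn_integral_mono)
      (auto simp: indicator_def ennreal_plus[symmetric] simp del: ennreal_plus intro!: ennreal_leI)
  also have "\<dots> = dev f a Q + ennreal \<bar>a - b\<bar> * emeasure lebesgue Q"
    using assms by (subst nn_integral_add) (auto simp: nn_integral_cmult)
  finally show ?thesis .
qed

lemma dev_mono: "S \<subseteq> S' \<Longrightarrow> dev f a S \<le> dev f a S'"
  by (intro nn_integral_mono mult_left_mono) (auto simp: indicator_def)

lemma avg_near_of_dev: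
  fixes f :: "real ^ 'n \<Rightarrow> real"
  assumes "set_integrable lebesgue Q f" "Q \<in> lmeasurable" "0 < measure lebesgue Q"
    and "dev f a Q \<le> ennreal B" "0 \<le> B"
  shows "\<bar>avg f Q - a\<bar> \<le> B / measure lebesgue Q"
proof -
  let ?m = "measure lebesgue Q"
  have c: "set_integrable lebesgue Q (\<lambda>x. a)"
    using assms(2) by (auto simp: set_integrable_def fmeasurable_def)
  have i: "set_integrable lebesgue Q (\<lambda>x. f x - a)" using set_integral_diff(1)[OF assms(1) c] .
  have "(LINT x:Q|lebesgue. f x - a) = (LINT x:Q|lebesgue. f x) - ?m * a"
    using set_integral_diff(2)[OF assms(1) c] assms(2)
    by (simp add: set_lebesgue_integral_def fmeasurable_def)
  then have "avg f Q - a = (LINT x:Q|lebesgue. f x - a) / ?m"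
    using assms(3) by (simp add: avg_def field_simps)
  moreover have "\<bar>LINT x:Q|lebesgue. f x - a\<bar> \<le> (LINT x:Q|lebesgue. \<bar>f x - a\<bar>)"
    using set_integral_norm_bound[OF i] by simp
  moreover have "(LINT x:Q|lebesgue. \<bar>f x - a\<bar>) \<le> B"
    using assms(4,5) by (simp add: dev_eq_LINT[OF assms(1,2)] ennreal_le_iff)
  ultimately show ?thesis using assms(3) by (simp add: abs_divide divide_right_mono)
qed

text \<open>Any constant may serve as reference value: passing from \<open>a\<close> to the mean
  costs at most the deviation from \<open>a\<close> once more, hence the factor 2.\<close>

lemma mean_osc_le_of_dev:
  fixes f :: "real ^ 'n \<Rightarrow> real"
  assumes "set_integrable lebesgue Q f" "Q \<in> lmeasurable" "0 < measure lebesgue Q"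
    and "dev f a Q \<le> ennreal B" "0 \<le> B"
  shows "mean_osc f Q \<le> 2 * B / measure lebesgue Q"
proof -
  let ?m = "measure lebesgue Q"
  have "dev f (avg f Q) Q \<le> dev f a Q + ennreal \<bar>a - avg f Q\<bar> * emeasure lebesgue Q"
    using assms(2) by (intro dev_shift dev_measurable assms) auto
  also have "\<dots> \<le> ennreal B + ennreal (B / ?m) * ennreal ?m"
    using avg_near_of_dev[OF assms] assms(2)
    by (intro add_mono assms mult_mono ennreal_leI) (auto simp: emeasure_eq_measure2 abs_minus_commute)
  also have "\<dots> = ennreal (2 * B)"
    using assms(3,5) by (simp add: ennreal_mult[symmetric] ennreal_plus[symmetric] del: ennreal_plus)
  finally have "mean_osc f Q * ?m \<le> 2 * B"
    using assms by (simp add: dev_eq_mean_osc ennreal_le_iff)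
  then show ?thesis using assms(3) by (simp add: field_simps)
qed

lemma dev_Un:
  assumes "f \<in> borel_measurable lebesgue" "S \<in> sets lebesgue" "T \<in> sets lebesgue"
  shows "dev f a (S \<union> T) \<le> dev f a S + dev f a T"
proof -
  have "dev f a (S \<union> T)
      \<le> (\<integral>\<^sup>+x. ennreal \<bar>f x - a\<bar> * indicator S x + ennreal \<bar>f x - a\<bar> * indicator T x \<partial>lebesgue)"
    by (rule nn_integral_mono) (auto simp: indicator_def)
  also have "\<dots> = dev f a S + dev f a T"
    using assms by (intro nn_integral_add dev_integrand_measurable)
  finally show ?thesis .
qed

lemma dev_le_const:
  fixes p :: "real ^ 'n"
  assumes "\<And>x. x \<in> S \<Longrightarrow> \<bar>f x - a\<bar> \<le> B" "S \<subseteq> ccube p l" "0 \<le> B" "0 \<le> l"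
  shows "dev f a S \<le> ennreal (B * l ^ CARD('n))"
proof -
  have "dev f a S \<le> (\<integral>\<^sup>+x. ennreal B * indicator (ccube p l) x \<partial>lebesgue)"
    using assms(1,2) by (intro nn_integral_mono) (auto simp: indicator_def intro!: ennreal_leI)
  also have "\<dots> = ennreal B * ennreal (l ^ CARD('n))"
    unfolding emeasure_ccube[OF assms(4), of p, symmetric] by (rule nn_integral_cmult_indicator) (rule ccube_sets)
  also have "\<dots> = ennreal (B * l ^ CARD('n))" using assms by (simp add: ennreal_mult)
  finally show ?thesis .
qed

text \<open>This is how the extension becomes integrable on cubes: a finite deviation from some
  constant is established first.\<close>

lemma set_integrable_of_dev:
  fixes f :: "real ^ 'n \<Rightarrow> real"
  assumes "f \<in> borel_measurable lebesgue" "Q \<in> lmeasurable" "dev f a Q \<le> ennreal B"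
  shows "set_integrable lebesgue Q f"
proof -
  have Q: "Q \<in> sets lebesgue" using assms(2) by (rule fmeasurableD)
  have "integrable lebesgue (\<lambda>x. indicator Q x *\<^sub>R (f x - a))"
    unfolding integrable_iff_bounded
  proof
    show "(\<lambda>x. indicator Q x *\<^sub>R (f x - a)) \<in> borel_measurable lebesgue"
      using assms(1) Q by measurable
    have "(\<integral>\<^sup>+x. ennreal (norm (indicator Q x *\<^sub>R (f x - a))) \<partial>lebesgue) = dev f a Q"
      by (rule nn_integral_cong) (auto simp: indicator_def)
    then show "(\<integral>\<^sup>+x. ennreal (norm (indicator Q x *\<^sub>R (f x - a))) \<partial>lebesgue) < \<infinity>"
      using le_less_trans[OF assms(3) ennreal_less_top] by simp
  qed
  then have "set_integrable lebesgue Q (\<lambda>x. f x - a)" by (simp add: set_integrable_def)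
  moreover have "set_integrable lebesgue Q (\<lambda>x. a)"
    using assms(2) by (auto simp: set_integrable_def fmeasurable_def)
  ultimately have "set_integrable lebesgue Q (\<lambda>x. (f x - a) + a)" by (rule set_integral_add(1))
  then show ?thesis by simp
qed

section \<open>Chains along rectifiable curves\<close>

text \<open>Greedy subdivision: while the end point is farther than \<open>h\<close>, the
  intermediate value theorem gives a next point at distance exactly \<open>h\<close>. Each such step
  uses up \<open>h\<close> of the length, so at most \<open>L / h\<close> of them precede the last
  one.\<close>

lemma arclength_chain:
  fixes g :: "real \<Rightarrow> 'a::metric_space" and \<phi> :: "'a \<Rightarrow> real"
  assumes path: "path g" and h: "0 < h" and len: "arclength g \<le> ennreal L" and L: "0 \<le> L"
    and step: "\<And>z w. z \<in> path_image g \<Longrightarrow> w \<in> path_image g \<Longrightarrow> dist z w \<le> h \<Longrightarrow> \<bar>\<phi> z - \<phi> w\<bar> \<le> D"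
  shows "\<bar>\<phi> (pathstart g) - \<phi> (pathfinish g)\<bar> \<le> (L / h + 1) * D"
proof -
  define S where "S ts = (\<Sum>i<length ts - 1. dist (g (ts ! i)) (g (ts ! Suc i)))" for ts
  have S_Cons: "S (t # u # ts) = dist (g t) (g u) + S (u # ts)" for t u ts
    by (simp add: S_def sum.lessThan_Suc_shift del: sum.lessThan_Suc)
  have im: "t \<in> {0..1} \<Longrightarrow> g t \<in> path_image g" for t by (simp add: path_image_def)
  have D: "0 \<le> D" using step[OF im im, of 0 0] h by simp
  \<comment> \<open>The rest of the curve is measured by inscribed polygons with nodes in
    \<open>{t..1}\<close>. Prefixing \<open>t\<close> to the nodes from \<open>u\<close> on shows
    that a step of length \<open>h\<close> lowers the bound for the rest by
    \<open>h\<close>.\<close>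
  have claim: "\<bar>\<phi> (g t) - \<phi> (g 1)\<bar> \<le> (real m + 1) * D"
    if "t \<in> {0..1}" "\<And>ts. sorted ts \<Longrightarrow> set ts \<subseteq> {t..1} \<Longrightarrow> S ts < (real m + 1) * h" for m t
    using that
  proof (induction m arbitrary: t)
    case (0 t)
    have "S [t, 1] < h" using 0(2)[of "[t, 1]"] 0(1) by simp
    then have "dist (g t) (g 1) \<le> h" by (simp add: S_def)
    then show ?case using step[OF im im, of t 1] 0(1) by simp
  next
    case (Suc m t)
    show ?case
    proof (cases "dist (g t) (g 1) \<le> h")
      case True
      then have "\<bar>\<phi> (g t) - \<phi> (g 1)\<bar> \<le> D" using step[OF im im, of t 1] Suc(2) by simp
      also have "\<dots> \<le> (real (Suc m) + 1) * D" using D by (simp add: distrib_right)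
      finally show ?thesis .
    next
      case False
      have "continuous_on {t..1} (\<lambda>u. dist (g t) (g u))"
        using path Suc(2) unfolding path_def
        by (intro continuous_intros) (auto intro: continuous_on_subset)
      then obtain u where u: "t \<le> u" "u \<le> 1" "dist (g t) (g u) = h"
        using IVT'[of "\<lambda>u. dist (g t) (g u)" t h 1] False h Suc(2) by auto
      have "\<bar>\<phi> (g u) - \<phi> (g 1)\<bar> \<le> (real m + 1) * D"
      proof (rule Suc(1))
        show "u \<in> {0..1}" using u Suc(2) by auto
        fix ts assume ts: "sorted ts" "set ts \<subseteq> {u..1}"
        show "S ts < (real m + 1) * h"
        proof (cases ts)
          case Nil then show ?thesis using h by (simp add: S_def)
        next
          case (Cons v vs)
          have "S (t # u # ts) < (real (Suc m) + 1) * h"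
            using ts u by (intro Suc(3)) (auto simp: subset_iff)
          then have "h + (dist (g u) (g v) + S ts) < (real (Suc m) + 1) * h"
            by (simp add: S_Cons u Cons)
          moreover have "(real (Suc m) + 1) * h = (real m + 1) * h + h" by (simp add: distrib_right)
          ultimately show ?thesis using zero_le_dist[of "g u" "g v"] by linarith
        qed
      qed
      moreover have "\<bar>\<phi> (g t) - \<phi> (g u)\<bar> \<le> D"
        using step[OF im im, of t u] u Suc(2) by simp
      ultimately show ?thesis by (simp add: distrib_right)
    qed
  qed
  define m where "m = nat \<lfloor>L / h\<rfloor>"
  have m: "real m \<le> L / h" "L / h < real m + 1"
    using L h by (simp_all add: m_def)
  have "\<bar>\<phi> (g 0) - \<phi> (g 1)\<bar> \<le> (real m + 1) * D"
  proof (rule claim)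
    fix ts :: "real list" assume ts: "sorted ts" "set ts \<subseteq> {0..1}"
    have "ennreal (S ts) = (\<Sum>i<length ts - 1. ennreal (dist (g (ts ! i)) (g (ts ! Suc i))))"
      unfolding S_def by (rule sum_ennreal[symmetric]) simp
    also have "\<dots> \<le> arclength g" unfolding arclength_def using ts by (intro SUP_upper) auto
    finally have "ennreal (S ts) \<le> ennreal L" using len by (rule order_trans)
    then have "S ts \<le> L" using L by (simp add: ennreal_le_iff)
    also have "L < (real m + 1) * h" using m(2) h by (simp add: field_simps)
    finally show "S ts < (real m + 1) * h" .
  qed simp
  also have "\<dots> \<le> (L / h + 1) * D" using m(1) D by (intro mult_right_mono) auto
  finally show ?thesis by (simp add: pathstart_def pathfinish_def)
qed

lemma dist_ivt:
  fixes S :: "'a::metric_space set"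
  assumes "connected S" "x \<in> S" "y \<in> S" "0 \<le> r" "r \<le> dist x y"
  obtains z where "z \<in> S" "dist x z = r"
proof -
  have "connected (dist x ` S)"
    by (intro connected_continuous_image assms continuous_intros)
  moreover have "dist x x \<in> dist x ` S" "dist x y \<in> dist x ` S" using assms by blast+
  ultimately have "{dist x x..dist x y} \<subseteq> dist x ` S" by (rule connected_contains_Icc)
  then have "r \<in> dist x ` S" using assms by auto
  then show thesis using that by auto
qed

section \<open>Linear extension of the limit functional\<close>

text \<open>The operator has to be additive at every point, also at boundary points where the
  averages of a general \<open>f\<close> may diverge and \<open>lim\<close> is unspecified. Putting
  0 there would spoil Lipschitz continuity. So \<open>lim\<close> is taken on a basis of the
  convergent sequences and extended linearly to all sequences.\<close>

lemma linear_limit: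
  obtains L :: "(nat \<Rightarrow> real) \<Rightarrow> real" where
    "\<And>u v. L (\<lambda>k. u k + v k) = L u + L v" "\<And>c u. L (\<lambda>k. c * u k) = c * L u"
    "\<And>u l. u \<longlonglongrightarrow> l \<Longrightarrow> L u = l"
proof -
  interpret vs: vector_space_pair "\<lambda>c (u :: nat \<Rightarrow> real) k. c * u k" "(*) :: real \<Rightarrow> real \<Rightarrow> real"
    by unfold_locales (auto simp: algebra_simps plus_fun_def fun_eq_iff)
  let ?C = "{u :: nat \<Rightarrow> real. convergent u}"
  obtain B where B: "B \<subseteq> ?C" "\<not> vs.vs1.dependent B" "?C \<subseteq> vs.vs1.span B"
    using vs.vs1.maximal_independent_subset[of ?C] by metis
  obtain g where g: "Vector_Spaces.linear (\<lambda>c (u :: nat \<Rightarrow> real) k. c * u k) ((*) :: real \<Rightarrow> real \<Rightarrow> real) g" "\<forall>u\<in>B. g u = lim u"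
    using vs.linear_independent_extend[OF B(2), of lim] by blast
  interpret g: Vector_Spaces.linear "\<lambda>c (u :: nat \<Rightarrow> real) k. c * u k" "(*) :: real \<Rightarrow> real \<Rightarrow> real" g by (rule g(1))
  \<comment> \<open>Convergence is carried through the induction because the sum rule for
    \<open>lim\<close> depends on it.\<close>
  have sp: "g u = lim u \<and> convergent u" if "u \<in> vs.vs1.span B" for u
    using that
  proof (induction rule: vs.vs1.span_induct_alt)
    case base
    have "g (\<lambda>k. 0) = 0" using g.scale[of 0 "\<lambda>k. 0"] by simp
    moreover have "lim (\<lambda>k. 0 :: real) = 0" by (rule limI) simp
    ultimately show ?case unfolding zero_fun_def by (simp add: convergent_const)
  next
    case (step c x y)
    have x: "g x = lim x" "convergent x" using step B(1) g(2) by auto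
    have "(\<lambda>k. c * x k + y k) \<longlonglongrightarrow> c * lim x + lim y"
      using x(2) step(2) by (intro tendsto_intros) (auto simp: convergent_LIMSEQ_iff)
    moreover have "(\<lambda>k. c * x k) + y = (\<lambda>k. c * x k + y k)" by (simp add: plus_fun_def)
    ultimately show ?case using x step(2) g.add[of "\<lambda>k. c * x k" y] g.scale[of c x]
      by (auto simp: limI convergent_def)
  qed
  show thesis
  proof (rule that[of g])
    fix u v show "g (\<lambda>k. u k + v k) = g u + g v" using g.add[of u v] by (simp add: plus_fun_def)
  next
    fix c u show "g (\<lambda>k. c * u k) = c * g u" by (rule g.scale)
  next
    fix u :: "nat \<Rightarrow> real" and l assume u: "u \<longlonglongrightarrow> l"
    then have "u \<in> ?C" by (auto simp: convergent_def)
    then show "g u = l" using sp B(3) limI[OF u] by auto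
  qed
qed

section \<open>Geometry of locally uniform domains\<close>

text \<open>\<open>rn\<close> is the diameter of the unit cube. Of the scale \<open>\<rho>\<close>
  only its smallness is recorded, which \<open>bmo_scale\<close> provides. The assumption
  \<open>big\<close> supplies a cube on which the norm bounds the mean of the absolute
  value.\<close>

locale loc_uniform =
  fixes \<Omega> :: "(real ^ 'n) set" and \<epsilon> \<delta> \<rho> rn :: real
  assumes rn_def: "rn = sqrt CARD('n)"
    and eps: "0 < \<epsilon>" "\<epsilon> \<le> 1" and delta: "0 < \<delta>" and dom: "eps_delta_domain \<epsilon> \<delta> \<Omega>"
    and rho: "0 < \<rho>" "rn * \<rho> \<le> \<epsilon> * \<delta> / 320"
    and big: "\<exists>(a, l) \<in> cubes_in \<Omega>. \<rho> \<le> l"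
begin

lemma rn_ge_1: "1 \<le> rn" by (simp add: rn_def)

lemma ccube_subset_cball_rn: "0 \<le> s \<Longrightarrow> ccube (p :: real ^ 'n) s \<subseteq> cball p (rn * s / 2)"
  unfolding rn_def by (rule ccube_subset_cball)

lemma open_dom: "open \<Omega>" and connected_dom: "connected \<Omega>"
  using dom by (auto simp: eps_delta_domain_def)

lemma rho_delta: "320 * \<rho> \<le> \<delta>"
proof -
  have "1 * \<rho> \<le> rn * \<rho>" using rho rn_ge_1 by (intro mult_right_mono) auto
  moreover have "\<epsilon> * \<delta> \<le> 1 * \<delta>" using eps delta by (intro mult_right_mono) auto
  ultimately show ?thesis using rho(2) by simp
qed

definition locint :: "(real ^ 'n \<Rightarrow> real) \<Rightarrow> bool" where
  "locint f \<longleftrightarrow> (\<forall>(a, l) \<in> cubes_in \<Omega>. set_integrable lebesgue (cube a l) f)"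

definition osc_bd :: "(real ^ 'n \<Rightarrow> real) \<Rightarrow> real \<Rightarrow> real \<Rightarrow> bool" where
  "osc_bd f t W \<longleftrightarrow>
     0 \<le> W \<and> (\<forall>p s. 0 < s \<longrightarrow> s \<le> t \<longrightarrow> ccube p s \<subseteq> \<Omega> \<longrightarrow> mean_osc f (ccube p s) \<le> W)"

lemma osc_bdD: "osc_bd f t W \<Longrightarrow> 0 < s \<Longrightarrow> s \<le> t \<Longrightarrow> ccube p s \<subseteq> \<Omega> \<Longrightarrow> mean_osc f (ccube p s) \<le> W"
  by (auto simp: osc_bd_def)

lemma osc_bd_nonneg: "osc_bd f t W \<Longrightarrow> 0 \<le> W"
  by (simp add: osc_bd_def)

lemma osc_bd_mono: "osc_bd f t W \<Longrightarrow> s \<le> t \<Longrightarrow> osc_bd f s W"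
  by (auto simp: osc_bd_def)

lemma locintD: "locint f \<Longrightarrow> 0 < s \<Longrightarrow> ccube p s \<subseteq> \<Omega> \<Longrightarrow> set_integrable lebesgue (ccube p s) f"
  by (auto simp: locint_def cubes_in_def ccube_def)

lemma dev_ccube:
  assumes "locint f" "osc_bd f t W" "0 < s" "s \<le> t" "ccube p s \<subseteq> \<Omega>"
  shows "dev f (avg f (ccube p s)) (ccube p s) \<le> ennreal (W * s ^ CARD('n))"
  using assms by (subst dev_eq_mean_osc) (auto simp: measure_ccube intro!: locintD ennreal_leI mult_right_mono osc_bdD)

text \<open>The deviation on the outer cube bounds that on the inner one; dividing by the volume of
  the inner cube produces the ratio of volumes.\<close>

lemma avg_nested:
  assumes "locint f" "osc_bd f t W" "0 < s" "0 < s'" "s' \<le> t" "ccube p' s' \<subseteq> \<Omega>" "ccube p s \<subseteq> ccube p' s'"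
  shows "\<bar>avg f (ccube p s) - avg f (ccube p' s')\<bar> \<le> W * (s' / s) ^ CARD('n)"
proof -
  have "\<bar>avg f (ccube p s) - avg f (ccube p' s')\<bar> \<le> (W * s' ^ CARD('n)) / measure lebesgue (ccube p s)"
  proof (rule avg_near_of_dev)
    show "set_integrable lebesgue (ccube p s) f" using assms by (intro locintD) auto
    show "dev f (avg f (ccube p' s')) (ccube p s) \<le> ennreal (W * s' ^ CARD('n))"
      using dev_mono[OF assms(7)] dev_ccube[OF assms(1,2,4,5,6)] by (rule order_trans)
  qed (use assms osc_bd_nonneg in \<open>auto simp: measure_ccube\<close>)
  then show ?thesis using assms by (simp add: measure_ccube power_divide)
qed

section \<open>Balls around points of curves, corkscrew points, and large cubes\<close>

lemma ball_subset_dom: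
  assumes "z \<in> \<Omega>" "ennreal t \<le> dist_to_set z (frontier \<Omega>)"
  shows "ball z t \<subseteq> \<Omega>"
proof (rule ccontr)
  assume n: "\<not> ball z t \<subseteq> \<Omega>"
  then have "0 < t" by (metis ball_eq_empty empty_subsetI not_le)
  then have "z \<in> ball z t" by simp
  \<comment> \<open>A connected set that meets both \<open>\<Omega>\<close> and its complement meets
    the frontier.\<close>
  then have "ball z t \<inter> frontier \<Omega> \<noteq> {}"
    using n assms(1) by (intro connected_Int_frontier connected_ball) blast+
  then obtain w where w: "w \<in> frontier \<Omega>" "dist z w < t" by auto
  have "dist_to_set z (frontier \<Omega>) \<le> ennreal (dist z w)"
    unfolding dist_to_set_def using w by (intro INF_lower)
  then have "ennreal t \<le> ennreal (dist z w)" using assms(2) by (rule order_trans[rotated])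
  then show False using w by (simp add: ennreal_le_iff)
qed

lemma curve:
  assumes "x \<in> \<Omega>" "y \<in> \<Omega>" "dist x y < \<delta>"
  obtains \<gamma> where "path \<gamma>" "pathstart \<gamma> = x" "pathfinish \<gamma> = y"
    "arclength \<gamma> \<le> ennreal (dist x y / \<epsilon>)" "path_image \<gamma> \<subseteq> \<Omega>"
    "\<And>z. z \<in> path_image \<gamma> \<Longrightarrow> ball z (\<epsilon> * (dist x z * dist z y / dist x y)) \<subseteq> \<Omega>"
proof -
  obtain \<gamma> where g: "rectifiable \<gamma>" "pathstart \<gamma> = x" "pathfinish \<gamma> = y" "path_image \<gamma> \<subseteq> \<Omega>"
    "arclength \<gamma> \<le> ennreal (norm (x - y) / \<epsilon>)"
    "\<forall>z\<in>path_image \<gamma>. ennreal (\<epsilon> * (norm (z - x) * norm (z - y) / norm (x - y))) \<le> dist_to_set z (frontier \<Omega>)"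
    using dom assms unfolding eps_delta_domain_def dist_norm by meson
  show thesis
  proof
    show "path \<gamma>" using g by (simp add: rectifiable_def)
    fix z assume z: "z \<in> path_image \<gamma>"
    show "ball z (\<epsilon> * (dist x z * dist z y / dist x y)) \<subseteq> \<Omega>"
      using g z by (intro ball_subset_dom) (auto simp: dist_norm norm_minus_commute)
  qed (use g in \<open>auto simp: dist_norm\<close>)
qed

text \<open>The point of the curve at distance \<open>r / 2\<close> from \<open>x\<close> is at
  least \<open>r / 2\<close> away from \<open>y\<close>, and
  \<open>\<epsilon> * (r / 2)^2 / r = \<epsilon> * r / 4\<close>.\<close>

lemma midpoint_ball:
  assumes "x \<in> \<Omega>" "y \<in> \<Omega>" "dist x y = r" "0 < r" "r < \<delta>"
  obtains z where "dist x z = r / 2" "ball z (\<epsilon> * r / 4) \<subseteq> \<Omega>"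
proof -
  obtain \<gamma> where g: "path \<gamma>" "pathstart \<gamma> = x" "pathfinish \<gamma> = y"
    "\<And>z. z \<in> path_image \<gamma> \<Longrightarrow> ball z (\<epsilon> * (dist x z * dist z y / dist x y)) \<subseteq> \<Omega>"
    using curve[OF assms(1,2)] assms by metis
  have "x \<in> path_image \<gamma>" "y \<in> path_image \<gamma>" using g by (metis pathstart_in_path_image pathfinish_in_path_image)+
  then obtain z where z: "z \<in> path_image \<gamma>" "dist x z = r / 2"
    using dist_ivt[OF connected_path_image[OF g(1)], of x y "r/2"] assms by auto
  have "r / 2 \<le> dist z y" using dist_triangle[of x y z] z assms by simp
  then have "r / 2 * (r / 2) / r \<le> dist x z * dist z y / dist x y"
    unfolding z(2) assms(3) using assms(4) by (intro divide_right_mono mult_left_mono) auto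
  then have "\<epsilon> * (r / 4) \<le> \<epsilon> * (dist x z * dist z y / dist x y)"
    using eps assms(4) by (intro mult_left_mono) auto
  then have "ball z (\<epsilon> * r / 4) \<subseteq> ball z (\<epsilon> * (dist x z * dist z y / dist x y))"
    by (intro subset_ball) simp
  then show thesis using that[OF z(2)] g(4)[OF z(1)] by blast
qed

text \<open>Opposite corners of the large cube are at least \<open>\<rho>\<close> apart, whereas two
  points of the ball are less than \<open>2 * r\<close> apart.\<close>

lemma not_subset_ball:
  assumes "r \<le> \<rho> / 2" shows "\<not> \<Omega> \<subseteq> ball x r"
proof
  assume s: "\<Omega> \<subseteq> ball x r"
  obtain a l where al: "(a, l) \<in> cubes_in \<Omega>" "\<rho> \<le> l" using big by auto
  let ?b = "\<chi> i. a $ i + l"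
  have l: "0 < l" "cube a l \<subseteq> \<Omega>" using al by (auto simp: cubes_in_def)
  have "a \<in> cube a l" "?b \<in> cube a l" using l by (auto simp: cube_def mem_box_cart)
  then have "dist x a < r" "dist x ?b < r" using l s by (auto simp: subset_iff)
  then have "dist a ?b < 2 * r" using dist_triangle[of a ?b x] by (simp add: dist_commute)
  moreover have "l \<le> dist a ?b"
    using component_le_norm_cart[of "?b - a" undefined] l by (simp add: dist_norm norm_minus_commute)
  ultimately show False using assms al by simp
qed

lemma corkscrew_in:
  assumes "x \<in> \<Omega>" "0 < r" "r \<le> \<rho> / 2"
  obtains p where "dist x p = r / 2" "ball p (\<epsilon> * r / 4) \<subseteq> \<Omega>"
proof -
  obtain y where "y \<in> \<Omega>" "r \<le> dist x y" using not_subset_ball[OF assms(3)] by (auto simp: subset_iff not_less)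
  then obtain y' where y: "y' \<in> \<Omega>" "dist x y' = r"
    using dist_ivt[OF connected_dom assms(1)] assms(2) by (metis less_imp_le)
  have "r < \<delta>" using assms(3) rho_delta rho by simp
  then show thesis using midpoint_ball[OF assms(1) y assms(2)] that by blast
qed

lemma dom_nonempty: "\<Omega> \<noteq> {}"
  using not_subset_ball[of 0] rho by auto

lemma infdist_dom_attained:
  assumes "infdist x \<Omega> < r" obtains y where "y \<in> \<Omega>" "dist x y < r"
  using assms dom_nonempty by (auto simp: infdist_notempty cInf_less_iff)

lemma corkscrew:
  assumes "infdist x \<Omega> \<le> r" "0 < r" "r \<le> \<rho> / 2"
  obtains p where "dist x p \<le> 3 * r" "ball p (\<epsilon> / 4 * r) \<subseteq> \<Omega>"
proof -
  \<comment> \<open>Doubling the radius allows for an infimum that is not attained.\<close>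
  obtain y where y: "y \<in> \<Omega>" "dist x y < 2 * r" using infdist_dom_attained[of x "2 * r"] assms by auto
  obtain p where p: "dist y p = r / 2" "ball p (\<epsilon> * r / 4) \<subseteq> \<Omega>"
    using corkscrew_in[OF y(1) assms(2,3)] .
  have "dist x p \<le> 3 * r" using dist_triangle[of x p y] y p assms by simp
  then show thesis using that p by simp
qed

text \<open>If \<open>\<Omega>\<close> lies within \<open>\<delta> / 2\<close> of \<open>x\<close>,
  a large cube shrunk to side \<open>\<rho>\<close> will do. Otherwise two points at distance
  \<open>\<delta> / 2\<close> give a midpoint ball of radius
  \<open>\<epsilon> * \<delta> / 8\<close>, which contains a cube of side \<open>\<rho>\<close>
  because \<open>\<rho>\<close> is small. The distance stays below \<open>\<delta>\<close>, so a
  chain can join \<open>x\<close> to this cube.\<close>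

lemma big_cube_near:
  assumes "x \<in> \<Omega>"
  obtains p where "dist x p \<le> \<delta> / 2" "ccube p \<rho> \<subseteq> \<Omega>"
proof (cases "\<Omega> \<subseteq> ball x (\<delta> / 2)")
  case True
  obtain a l where al: "(a, l) \<in> cubes_in \<Omega>" "\<rho> \<le> l" using big by auto
  define p where "p = a + (\<chi> i. l / 2)"
  have "ccube p l \<subseteq> \<Omega>" using al cube_eq_ccube[of a l] by (auto simp: cubes_in_def p_def)
  moreover have "ccube p \<rho> \<subseteq> ccube p l" using al by (intro ccube_mono) simp
  ultimately have c: "ccube p \<rho> \<subseteq> \<Omega>" by simp
  moreover have "p \<in> ccube p \<rho>" using rho by (simp add: mem_ccube)
  ultimately have "dist x p \<le> \<delta> / 2" using True by (auto simp: subset_iff less_imp_le)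
  then show thesis using that c by blast
next
  case False
  then obtain y where "y \<in> \<Omega>" "\<delta> / 2 \<le> dist x y" by (auto simp: subset_iff not_less)
  then obtain y' where y: "y' \<in> \<Omega>" "dist x y' = \<delta> / 2"
    using dist_ivt[OF connected_dom assms] delta by (metis half_gt_zero less_imp_le)
  obtain p where p: "dist x p = \<delta> / 2 / 2" "ball p (\<epsilon> * (\<delta> / 2) / 4) \<subseteq> \<Omega>"
    using midpoint_ball[OF assms y] delta by auto
  have "0 < \<epsilon> * \<delta>" using eps delta by simp
  then have "cball p (rn * \<rho> / 2) \<subseteq> ball p (\<epsilon> * (\<delta> / 2) / 4)"
    using rho(2) by (intro subsetI) (simp add: order.strict_trans1)
  then have "ccube p \<rho> \<subseteq> \<Omega>" using ccube_subset_cball_rn[of \<rho> p] p rho by fastforce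
  moreover have "dist x p \<le> \<delta> / 2" using p(1) delta by linarith
  ultimately show thesis using that by blast
qed

text \<open>For \<open>s = sig D * t\<close> the cube of side \<open>2 * s\<close> has circumradius
  \<open>rn * s = \<epsilon> * t / (8 * D)\<close>, half the depth
  \<open>\<epsilon> * t / (4 * D)\<close> that is available along the curves of
  \<open>avg_chain\<close>.\<close>

definition sig :: "real \<Rightarrow> real" where "sig D = \<epsilon> / (8 * rn * D)"

text \<open>The number of steps of length \<open>s / 2\<close>, with \<open>s = sig D * t\<close>,
  along a curve of length at most \<open>D * t / \<epsilon>\<close>, times the cost of one
  step.\<close>

definition chain_const :: "real \<Rightarrow> real" where
  "chain_const D = (2 * D / (\<epsilon> * sig D) + 1) * (2 * 2 ^ CARD('n))"

lemma sig_pos: "1 \<le> D \<Longrightarrow> 0 < sig D"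
  using eps rn_ge_1 by (simp add: sig_def)

lemma sig_le: assumes "1 \<le> D" shows "rn * sig D \<le> 1 / 8" "sig D \<le> 1 / 8"
proof -
  have "\<epsilon> \<le> D" using eps assms by simp
  then show "rn * sig D \<le> 1 / 8" using assms by (simp add: sig_def field_simps)
  have "1 * sig D \<le> rn * sig D" using sig_pos[OF assms] rn_ge_1 by (intro mult_right_mono) auto
  then show "sig D \<le> 1 / 8" using \<open>rn * sig D \<le> 1 / 8\<close> by simp
qed

lemma ccube_sig_subset:
  assumes "1 \<le> D" "0 < t" shows "ccube p (2 * (sig D * t)) \<subseteq> ball (p :: real ^ 'n) t"
proof -
  have "ccube p (2 * (sig D * t)) \<subseteq> cball p (rn * (2 * (sig D * t)) / 2)"
    using assms sig_pos[of D] by (intro ccube_subset_cball_rn) simp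
  also have "rn * (2 * (sig D * t)) / 2 < t"
    using sig_le(1)[OF assms(1)] assms(2) mult_right_mono[of "rn * sig D" "1/8" t] by (simp add: mult.assoc)
  then have "cball p (rn * (2 * (sig D * t)) / 2) \<subseteq> ball p t" by auto
  finally show ?thesis .
qed

text \<open>Every point of the curve has depth at least \<open>\<epsilon> * t / (4 * D)\<close>:
  within \<open>t / 2\<close> of an end the given ball serves, and elsewhere the curve condition
  gives \<open>\<epsilon> * (t / 2)^2 / (D * t)\<close>.\<close>

lemma avg_chain:
  assumes f: "locint f" "osc_bd f t W" and t: "0 < t"
    and p: "ball p t \<subseteq> \<Omega>" "ball q t \<subseteq> \<Omega>" and D: "dist p q \<le> D * t" "D * t < \<delta>" "1 \<le> D"
  shows "\<bar>avg f (ccube p (sig D * t)) - avg f (ccube q (sig D * t))\<bar> \<le> chain_const D * W"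
proof -
  have W: "0 \<le> W" using f(2) by (rule osc_bd_nonneg)
  define s where "s = sig D * t"
  have s: "0 < s" using sig_pos[OF D(3)] t by (simp add: s_def)
  define \<tau> where "\<tau> = \<epsilon> / (4 * D)"
  have tau: "0 < \<tau>" "\<tau> \<le> 1/2" using eps D(3) by (auto simp: \<tau>_def field_simps)
  have ns: "rn * s = \<tau> * t / 2" using D(3) rn_ge_1 by (simp add: s_def sig_def \<tau>_def)
  have pq: "p \<in> \<Omega>" "q \<in> \<Omega>" using p t by (auto simp: subset_iff)
  obtain \<gamma> where g: "path \<gamma>" "pathstart \<gamma> = p" "pathfinish \<gamma> = q"
    "arclength \<gamma> \<le> ennreal (dist p q / \<epsilon>)" "path_image \<gamma> \<subseteq> \<Omega>"
    "\<And>z. z \<in> path_image \<gamma> \<Longrightarrow> ball z (\<epsilon> * (dist p z * dist z q / dist p q)) \<subseteq> \<Omega>"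
    using curve[OF pq] D by (smt (verit))
  have deep: "ball z (\<tau> * t) \<subseteq> \<Omega>" if z: "z \<in> path_image \<gamma>" "p \<noteq> q" for z
  proof -
    have tt: "\<tau> * t \<le> t / 2" using tau t mult_right_mono[of \<tau> "1/2" t] by simp
    consider "dist p z \<le> t / 2" | "dist z q \<le> t / 2" | "t / 2 \<le> dist p z" "t / 2 \<le> dist z q" by linarith
    then show ?thesis
    proof cases
      case 1
      have "ball z (\<tau> * t) \<subseteq> ball p t"
      proof
        fix w assume "w \<in> ball z (\<tau> * t)"
        then show "w \<in> ball p t" using dist_triangle[of p w z] 1 tt by simp
      qed
      then show ?thesis using p by simp
    next
      case 2
      have "ball z (\<tau> * t) \<subseteq> ball q t"
      proof
        fix w assume "w \<in> ball z (\<tau> * t)"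
        then show "w \<in> ball q t" using dist_triangle[of q w z] 2 tt by (simp add: dist_commute)
      qed
      then show ?thesis using p by simp
    next
      case 3
      have d: "0 < dist p q" using z by simp
      have "t / 2 * (t / 2) / (D * t) \<le> dist p z * dist z q / dist p q"
        using d D 3 t by (intro frac_le mult_mono) auto
      then have "\<epsilon> * (t / 2 * (t / 2) / (D * t)) \<le> \<epsilon> * (dist p z * dist z q / dist p q)"
        using eps by (intro mult_left_mono) auto
      moreover have "\<epsilon> * (t / 2 * (t / 2) / (D * t)) = \<tau> * t"
        using t D by (simp add: \<tau>_def)
      ultimately have "ball z (\<tau> * t) \<subseteq> ball z (\<epsilon> * (dist p z * dist z q / dist p q))"
        by (intro subset_ball) simp
      then show ?thesis using g(6)[OF z(1)] by simp
    qed
  qed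
  show ?thesis
  proof (cases "p = q")
    case True
    have "0 \<le> chain_const D" using eps D sig_pos[OF D(3)] by (simp add: chain_const_def)
    then show ?thesis using True W by simp
  next
    case False
    have "\<bar>avg f (ccube (pathstart \<gamma>) s) - avg f (ccube (pathfinish \<gamma>) s)\<bar>
        \<le> ((D * t / \<epsilon>) / (s / 2) + 1) * (2 * (W * 2 ^ CARD('n)))"
    proof (rule arclength_chain[OF g(1), where \<phi> = "\<lambda>z. avg f (ccube z s)"])
      have "dist p q / \<epsilon> \<le> D * t / \<epsilon>" using D eps by (intro divide_right_mono) auto
      then show "arclength \<gamma> \<le> ennreal (D * t / \<epsilon>)" using g(4) by (meson ennreal_leI order_trans)
      fix z w assume z: "z \<in> path_image \<gamma>" "w \<in> path_image \<gamma>" "dist z w \<le> s / 2"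
      have sub: "ccube z (2 * s) \<subseteq> \<Omega>"
      proof -
        have "ccube z (2 * s) \<subseteq> cball z (rn * (2 * s) / 2)" using s by (intro ccube_subset_cball_rn) simp
        also have "rn * (2 * s) / 2 < \<tau> * t" using ns mult_pos_pos[OF tau(1) t] by linarith
        then have "cball z (rn * (2 * s) / 2) \<subseteq> ball z (\<tau> * t)" by auto
        finally show ?thesis using deep[OF z(1) False] by simp
      qed
      \<comment> \<open>Both cubes of a step lie in the doubled cube about \<open>z\<close>, whose
        mean links their means.\<close>
      have 1: "ccube z s \<subseteq> ccube z (2 * s)" using s by (intro ccube_mono) simp
      have 2: "ccube w s \<subseteq> ccube z (2 * s)" using s z by (intro ccube_mono) (simp add: dist_commute)
      have st: "2 * s \<le> t" using sig_le(2)[OF D(3)] t mult_right_mono[of "sig D" "1/8" t] by (simp add: s_def)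
      have "\<bar>avg f (ccube z s) - avg f (ccube z (2 * s))\<bar> \<le> W * (2 * s / s) ^ CARD('n)"
        using avg_nested[OF f s _ st sub 1] s by simp
      moreover have "\<bar>avg f (ccube w s) - avg f (ccube z (2 * s))\<bar> \<le> W * (2 * s / s) ^ CARD('n)"
        using avg_nested[OF f s _ st sub 2] s by simp
      ultimately show "\<bar>avg f (ccube z s) - avg f (ccube w s)\<bar> \<le> 2 * (W * 2 ^ CARD('n))"
        using s by simp
    qed (use s D t eps in auto)
    also have "(D * t / \<epsilon>) / (s / 2) = 2 * D / (\<epsilon> * sig D)" using t by (simp add: s_def)
    finally show ?thesis by (simp add: g chain_const_def s_def mult_ac)
  qed
qed

section \<open>Averages with respect to a Lipschitz kernel\<close>

text \<open>Integrability is given on cubes only. By Lindelof countably many balls inside such cubes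
  cover \<open>\<Omega>\<close>. The indicator removes the arbitrary values of \<open>f\<close>
  outside \<open>\<Omega>\<close>.\<close>

lemma locint_measurable:
  assumes "locint f" shows "(\<lambda>x. indicator \<Omega> x * f x) \<in> borel_measurable lebesgue"
proof -
  let ?F = "{ball p t | p t. 0 < t \<and> ccube p (2 * t) \<subseteq> \<Omega>}"
  have "\<Union>?F = \<Omega>"
  proof (intro equalityI subsetI)
    fix x assume "x \<in> \<Union>?F"
    then obtain p t where pt: "0 < t" "ccube p (2 * t) \<subseteq> \<Omega>" "x \<in> ball p t" by blast
    then show "x \<in> \<Omega>" using ball_subset_ccube[of p "2 * t"] by auto
  next
    fix x assume "x \<in> \<Omega>"
    then obtain e where e: "0 < e" "cball x e \<subseteq> \<Omega>" using open_dom open_contains_cball by blast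
    define t where "t = e / rn"
    have t: "0 < t" "rn * t = e" using e rn_ge_1 by (auto simp: t_def)
    have "ccube x (2 * t) \<subseteq> cball x (rn * (2 * t) / 2)" using t by (intro ccube_subset_cball_rn) simp
    then have "ccube x (2 * t) \<subseteq> \<Omega>" using e t by simp
    then have "ball x t \<in> ?F" using t by blast
    moreover have "x \<in> ball x t" using t by simp
    ultimately show "x \<in> \<Union>?F" by blast
  qed
  moreover obtain F' where F': "F' \<subseteq> ?F" "countable F'" "\<Union>F' = \<Union>?F"
    by (rule Lindelof[of ?F]) auto
  ultimately have U: "\<Union>F' = \<Omega>" by simp
  show ?thesis
  proof (rule measurable_piecewise_restrict[of "insert (- \<Omega>) F'"])
    show "countable (insert (- \<Omega>) F')" using F' by simp
    show "space lebesgue \<subseteq> \<Union>(insert (- \<Omega>) F')" using U by auto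
    fix B assume B: "B \<in> insert (- \<Omega>) F'"
    have "open B \<or> B = - \<Omega>" using B F'(1) by auto
    then have s: "B \<in> sets lebesgue" using open_dom by auto
    then show "B \<inter> space lebesgue \<in> sets lebesgue" by simp
    show "(\<lambda>x. indicator \<Omega> x * f x) \<in> borel_measurable (restrict_space lebesgue B)"
    proof (cases "B = - \<Omega>")
      case True
      have "(\<lambda>x. 0 :: real) \<in> borel_measurable (restrict_space lebesgue B)" by simp
      then show ?thesis
        by (rule measurable_cong[THEN iffD1, rotated]) (auto simp: True space_restrict_space)
    next
      case False
      then have "B \<in> ?F" using B F'(1) by auto
      then obtain p t where pt: "B = ball p t" "0 < t" "ccube p (2 * t) \<subseteq> \<Omega>" by blast
      have BQ: "B \<subseteq> ccube p (2 * t)" using ball_subset_ccube[of p "2 * t"] pt by simp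
      have "set_integrable lebesgue (ccube p (2 * t)) f" using locintD[OF assms _ pt(3)] pt(2) by simp
      then have "set_integrable lebesgue B f" by (rule set_integrable_subset) (use BQ s in auto)
      then have "(\<lambda>x. indicator B x *\<^sub>R f x) \<in> borel_measurable lebesgue"
        unfolding set_integrable_def by (rule borel_measurable_integrable)
      then have "(\<lambda>x. indicator B x *\<^sub>R f x) \<in> borel_measurable (restrict_space lebesgue B)"
        by (rule measurable_restrict_space1)
      then show ?thesis
        by (rule measurable_cong[THEN iffD1, rotated])
          (use BQ pt(3) in \<open>auto simp: space_restrict_space indicator_def\<close>)
    qed
  qed
qed

section \<open>Mean deviation on sets of fixed relative depth\<close>

definition deep :: "real ^ 'n \<Rightarrow> real \<Rightarrow> real \<Rightarrow> real \<Rightarrow> (real ^ 'n) set" where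
  "deep x R k r = {y. dist x y \<le> R * r \<and> ball y (k * r) \<subseteq> \<Omega>}"

text \<open>Two points of \<open>deep x R k r\<close> are at most
  \<open>2 * R * r = D * (k * r)\<close> apart for \<open>D = 2 * R / k\<close>; the side is the one
  that \<open>avg_chain\<close> requires for balls of radius \<open>k * r\<close>.\<close>

definition ref_avg :: "(real ^ 'n \<Rightarrow> real) \<Rightarrow> real ^ 'n \<Rightarrow> real \<Rightarrow> real \<Rightarrow> real \<Rightarrow> real" where
  "ref_avg f p R k r = avg f (ccube p (sig (2 * R / k) * (k * r)))"

text \<open>The number of cubes of side \<open>sig D * k\<close> in a cover of a cube of side
  \<open>2 * R\<close>, times the bound for one of them; the factors \<open>W\<close> and
  \<open>r ^ n\<close> are scaled out.\<close>

definition deep_const :: "real \<Rightarrow> real \<Rightarrow> real" where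
  "deep_const R k = (let D = 2 * R / k in
     real (nat \<lceil>4 * R / (sig D * k)\<rceil>) ^ CARD('n) * ((1 + chain_const D) * (sig D * k) ^ CARD('n)))"

lemma chain_const_nonneg: "1 \<le> D \<Longrightarrow> 0 \<le> chain_const D"
  using eps sig_pos[of D] by (simp add: chain_const_def)

lemma deep_const_nonneg: 
  assumes "1 \<le> R" "0 < k" "k \<le> 1" shows "0 \<le> deep_const R k"
proof -
  have D: "1 \<le> 2 * R / k" using assms by (simp add: field_simps)
  show ?thesis unfolding deep_const_def Let_def
    using sig_pos[OF D] chain_const_nonneg[OF D] assms
    by (intro mult_nonneg_nonneg zero_le_power add_nonneg_nonneg of_nat_0_le_iff) auto
qed

text \<open>The set is covered by boundedly many small cubes centred at its own points. Chains tie
  their means to the mean at \<open>p\<close>, so one reference value serves the whole set although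
  it need not be connected.\<close>

lemma dev_deep:
  assumes f: "locint f" "osc_bd f r W" and r: "0 < r" and R: "1 \<le> R" "2 * R * r < \<delta>"
    and k: "0 < k" "k \<le> 1" and p: "p \<in> deep x R k r"
  shows "dev f (ref_avg f p R k r) (deep x R k r) \<le> ennreal (deep_const R k * W * r ^ CARD('n))"
proof -
  define D where "D = 2 * R / k"
  have D: "1 \<le> D" using R k by (simp add: D_def field_simps)
  define s where "s = sig D * (k * r)"
  have s: "0 < s" using sig_pos[OF D] r k by (simp add: s_def)
  define a where "a = avg f (ccube p s)"
  define M where "M = nat \<lceil>4 * R / (sig D * k)\<rceil>"
  have M0: "0 < 4 * R / (sig D * k)" using R k sig_pos[OF D] by simp
  then have M: "0 < M" "4 * R / (sig D * k) \<le> M" by (auto simp: M_def)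
  have W: "0 \<le> W" using f(2) by (rule osc_bd_nonneg)
  have kr: "0 < k * r" "k * r \<le> r" using k r by auto
  have s2: "ccube y (2 * s) \<subseteq> \<Omega>" "ccube y s \<subseteq> \<Omega>" if "ball y (k * r) \<subseteq> \<Omega>" for y
  proof -
    show "ccube y (2 * s) \<subseteq> \<Omega>" using ccube_sig_subset[OF D kr(1), of y] that by (simp add: s_def)
    moreover have "ccube y s \<subseteq> ccube y (2 * s)" using s by (intro ccube_mono) simp
    ultimately show "ccube y s \<subseteq> \<Omega>" by simp
  qed
  have sr: "s \<le> r" using sig_le(2)[OF D] kr mult_right_mono[of "sig D" "1/8" "k * r"] unfolding s_def by linarith
  obtain C where C: "finite C" "card C \<le> M ^ CARD('n)" "ccube x (2 * R * r) \<subseteq> (\<Union>c\<in>C. ccube c (2 * R * r / M))"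
  proof (rule ccube_grid[OF M(1)])
    show "0 < 2 * R * r" using R r by simp
  qed
  define h where "h = 2 * R * r / M"
  have h: "h \<le> s / 2"
  proof -
    have "4 * R \<le> M * (sig D * k)" using M sig_pos[OF D] k by (simp add: field_simps)
    then have "4 * R * r \<le> M * (sig D * k) * r" using r by (intro mult_right_mono) auto
    then show ?thesis using M by (simp add: h_def s_def field_simps)
  qed
  let ?S = "deep x R k r"
  define C' where "C' = {c \<in> C. ccube c h \<inter> ?S \<noteq> {}}"
  \<comment> \<open>A grid cell may leave \<open>\<Omega>\<close>. So each cell that meets the set
    is replaced by a cube about one of its points in the set; as \<open>h \<le> s / 2\<close>, this
    cube contains the cell.\<close>
  define y where "y c = (SOME y. y \<in> ccube c h \<inter> ?S)" for c
  have y: "y c \<in> ccube c h" "y c \<in> ?S" if "c \<in> C'" for c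
  proof -
    have "\<exists>y. y \<in> ccube c h \<inter> ?S" using that by (auto simp: C'_def)
    then have "y c \<in> ccube c h \<inter> ?S" unfolding y_def by (rule someI_ex)
    then show "y c \<in> ccube c h" "y c \<in> ?S" by auto
  qed
  have cover: "?S \<subseteq> (\<Union>c\<in>C'. ccube (y c) s)"
  proof
    fix z assume z: "z \<in> ?S"
    then have "z \<in> ccube x (2 * R * r)" using cball_subset_ccube[of x "2 * R * r"] by (auto simp: deep_def)
    then obtain c where c: "c \<in> C" "z \<in> ccube c h" using C(3) by (auto simp: h_def)
    then have c': "c \<in> C'" using z by (auto simp: C'_def)
    have "z \<in> ccube (y c) s"
      unfolding mem_ccube
    proof
      fix i
      have "\<bar>z $ i - c $ i\<bar> \<le> h / 2" "\<bar>y c $ i - c $ i\<bar> \<le> h / 2"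
        using c(2) y(1)[OF c'] by (auto simp: mem_ccube)
      then show "\<bar>z $ i - y c $ i\<bar> \<le> s / 2" using h by linarith
    qed
    then show "z \<in> (\<Union>c\<in>C'. ccube (y c) s)" using c' by auto
  qed
  have one: "dev f a (ccube z s) \<le> ennreal ((1 + chain_const D) * W * s ^ CARD('n))"
    and int: "set_integrable lebesgue (ccube z s) f"
    if z: "z \<in> ?S" for z
  proof -
    have b: "ball z (k * r) \<subseteq> \<Omega>" "ball p (k * r) \<subseteq> \<Omega>" using z p by (auto simp: deep_def)
    have "dist z p \<le> 2 * R * r" using z p dist_triangle[of z p x] by (auto simp: deep_def dist_commute)
    also have "2 * R * r = D * (k * r)" using k by (simp add: D_def)
    finally have "\<bar>avg f (ccube z s) - a\<bar> \<le> chain_const D * W"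
      unfolding a_def s_def using R k D kr
      by (intro avg_chain f(1) osc_bd_mono[OF f(2)] b) (auto simp: D_def)
    then have 1: "ennreal \<bar>avg f (ccube z s) - a\<bar> * emeasure lebesgue (ccube z s)
       \<le> ennreal (chain_const D * W) * ennreal (s ^ CARD('n))"
      unfolding emeasure_ccube[OF less_imp_le[OF s]] by (intro mult_mono ennreal_leI) auto
    show int: "set_integrable lebesgue (ccube z s) f" using locintD[OF f(1) s s2(2)[OF b(1)]] .
    have "dev f a (ccube z s) \<le> dev f (avg f (ccube z s)) (ccube z s)
        + ennreal \<bar>avg f (ccube z s) - a\<bar> * emeasure lebesgue (ccube z s)"
      by (intro dev_shift dev_measurable int) auto
    also have "\<dots> \<le> ennreal (W * s ^ CARD('n)) + ennreal (chain_const D * W) * ennreal (s ^ CARD('n))"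
      by (intro add_mono dev_ccube[OF f s sr s2(2)[OF b(1)]] 1)
    also have "\<dots> = ennreal ((1 + chain_const D) * W * s ^ CARD('n))"
      using W s chain_const_nonneg[OF D]
      by (simp add: ennreal_mult[symmetric] ennreal_plus[symmetric] algebra_simps del: ennreal_plus)
    finally show "dev f a (ccube z s) \<le> ennreal ((1 + chain_const D) * W * s ^ CARD('n))" .
  qed
  have fin: "finite C'" "card C' \<le> M ^ CARD('n)" using C(1,2) card_mono[OF C(1), of C'] by (auto simp: C'_def)
  have "dev f a ?S \<le> (\<Sum>c\<in>C'. dev f a (ccube (y c) s))"
    by (intro nn_integral_finite_cover fin cover dev_measurable int y) auto
  also have "\<dots> \<le> (\<Sum>c\<in>C'. ennreal ((1 + chain_const D) * W * s ^ CARD('n)))"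
    by (intro sum_mono one y)
  also have "\<dots> = ennreal (real (card C') * ((1 + chain_const D) * W * s ^ CARD('n)))"
    using W s chain_const_nonneg[OF D] by (simp add: ennreal_mult ennreal_of_nat_eq_real_of_nat)
  also have "\<dots> \<le> ennreal (real M ^ CARD('n) * ((1 + chain_const D) * W * s ^ CARD('n)))"
  proof -
    have "real (card C') \<le> real M ^ CARD('n)" using fin(2) by (metis of_nat_le_iff of_nat_power)
    then show ?thesis using W s chain_const_nonneg[OF D] by (intro ennreal_leI mult_right_mono) auto
  qed
  also have "real M ^ CARD('n) * ((1 + chain_const D) * W * s ^ CARD('n)) = deep_const R k * W * r ^ CARD('n)"
    by (simp add: deep_const_def Let_def D_def M_def s_def power_mult_distrib)
  finally show ?thesis by (simp add: a_def s_def ref_avg_def D_def)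
qed

lemma deep_measurable: "deep x R k r \<in> sets lebesgue"
proof -
  have "deep x R k r = cball x (R * r) \<inter> {y. ball y (k * r) \<subseteq> \<Omega>}" by (auto simp: deep_def)
  moreover have "closed {y. ball y (k * r) \<subseteq> \<Omega>}"
  proof -
    have "{y. ball y (k * r) \<subseteq> \<Omega>} = (\<Inter>z\<in>- \<Omega>. {y. k * r \<le> dist y z})"
    proof (intro equalityI subsetI)
      fix y assume "y \<in> (\<Inter>z\<in>- \<Omega>. {y. k * r \<le> dist y z})"
      then have y: "k * r \<le> dist y z" if "z \<notin> \<Omega>" for z using that by auto
      have "w \<in> \<Omega>" if "w \<in> ball y (k * r)" for w
        using y[of w] that by (cases "w \<in> \<Omega>") auto
      then show "y \<in> {y. ball y (k * r) \<subseteq> \<Omega>}" by blast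
    next
      fix y assume "y \<in> {y. ball y (k * r) \<subseteq> \<Omega>}"
      then have y: "ball y (k * r) \<subseteq> \<Omega>" by blast
      have "k * r \<le> dist y z" if "z \<notin> \<Omega>" for z
        using subsetD[OF y, of z] that by (cases "k * r \<le> dist y z") auto
      then show "y \<in> (\<Inter>z\<in>- \<Omega>. {y. k * r \<le> dist y z})" by blast
    qed
    moreover have "closed (\<Inter>z\<in>- \<Omega>. {y. k * r \<le> dist y z})"
      by (intro closed_INT ballI closed_Collect_le continuous_intros)
    ultimately show ?thesis by simp
  qed
  ultimately have "closed (deep x R k r)" by auto
  then show ?thesis by simp
qed

text \<open>A corkscrew point lies within \<open>3 * r\<close> of \<open>x\<close> and has depth
  \<open>\<epsilon> * r / 4\<close>. The reach \<open>4 * r\<close> and the threshold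
  \<open>\<epsilon> * r / 8\<close> leave room for a whole neighbourhood of it in the
  support.\<close>

definition kern :: "real ^ 'n \<Rightarrow> real \<Rightarrow> real ^ 'n \<Rightarrow> real" where
  "kern x r y = max 0 (4 * r - dist x y) * max 0 (infdist y (- \<Omega>) - \<epsilon> * r / 8)"

definition kmass :: "real ^ 'n \<Rightarrow> real \<Rightarrow> real" where
  "kmass x r = (LINT y|lebesgue. kern x r y)"

definition kavg :: "(real ^ 'n \<Rightarrow> real) \<Rightarrow> real ^ 'n \<Rightarrow> real \<Rightarrow> real" where
  "kavg f x r = (LINT y|lebesgue. kern x r y * f y) / kmass x r"

text \<open>For these points and radii the kernel has positive mass, and at most \<open>20 r\<^sup>2\<close> is attained
  because \<open>x\<close> is also close to the complement.\<close>

definition adm :: "real ^ 'n \<Rightarrow> real \<Rightarrow> bool" where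
  "adm x r \<longleftrightarrow> 0 < r \<and> r \<le> \<rho> / 2 \<and> infdist x \<Omega> \<le> r \<and> \<Omega> \<noteq> UNIV \<and> infdist x (- \<Omega>) \<le> r"

lemma kern_nonneg: "0 \<le> kern x r y" by (simp add: kern_def)

lemma kern_support:
  assumes "kern x r y \<noteq> 0" shows "dist x y < 4 * r" "ball y (\<epsilon> / 8 * r) \<subseteq> \<Omega>"
proof -
  show "dist x y < 4 * r" using assms by (auto simp: kern_def split: if_splits)
  have i: "\<epsilon> / 8 * r < infdist y (- \<Omega>)" using assms by (auto simp: kern_def split: if_splits)
  show "ball y (\<epsilon> / 8 * r) \<subseteq> \<Omega>"
  proof
    fix z assume z: "z \<in> ball y (\<epsilon> / 8 * r)"
    show "z \<in> \<Omega>"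
    proof (rule ccontr)
      assume "z \<notin> \<Omega>"
      then have "infdist y (- \<Omega>) \<le> dist y z" by (intro infdist_le) auto
      then show False using i z by simp
    qed
  qed
qed

lemma kern_zero_outside: assumes "0 < r" "y \<notin> \<Omega>" shows "kern x r y = 0"
proof (rule ccontr)
  assume "kern x r y \<noteq> 0"
  then have "ball y (\<epsilon> / 8 * r) \<subseteq> \<Omega>" by (rule kern_support)
  moreover have "y \<in> ball y (\<epsilon> / 8 * r)" using assms eps by simp
  ultimately show False using assms by blast
qed

lemma infdist_compl_ge:
  assumes "ball p t \<subseteq> \<Omega>" "\<Omega> \<noteq> UNIV" shows "t \<le> infdist p (- \<Omega>)"
proof -
  have ne: "- \<Omega> \<noteq> {}" using assms by auto
  show ?thesis
    unfolding infdist_notempty[OF ne] using ne assms(1)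
    by (intro cINF_greatest) (auto simp: subset_iff not_less[symmetric])
qed

lemma kern_height:
  assumes "adm x r" "dist x y < 4 * r"
  shows "max 0 (infdist y (- \<Omega>) - \<epsilon> * r / 8) \<le> 5 * r"
proof -
  have "infdist y (- \<Omega>) \<le> infdist x (- \<Omega>) + dist y x" by (rule infdist_triangle)
  then have "infdist y (- \<Omega>) \<le> 5 * r" using assms by (simp add: adm_def dist_commute)
  moreover have "0 < r" "0 < \<epsilon> * r" using assms eps by (auto simp: adm_def)
  ultimately show ?thesis by simp
qed

lemma kern_le:
  assumes "adm x r" shows "kern x r y \<le> 20 * r\<^sup>2"
proof (cases "dist x y < 4 * r")
  case True
  have "kern x r y \<le> (4 * r) * (5 * r)"
    unfolding kern_def using kern_height[OF assms True] assms
    by (intro mult_mono) (auto simp: adm_def)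
  then show ?thesis by (simp add: power2_eq_square)
qed (simp add: kern_def)

lemma kern_continuous: "continuous_on UNIV (kern x r)"
  unfolding kern_def by (intro continuous_intros)

lemma kern_measurable: "kern x r \<in> borel_measurable lebesgue"
  by (intro measurable_completion) (simp add: borel_measurable_continuous_onI[OF kern_continuous])

lemma kern_integrable:
  assumes "adm x r" shows "integrable lebesgue (kern x r)"
proof (rule Bochner_Integration.integrable_bound[of lebesgue "\<lambda>y. 20 * r\<^sup>2 * indicator (ccube x (8 * r)) y"])
  show "integrable lebesgue (\<lambda>y. 20 * r\<^sup>2 * indicator (ccube x (8 * r)) y)"
    using ccube_lmeasurable[of x "8 * r"]
    by (intro integrable_mult_right integrable_real_indicator) (auto simp: fmeasurable_def)
  show "AE y in lebesgue. norm (kern x r y) \<le> norm (20 * r\<^sup>2 * indicator (ccube x (8 * r)) y)"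
  proof (rule AE_I2)
    fix y
    show "norm (kern x r y) \<le> norm (20 * r\<^sup>2 * indicator (ccube x (8 * r)) y)"
    proof (cases "kern x r y = 0")
      case False
      then have "y \<in> ball x (8 * r / 2)" using kern_support(1) by auto
      then have "y \<in> ccube x (8 * r)" using ball_subset_ccube by blast
      then show ?thesis using kern_le[OF assms, of y] kern_nonneg[of x r y] by simp
    qed simp
  qed
qed (rule kern_measurable)

text \<open>Up to powers of \<open>r\<close>: the lower bound \<open>\<epsilon> * r^2 / 32\<close>
  of the kernel on a cube about a corkscrew point, times the volume of that cube, whose side is
  \<open>\<epsilon> * r / (16 * rn)\<close>.\<close>

definition kmass_const :: real where
  "kmass_const = \<epsilon> / 32 * (\<epsilon> / (16 * rn)) ^ CARD('n)"

lemma kmass_const_pos: "0 < kmass_const"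
  using eps rn_ge_1 by (simp add: kmass_const_def)

lemma kmass_ge:
  assumes "adm x r" shows "kmass_const * r\<^sup>2 * r ^ CARD('n) \<le> kmass x r"
proof -
  have r: "0 < r" "r \<le> \<rho> / 2" "infdist x \<Omega> \<le> r" "\<Omega> \<noteq> UNIV" using assms by (auto simp: adm_def)
  obtain p where p: "dist x p \<le> 3 * r" "ball p (\<epsilon> / 4 * r) \<subseteq> \<Omega>" using corkscrew[OF r(3,1,2)] .
  define s where "s = \<epsilon> * r / (16 * rn)"
  have s: "0 < s" "rn * s / 2 = \<epsilon> * r / 32" using eps r rn_ge_1 by (auto simp: s_def)
  have er: "0 < \<epsilon> * r" "\<epsilon> * r \<le> r" using eps r by auto
  have low: "\<epsilon> * r\<^sup>2 / 32 * indicator (ccube p s) y \<le> kern x r y" for y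
  proof (cases "y \<in> ccube p s")
    case True
    then have d: "dist p y \<le> \<epsilon> * r / 32" using ccube_subset_cball_rn[of s p] s by fastforce
    have "\<epsilon> / 4 * r \<le> infdist p (- \<Omega>)" using p(2) r(4) by (rule infdist_compl_ge)
    then have "\<epsilon> * r / 16 \<le> infdist y (- \<Omega>) - \<epsilon> * r / 8"
      using infdist_triangle[of p "- \<Omega>" y] d er by linarith
    moreover have "r / 2 \<le> 4 * r - dist x y" using dist_triangle[of x y p] d p er by linarith
    ultimately have "(r / 2) * (\<epsilon> * r / 16) \<le> kern x r y"
      unfolding kern_def using r er by (intro mult_mono) auto
    then show ?thesis using True by (simp add: power2_eq_square mult_ac)
  qed (simp add: kern_nonneg)
  have "(LINT y|lebesgue. \<epsilon> * r\<^sup>2 / 32 * indicator (ccube p s) y) \<le> kmass x r"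
    unfolding kmass_def
  proof (rule integral_mono)
    show "integrable lebesgue (\<lambda>y. \<epsilon> * r\<^sup>2 / 32 * indicator (ccube p s) y)"
      using ccube_lmeasurable[of p s]
      by (intro integrable_mult_right integrable_real_indicator) (auto simp: fmeasurable_def)
  qed (use low kern_integrable[OF assms] in auto)
  also have "(LINT y|lebesgue. \<epsilon> * r\<^sup>2 / 32 * indicator (ccube p s) y) = kmass_const * r\<^sup>2 * r ^ CARD('n)"
    using s by (simp add: measure_ccube kmass_const_def s_def power_mult_distrib power_divide mult_ac)
  finally show ?thesis .
qed

lemma kmass_pos: "adm x r \<Longrightarrow> 0 < kmass x r"
  using kmass_ge[of x r] kmass_const_pos by (auto simp: adm_def intro: less_le_trans[rotated])

lemma dev_measurable_dom:
  assumes "locint f" "S \<subseteq> \<Omega>" "S \<in> sets lebesgue"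
  shows "(\<lambda>x. ennreal \<bar>f x - a\<bar> * indicator S x) \<in> borel_measurable lebesgue"
proof -
  have "(\<lambda>x. ennreal \<bar>indicator \<Omega> x * f x - a\<bar> * indicator S x) \<in> borel_measurable lebesgue"
    using locint_measurable[OF assms(1)] assms(3) by measurable
  then show ?thesis
    by (rule measurable_cong[THEN iffD1, rotated]) (use assms(2) in \<open>auto simp: indicator_def\<close>)
qed

text \<open>The weight is signed, so that the estimate applies to a difference of two kernels as
  well as to a single one.\<close>

lemma weighted_dev:
  assumes f: "locint f" and w: "w \<in> borel_measurable lebesgue"
    and S: "S \<subseteq> \<Omega>" "S \<in> sets lebesgue" and c: "0 \<le> c" "\<And>y. \<bar>w y\<bar> \<le> c * indicator S y"
    and B: "dev f a S \<le> ennreal B" "0 \<le> B"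
  shows "integrable lebesgue (\<lambda>y. w y * (f y - a))"
    and "\<bar>LINT y|lebesgue. w y * (f y - a)\<bar> \<le> c * B"
proof -
  have z: "w y = 0" if "y \<notin> \<Omega>" for y
  proof -
    have "y \<notin> S" using S(1) that by blast
    then show ?thesis using c(2)[of y] by simp
  qed
  have m: "(\<lambda>y. w y * (f y - a)) \<in> borel_measurable lebesgue"
  proof -
    have "(\<lambda>y. w y * (indicator \<Omega> y * f y - a)) \<in> borel_measurable lebesgue"
      using locint_measurable[OF f] w by measurable
    then show ?thesis by (rule measurable_cong[THEN iffD1, rotated]) (use z in \<open>auto simp: indicator_def\<close>)
  qed
  have le: "(\<integral>\<^sup>+y. ennreal (norm (w y * (f y - a))) \<partial>lebesgue) \<le> ennreal (c * B)"
  proof -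
    have "(\<integral>\<^sup>+y. ennreal (norm (w y * (f y - a))) \<partial>lebesgue)
        \<le> (\<integral>\<^sup>+y. ennreal c * (ennreal \<bar>f y - a\<bar> * indicator S y) \<partial>lebesgue)"
    proof (rule nn_integral_mono)
      fix y
      show "ennreal (norm (w y * (f y - a))) \<le> ennreal c * (ennreal \<bar>f y - a\<bar> * indicator S y)"
      proof (cases "y \<in> S")
        case True
        then have "norm (w y * (f y - a)) \<le> c * \<bar>f y - a\<bar>"
          using c(2)[of y] by (auto simp: abs_mult intro: mult_right_mono)
        then show ?thesis using True c(1) by (simp add: ennreal_mult[symmetric] ennreal_leI)
      next
        case False
        then show ?thesis using c(2)[of y] by simp
      qed
    qed
    also have "\<dots> = ennreal c * dev f a S"
      by (intro nn_integral_cmult dev_measurable_dom f S)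
    also have "\<dots> \<le> ennreal c * ennreal B" by (intro mult_left_mono B) auto
    finally show ?thesis using c(1) B(2) by (simp add: ennreal_mult)
  qed
  show i: "integrable lebesgue (\<lambda>y. w y * (f y - a))"
    unfolding integrable_iff_bounded using m le_less_trans[OF le ennreal_less_top] by simp
  have "ennreal (norm (LINT y|lebesgue. w y * (f y - a))) \<le> ennreal (c * B)"
    using integral_norm_bound_ennreal[OF i] le by (rule order_trans)
  then show "\<bar>LINT y|lebesgue. w y * (f y - a)\<bar> \<le> c * B" using c(1) B(2) by (simp add: ennreal_le_iff)
qed

lemma kavg_minus:
  assumes "adm x r" "integrable lebesgue (\<lambda>y. kern x r y * (f y - a))"
  shows "kavg f x r - a = (LINT y|lebesgue. kern x r y * (f y - a)) / kmass x r"
    and "integrable lebesgue (\<lambda>y. kern x r y * f y)"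
proof -
  have e: "(\<lambda>y. kern x r y * f y) = (\<lambda>y. kern x r y * (f y - a) + kern x r y * a)"
    by (simp add: algebra_simps)
  have i: "integrable lebesgue (\<lambda>y. kern x r y * a)" using kern_integrable[OF assms(1)] by simp
  show "integrable lebesgue (\<lambda>y. kern x r y * f y)" unfolding e by (intro Bochner_Integration.integrable_add assms(2) i)
  have "(LINT y|lebesgue. kern x r y * f y) = (LINT y|lebesgue. kern x r y * (f y - a)) + kmass x r * a"
    unfolding e using assms(2) i by (simp add: kmass_def)
  then show "kavg f x r - a = (LINT y|lebesgue. kern x r y * (f y - a)) / kmass x r"
    using kmass_pos[OF assms(1)] by (simp add: kavg_def field_simps)
qed

text \<open>The normalised kernel is a probability density supported in \<open>\<Omega>\<close>
  within \<open>4 * r\<close> of \<open>x\<close>. This gives the bounds for bounded and for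
  Lipschitz functions.\<close>

lemma kavg_mean:
  assumes f: "locint f" and a: "adm x r" and B: "\<And>y. y \<in> \<Omega> \<Longrightarrow> dist x y < 4 * r \<Longrightarrow> \<bar>f y - a\<bar> \<le> B"
  shows "\<bar>kavg f x r - a\<bar> \<le> B"
proof -
  have r: "0 < r" using a by (simp add: adm_def)
  have le: "norm (kern x r y * (f y - a)) \<le> norm (B * kern x r y)" for y
  proof (cases "kern x r y = 0")
    case False
    then have "y \<in> \<Omega>" "dist x y < 4 * r" using kern_zero_outside[OF r] kern_support(1) by blast+
    then have "\<bar>f y - a\<bar> \<le> B" by (rule B)
    then show ?thesis using kern_nonneg[of x r y] by (simp add: abs_mult mult.commute mult_right_mono)
  qed simp
  have m: "(\<lambda>y. kern x r y * (f y - a)) \<in> borel_measurable lebesgue"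
  proof -
    have "(\<lambda>y. kern x r y * (indicator \<Omega> y * f y - a)) \<in> borel_measurable lebesgue"
      using locint_measurable[OF f] kern_measurable[of x r] by measurable
    then show ?thesis
      by (rule measurable_cong[THEN iffD1, rotated]) (use kern_zero_outside[OF r] in \<open>auto simp: indicator_def\<close>)
  qed
  have iK: "integrable lebesgue (\<lambda>y. B * kern x r y)" using kern_integrable[OF a] by simp
  have i: "integrable lebesgue (\<lambda>y. kern x r y * (f y - a))"
    by (rule Bochner_Integration.integrable_bound[OF iK m]) (use le in auto)
  have "norm (LINT y|lebesgue. kern x r y * (f y - a)) \<le> (LINT y|lebesgue. B * kern x r y)"
  proof (rule Bochner_Integration.integral_norm_bound_integral[OF i iK])
    fix y
    show "norm (kern x r y * (f y - a)) \<le> B * kern x r y"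
    proof (cases "kern x r y = 0")
      case False
      then have "y \<in> \<Omega>" "dist x y < 4 * r" using kern_zero_outside[OF r] kern_support(1) by blast+
      then have "\<bar>f y - a\<bar> \<le> B" by (rule B)
      then show ?thesis using kern_nonneg[of x r y] by (simp add: abs_mult mult.commute mult_right_mono)
    qed simp
  qed
  then have "\<bar>LINT y|lebesgue. kern x r y * (f y - a)\<bar> \<le> B * kmass x r" by (simp add: kmass_def)
  then show ?thesis
    unfolding kavg_minus(1)[OF a i] using kmass_pos[OF a] by (simp add: abs_divide field_simps)
qed

text \<open>The depth, relative to \<open>r\<close>, of the support of every kernel of radius at
  least \<open>r / \<Theta>\<close>; \<open>\<Theta>\<close> bounds the ratio of the radii that are
  compared.\<close>

abbreviation kc :: "real \<Rightarrow> real" where "kc \<Theta> \<equiv> \<epsilon> / (8 * \<Theta>)"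

text \<open>The radius \<open>14 r\<close> accommodates kernels of radius up to \<open>4 r\<close> centred within \<open>10 r\<close> of \<open>x\<close>.\<close>

lemma kern_support_deep:
  assumes "0 < r'" "r' \<le> r" "r \<le> \<Theta> * r'" "1 \<le> \<Theta>" "dist x x' \<le> 10 * r" "kern x' r' y \<noteq> 0"
  shows "y \<in> deep x 14 (kc \<Theta>) r"
proof -
  have "dist x y \<le> 14 * r" using kern_support(1)[OF assms(6)] dist_triangle[of x y x'] assms by simp
  moreover have "kc \<Theta> * r \<le> \<epsilon> / 8 * r'"
    using mult_left_mono[OF assms(3), of "\<epsilon>"] eps assms by (simp add: field_simps)
  then have "ball y (kc \<Theta> * r) \<subseteq> \<Omega>"
    using kern_support(2)[OF assms(6)] subset_ball[of "kc \<Theta> * r" "\<epsilon> / 8 * r'" y] by blast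
  ultimately show ?thesis by (simp add: deep_def)
qed

lemma kc_bounds: "1 \<le> \<Theta> \<Longrightarrow> 0 < kc \<Theta>" "1 \<le> \<Theta> \<Longrightarrow> kc \<Theta> \<le> 1"
  using eps by (auto simp: field_simps)

lemma corkscrew_deep:
  assumes "adm x r" "1 \<le> \<Theta>"
  obtains p where "p \<in> deep x 14 (kc \<Theta>) r"
proof -
  have r: "infdist x \<Omega> \<le> r" "0 < r" "r \<le> \<rho> / 2" using assms by (auto simp: adm_def)
  obtain p where p: "dist x p \<le> 3 * r" "ball p (\<epsilon> / 4 * r) \<subseteq> \<Omega>" using corkscrew[OF r] .
  have "kc \<Theta> \<le> \<epsilon> / 4" using eps assms by (simp add: field_simps)
  then have "kc \<Theta> * r \<le> \<epsilon> / 4 * r" using r by (intro mult_right_mono) auto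
  then have "ball p (kc \<Theta> * r) \<subseteq> \<Omega>" using p subset_ball[of "kc \<Theta> * r" "\<epsilon> / 4 * r" p] by blast
  then show thesis using that[of p] p r by (simp add: deep_def)
qed

lemma deep_subset: "0 < k \<Longrightarrow> 0 < r \<Longrightarrow> deep x R k r \<subseteq> \<Omega>"
  by (auto simp: deep_def subset_iff)

lemma dev_deep_kc:
  assumes "locint f" "osc_bd f r W" "0 < r" "r \<le> \<rho> / 2" "1 \<le> \<Theta>" "p \<in> deep x 14 (kc \<Theta>) r"
  shows "dev f (ref_avg f p 14 (kc \<Theta>) r) (deep x 14 (kc \<Theta>) r)
     \<le> ennreal (deep_const 14 (kc \<Theta>) * W * r ^ CARD('n))"
  using assms rho_delta rho kc_bounds[of \<Theta>] by (intro dev_deep) auto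

lemma kern_weighted:
  assumes f: "locint f" "osc_bd f r W" and r: "0 < r" "r \<le> \<rho> / 2" and T: "1 \<le> \<Theta>"
    and p: "p \<in> deep x 14 (kc \<Theta>) r"
    and a: "adm x' r'" "r' \<le> r" "r \<le> \<Theta> * r'" "dist x x' \<le> 10 * r"
  shows "integrable lebesgue (\<lambda>y. kern x' r' y * (f y - ref_avg f p 14 (kc \<Theta>) r))"
    and "\<bar>LINT y|lebesgue. kern x' r' y * (f y - ref_avg f p 14 (kc \<Theta>) r)\<bar>
      \<le> 20 * r'\<^sup>2 * (deep_const 14 (kc \<Theta>) * W * r ^ CARD('n))"
proof -
  have r': "0 < r'" using a by (simp add: adm_def)
  have le: "\<bar>kern x' r' y\<bar> \<le> 20 * r'\<^sup>2 * indicator (deep x 14 (kc \<Theta>) r) y" for y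
  proof (cases "kern x' r' y = 0")
    case False
    then have "y \<in> deep x 14 (kc \<Theta>) r" using kern_support_deep[OF r' a(2,3) T a(4)] by blast
    then show ?thesis using kern_le[OF a(1), of y] kern_nonneg[of x' r' y] by simp
  qed simp
  have B: "0 \<le> deep_const 14 (kc \<Theta>) * W * r ^ CARD('n)"
    using deep_const_nonneg[of 14 "kc \<Theta>"] kc_bounds[OF T] osc_bd_nonneg[OF f(2)] r by simp
  note * = weighted_dev[OF f(1) kern_measurable deep_subset[OF kc_bounds(1)[OF T] r(1)] deep_measurable
      _ le dev_deep_kc[OF f r T p] B]
  show "integrable lebesgue (\<lambda>y. kern x' r' y * (f y - ref_avg f p 14 (kc \<Theta>) r))" by (rule *(1)) simp
  show "\<bar>LINT y|lebesgue. kern x' r' y * (f y - ref_avg f p 14 (kc \<Theta>) r)\<bar>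
      \<le> 20 * r'\<^sup>2 * (deep_const 14 (kc \<Theta>) * W * r ^ CARD('n))" by (rule *(2)) simp
qed

definition ref_const :: "real \<Rightarrow> real" where
  "ref_const \<Theta> = 20 * deep_const 14 (kc \<Theta>) * \<Theta> ^ CARD('n) / kmass_const"

lemma ref_const_nonneg: "1 \<le> \<Theta> \<Longrightarrow> 0 \<le> ref_const \<Theta>"
  using deep_const_nonneg[of 14 "kc \<Theta>"] kc_bounds[of \<Theta>] kmass_const_pos by (simp add: ref_const_def)

text \<open>The maximum of the kernel divided by its mass is of order \<open>r' ^ (- n)\<close>, so
  the average differs from the reference value by at most a constant times the mean deviation on the
  deep set.\<close>

lemma kavg_near_ref:
  assumes f: "locint f" "osc_bd f r W" and r: "0 < r" "r \<le> \<rho> / 2" and T: "1 \<le> \<Theta>"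
    and p: "p \<in> deep x 14 (kc \<Theta>) r"
    and a: "adm x' r'" "r' \<le> r" "r \<le> \<Theta> * r'" "dist x x' \<le> 10 * r"
  shows "\<bar>kavg f x' r' - ref_avg f p 14 (kc \<Theta>) r\<bar> \<le> ref_const \<Theta> * W"
proof -
  note kw = kern_weighted[OF f r T p a]
  have r': "0 < r'" using a by (simp add: adm_def)
  let ?DC = "deep_const 14 (kc \<Theta>)"
  have DC: "0 \<le> ?DC" using deep_const_nonneg[of 14 "kc \<Theta>"] kc_bounds[OF T] by simp
  have W: "0 \<le> W" using f(2) by (rule osc_bd_nonneg)
  have low: "0 < kmass_const * r'\<^sup>2 * r' ^ CARD('n)" using kmass_const_pos r' by simp
  have "\<bar>kavg f x' r' - ref_avg f p 14 (kc \<Theta>) r\<bar>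
      \<le> 20 * r'\<^sup>2 * (?DC * W * r ^ CARD('n)) / (kmass_const * r'\<^sup>2 * r' ^ CARD('n))"
    unfolding kavg_minus(1)[OF a(1) kw(1)] abs_divide
    using kmass_ge[OF a(1)] low kw(2) DC W r by (intro frac_le) auto
  also have "\<dots> \<le> 20 * r'\<^sup>2 * (?DC * W * (\<Theta> * r') ^ CARD('n)) / (kmass_const * r'\<^sup>2 * r' ^ CARD('n))"
    using a r r' DC W low by (intro divide_right_mono mult_left_mono power_mono) auto
  also have "\<dots> = ref_const \<Theta> * W"
    using r' kmass_const_pos by (simp add: ref_const_def power_mult_distrib field_simps)
  finally show ?thesis .
qed

text \<open>Product rule for the reach factor \<open>A\<close> and the depth factor
  \<open>E\<close>: \<open>A\<close> changes by at most \<open>4 * \<Delta>\<close>,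
  \<open>E\<close> by at most \<open>\<Delta>\<close>, and the factors are at most
  \<open>4 * r\<close> and \<open>5 * r\<close>, so the constant is \<open>20 + 4\<close>.\<close>

lemma kern_lipschitz:
  assumes a: "adm x r" "adm x' r'" "r' \<le> r"
  shows "\<bar>kern x r y - kern x' r' y\<bar> \<le> 24 * r * (dist x x' + (r - r'))"
proof -
  have r: "0 < r'" "0 < r" using a by (auto simp: adm_def)
  define A where "A = max 0 (4 * r - dist x y)"
  define A' where "A' = max 0 (4 * r' - dist x' y)"
  define E where "E = max 0 (infdist y (- \<Omega>) - \<epsilon> * r / 8)"
  define E' where "E' = max 0 (infdist y (- \<Omega>) - \<epsilon> * r' / 8)"
  define \<Delta> where "\<Delta> = dist x x' + (r - r')"
  have D: "0 \<le> \<Delta>" using a by (simp add: \<Delta>_def)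
  have nn: "0 \<le> A" "0 \<le> A'" "0 \<le> E" "0 \<le> E'" by (auto simp: A_def A'_def E_def E'_def)
  have "\<bar>dist x y - dist x' y\<bar> \<le> dist x x'" by (metis abs_dist_diff_le dist_commute)
  then have dA: "\<bar>A - A'\<bar> \<le> 4 * \<Delta>" unfolding A_def A'_def \<Delta>_def
    using a(3) zero_le_dist[of x x'] by (intro order_trans[OF abs_max_0_diff_le]) (smt (verit))
  have "\<epsilon> * (r - r') \<le> 1 * (r - r')" using eps a(3) by (intro mult_right_mono) auto
  moreover have "0 \<le> \<epsilon> * (r - r')" using eps a(3) by simp
  ultimately have "\<epsilon> * r / 8 - \<epsilon> * r' / 8 \<le> r - r'" "0 \<le> \<epsilon> * r / 8 - \<epsilon> * r' / 8"
    using a(3) by (auto simp: right_diff_distrib)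
  then have dE: "\<bar>E - E'\<bar> \<le> \<Delta>" unfolding E_def E'_def \<Delta>_def
    using zero_le_dist[of x x'] by (intro order_trans[OF abs_max_0_diff_le]) linarith
  have k: "kern x r y = A * E" "kern x' r' y = A' * E'"
    by (auto simp: kern_def A_def A'_def E_def E'_def)
  show ?thesis
  \<comment> \<open>The bound \<open>5 * r\<close> for the depth factor holds only within the reach
    of the kernel. If \<open>A = 0\<close>, the change of \<open>A\<close> is therefore multiplied
    by \<open>E'\<close> instead of \<open>E\<close>.\<close>
  proof (cases "A = 0")
    case True
    show ?thesis
    proof (cases "A' = 0")
      case True
      then show ?thesis using \<open>A = 0\<close> D r by (simp add: k \<Delta>_def[symmetric])
    next
      case False
      then have "dist x' y < 4 * r'" by (auto simp: A'_def max_def split: if_splits)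
      then have "E' \<le> 5 * r" using kern_height[OF a(2)] a(3) by (fastforce simp: E'_def)
      then have "\<bar>A - A'\<bar> * E' \<le> 4 * \<Delta> * (5 * r)" using dA nn D by (intro mult_mono) auto
      then have "A' * E' \<le> 20 * (r * \<Delta>)" using True nn by (simp add: mult_ac)
      moreover have "0 \<le> r * \<Delta>" using D r by simp
      ultimately show ?thesis using True nn unfolding k \<Delta>_def[symmetric] by (simp add: mult_ac)
    qed
  next
    case False
    then have "dist x y < 4 * r" by (auto simp: A_def max_def split: if_splits)
    then have E: "E \<le> 5 * r" using kern_height[OF a(1)] by (simp add: E_def)
    have A': "A' \<le> 4 * r" using a(3) zero_le_dist[of x' y] r unfolding A'_def by (smt (verit))
    have "A * E - A' * E' = (A - A') * E + A' * (E - E')" by (simp add: algebra_simps)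
    also have "\<bar>\<dots>\<bar> \<le> \<bar>A - A'\<bar> * E + A' * \<bar>E - E'\<bar>"
      using nn abs_triangle_ineq[of "(A - A') * E" "A' * (E - E')"] by (simp add: abs_mult)
    also have "\<dots> \<le> 4 * \<Delta> * (5 * r) + 4 * r * \<Delta>"
      using dA dE E A' nn D r by (intro add_mono mult_mono) auto
    finally show ?thesis unfolding k \<Delta>_def[symmetric] by (simp add: mult_ac)
  qed
qed

definition lip_const :: "real \<Rightarrow> real" where
  "lip_const \<Theta> = 24 * deep_const 14 (kc \<Theta>) / kmass_const
     + ref_const \<Theta> * (24 * 28 ^ CARD('n)) / kmass_const"

lemma lip_const_nonneg: "1 \<le> \<Theta> \<Longrightarrow> 0 \<le> lip_const \<Theta>"
  using deep_const_nonneg[of 14 "kc \<Theta>"] kc_bounds[of \<Theta>] kmass_const_pos ref_const_nonneg[of \<Theta>]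
  by (simp add: lip_const_def)

text \<open>After subtraction of a reference value both integrals are of order \<open>W\<close>. The
  difference of the normalised integrals splits into a change of the kernel and a change of the
  mass, and each of these contributes a factor \<open>\<Delta> / r\<close>.\<close>

lemma kavg_lipschitz:
  assumes f: "locint f" "osc_bd f r W" and T: "1 \<le> \<Theta>"
    and a: "adm x r" "adm x' r'" "r' \<le> r" "r \<le> \<Theta> * r'" "dist x x' \<le> 10 * r"
  shows "\<bar>kavg f x r - kavg f x' r'\<bar> \<le> lip_const \<Theta> * W * (dist x x' + (r - r')) / r"
proof -
  have r: "0 < r" "r \<le> \<rho> / 2" "0 < r'" using a by (auto simp: adm_def)
  have W: "0 \<le> W" using f(2) by (rule osc_bd_nonneg)
  obtain p where p: "p \<in> deep x 14 (kc \<Theta>) r" using corkscrew_deep[OF a(1) T] .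
  define a0 where "a0 = ref_avg f p 14 (kc \<Theta>) r"
  let ?S = "deep x 14 (kc \<Theta>) r" and ?k = "kmass x r" and ?k' = "kmass x' r'"
  let ?DC = "deep_const 14 (kc \<Theta>)"
  define \<Delta> where "\<Delta> = dist x x' + (r - r')"
  have D: "0 \<le> \<Delta>" using a by (simp add: \<Delta>_def)
  have DC: "0 \<le> ?DC" using deep_const_nonneg[of 14 "kc \<Theta>"] kc_bounds[OF T] by simp
  have rT: "r \<le> \<Theta> * r" using T r by simp
  note i = kern_weighted(1)[OF f r(1,2) T p a(1) _ rT, folded a0_def, simplified]
  note i' = kern_weighted(1)[OF f r(1,2) T p a(2,3,4,5), folded a0_def]
  have r10: "dist x x \<le> 10 * r" using r by simp
  have le: "\<bar>kern x r y - kern x' r' y\<bar> \<le> 24 * r * \<Delta> * indicator ?S y" for y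
  proof (cases "y \<in> ?S")
    case True then show ?thesis using kern_lipschitz[OF a(1-3)] by (simp add: \<Delta>_def)
  next
    case False
    then have "kern x r y = 0" "kern x' r' y = 0"
      using kern_support_deep[OF r(1) order_refl rT T r10] kern_support_deep[OF r(3) a(3,4) T a(5)] by blast+
    then show ?thesis using False by simp
  qed
  have B: "0 \<le> ?DC * W * r ^ CARD('n)" using DC W r by simp
  have wm: "(\<lambda>y. kern x r y - kern x' r' y) \<in> borel_measurable lebesgue"
    using kern_measurable by measurable
  have "\<bar>LINT y|lebesgue. (kern x r y - kern x' r' y) * (f y - a0)\<bar> \<le> 24 * r * \<Delta> * (?DC * W * r ^ CARD('n))"
    using weighted_dev(2)[OF f(1) wm deep_subset[OF kc_bounds(1)[OF T] r(1)] deep_measurable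
      _ le dev_deep_kc[OF f r(1,2) T p, folded a0_def] B] r D by simp
  moreover define J where "J = (LINT y|lebesgue. kern x r y * (f y - a0))"
  moreover define J' where "J' = (LINT y|lebesgue. kern x' r' y * (f y - a0))"
  ultimately have JJ: "\<bar>J - J'\<bar> \<le> 24 * r * \<Delta> * (?DC * W * r ^ CARD('n))"
    using i r i' by (simp add: left_diff_distrib)
  have kk: "\<bar>?k' - ?k\<bar> \<le> 24 * r * \<Delta> * (28 * r) ^ CARD('n)"
  proof -
    have "?k - ?k' = (LINT y|lebesgue. kern x r y - kern x' r' y)"
      using kern_integrable[OF a(1)] kern_integrable[OF a(2)] by (simp add: kmass_def)
    also have "norm \<dots> \<le> (LINT y|lebesgue. 24 * r * \<Delta> * indicator (ccube x (28 * r)) y)"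
    proof (rule Bochner_Integration.integral_norm_bound_integral)
      show "integrable lebesgue (\<lambda>y. kern x r y - kern x' r' y)"
        using kern_integrable[OF a(1)] kern_integrable[OF a(2)] by simp
      show "integrable lebesgue (\<lambda>y. 24 * r * \<Delta> * indicator (ccube x (28 * r)) y)"
        using ccube_lmeasurable[of x "28 * r"]
        by (intro integrable_mult_right integrable_real_indicator) (auto simp: fmeasurable_def)
      fix y
      have "?S \<subseteq> ccube x (28 * r)" using cball_subset_ccube[of x "28 * r"] by (auto simp: deep_def)
      then have "24 * r * \<Delta> * indicator ?S y \<le> 24 * r * \<Delta> * indicator (ccube x (28 * r)) y"
        using r D by (intro mult_left_mono) (auto simp: indicator_def)
      then show "norm (kern x r y - kern x' r' y) \<le> 24 * r * \<Delta> * indicator (ccube x (28 * r)) y"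
        using le[of y] by simp
    qed
    also have "\<dots> = 24 * r * \<Delta> * (28 * r) ^ CARD('n)" using r by (simp add: measure_ccube)
    finally show ?thesis by (simp add: abs_minus_commute)
  qed
  have k: "0 < ?k" "0 < ?k'" using a by (auto intro: kmass_pos)
  have e: "kavg f x r - a0 = J / ?k" "kavg f x' r' - a0 = J' / ?k'"
    unfolding J_def J'_def using kavg_minus(1)[OF a(1) i] kavg_minus(1)[OF a(2) i'] r by auto
  have J': "J' = (kavg f x' r' - a0) * ?k'" using e(2) k by (simp add: field_simps)
  have "kavg f x r - kavg f x' r' = J / ?k - (kavg f x' r' - a0)" using e(1) by simp
  also have "\<dots> = (J - J') / ?k + (kavg f x' r' - a0) * ((?k' - ?k) / ?k)"
    using k by (simp add: J' field_simps)
  finally have "\<bar>kavg f x r - kavg f x' r'\<bar> \<le> \<bar>J - J'\<bar> / ?k + \<bar>kavg f x' r' - a0\<bar> * (\<bar>?k' - ?k\<bar> / ?k)"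
    using k abs_triangle_ineq[of "(J - J') / ?k" "(kavg f x' r' - a0) * ((?k' - ?k) / ?k)"]
    by (simp add: abs_mult)
  also have "\<dots> \<le> 24 * r * \<Delta> * (?DC * W * r ^ CARD('n)) / (kmass_const * r\<^sup>2 * r ^ CARD('n))
      + ref_const \<Theta> * W * (24 * r * \<Delta> * (28 * r) ^ CARD('n) / (kmass_const * r\<^sup>2 * r ^ CARD('n)))"
    using JJ kk k kmass_ge[OF a(1)] kmass_const_pos r D DC W ref_const_nonneg[OF T]
      kavg_near_ref[OF f r(1,2) T p a(2,3,4,5), folded a0_def]
    by (intro add_mono mult_mono frac_le) auto
  also have "\<dots> = lip_const \<Theta> * W * \<Delta> / r"
    using r kmass_const_pos by (simp add: lip_const_def power_mult_distrib field_simps power2_eq_square)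
  finally show ?thesis by (simp add: \<Delta>_def)
qed

section \<open>Bounds by the norm\<close>

text \<open>The two suprema of the norm are bounded separately by one real number; this is implied
  by norm at most \<open>V\<close> and implies norm at most \<open>2 * V\<close>.\<close>

definition norm_bd :: "(real ^ 'n \<Rightarrow> real) \<Rightarrow> real \<Rightarrow> bool" where
  "norm_bd f V \<longleftrightarrow> 0 \<le> V \<and>
     (\<forall>p s. 0 < s \<longrightarrow> s < \<rho> \<longrightarrow> ccube p s \<subseteq> \<Omega> \<longrightarrow> mean_osc f (ccube p s) \<le> V) \<and>
     (\<forall>p s. \<rho> \<le> s \<longrightarrow> ccube p s \<subseteq> \<Omega> \<longrightarrow> avg (\<lambda>x. \<bar>f x\<bar>) (ccube p s) \<le> V)"

lemma norm_bd_osc: "norm_bd f V \<Longrightarrow> t < \<rho> \<Longrightarrow> osc_bd f t V"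
  by (simp add: norm_bd_def osc_bd_def)

lemma norm_bd_nonneg: "norm_bd f V \<Longrightarrow> 0 \<le> V"
  by (simp add: norm_bd_def)

text \<open>A chain leads from \<open>p\<close> to a cube of side \<open>\<rho>\<close>, where the
  norm bounds the mean of the absolute value. The constant may depend on the smallest side
  \<open>t\<close>.\<close>

lemma avg_bounded:
  assumes t: "0 < t" "t < \<rho>"
  obtains C where "0 \<le> C"
    "\<And>f V p s. locint f \<Longrightarrow> norm_bd f V \<Longrightarrow> t \<le> s \<Longrightarrow> s < \<rho> \<Longrightarrow> ccube p s \<subseteq> \<Omega> \<Longrightarrow>
       \<bar>avg f (ccube p s)\<bar> \<le> C * V"
proof -
  \<comment> \<open>The balls at both ends have radius \<open>t / 2\<close>, and
    \<open>D * (t / 2) = 3 * \<delta> / 4\<close> lies between the distance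
    \<open>\<delta> / 2\<close> of the centres and the limit \<open>\<delta>\<close> for
    chains.\<close>
  define D where "D = 3 * \<delta> / (2 * t)"
  have D: "1 \<le> D" "D * (t / 2) = 3 * \<delta> / 4" using t rho_delta by (auto simp: D_def field_simps)
  define s2 where "s2 = sig D * (t / 2)"
  have s2: "0 < s2" "s2 \<le> t"
    using sig_pos[OF D(1)] sig_le(2)[OF D(1)] t mult_right_mono[of "sig D" "1/8" "t/2"] by (auto simp: s2_def)
  define C where "C = (\<rho> / s2) ^ CARD('n) + chain_const D + (\<rho> / s2) ^ CARD('n)"
  have C: "0 \<le> C" using chain_const_nonneg[OF D(1)] rho s2 by (simp add: C_def)
  show thesis
  proof (rule that[OF C])
    fix f V p s
    assume f: "locint f" "norm_bd f V" and s: "t \<le> s" "s < \<rho>" and sub: "ccube p s \<subseteq> \<Omega>"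
    have V: "0 \<le> V" using f(2) by (rule norm_bd_nonneg)
    have s0: "0 < s" using s t by simp
    have p: "p \<in> \<Omega>" using sub s0 by (auto simp: mem_ccube subset_iff)
    obtain q where q: "dist p q \<le> \<delta> / 2" "ccube q \<rho> \<subseteq> \<Omega>" using big_cube_near[OF p] .
    have bp: "ball p (t / 2) \<subseteq> \<Omega>"
      using ball_subset_ccube[of p s] subset_ball[of "t / 2" "s / 2" p] sub s by auto
    have bq: "ball q (t / 2) \<subseteq> \<Omega>"
      using ball_subset_ccube[of q \<rho>] subset_ball[of "t / 2" "\<rho> / 2" q] q t by auto
    have c1: "\<bar>avg f (ccube p s2) - avg f (ccube p s)\<bar> \<le> V * (\<rho> / s2) ^ CARD('n)"
    proof -
      have "ccube p s2 \<subseteq> ccube p s" using s2 s by (intro ccube_mono) simp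
      then have "\<bar>avg f (ccube p s2) - avg f (ccube p s)\<bar> \<le> V * (s / s2) ^ CARD('n)"
        using avg_nested[OF f(1) norm_bd_osc[OF f(2) s(2)] s2(1) s0 order_refl sub] by simp
      also have "\<dots> \<le> V * (\<rho> / s2) ^ CARD('n)"
        using V s s0 s2 by (intro mult_left_mono power_mono divide_right_mono) auto
      finally show ?thesis .
    qed
    have "\<bar>avg f (ccube p s2) - avg f (ccube q s2)\<bar> \<le> chain_const D * V"
      unfolding s2_def using q t D delta
      by (intro avg_chain f(1) norm_bd_osc[OF f(2)] bp bq) auto
    moreover have "\<bar>avg f (ccube q s2)\<bar> \<le> V * (\<rho> / s2) ^ CARD('n)"
    proof -
      have i: "set_integrable lebesgue (ccube q \<rho>) f" using locintD[OF f(1) rho(1) q(2)] .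
      have sub2: "ccube q s2 \<subseteq> ccube q \<rho>" using s2 t by (intro ccube_mono) simp
      have "dev f 0 (ccube q s2) \<le> dev f 0 (ccube q \<rho>)" using sub2 by (rule dev_mono)
      also have "\<dots> = ennreal (avg (\<lambda>x. \<bar>f x\<bar>) (ccube q \<rho>) * \<rho> ^ CARD('n))"
        using rho dev_eq_LINT[OF i ccube_lmeasurable, of 0] by (simp add: avg_def measure_ccube)
      also have "\<dots> \<le> ennreal (V * \<rho> ^ CARD('n))"
        using f(2) q(2) rho by (intro ennreal_leI mult_right_mono) (auto simp: norm_bd_def)
      finally have "\<bar>avg f (ccube q s2) - 0\<bar> \<le> V * \<rho> ^ CARD('n) / measure lebesgue (ccube q s2)"
        using s2 V rho set_integrable_subset[OF i _ sub2]
        by (intro avg_near_of_dev) (auto simp: measure_ccube)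
      then show ?thesis using s2 by (simp add: measure_ccube power_divide)
    qed
    ultimately show "\<bar>avg f (ccube p s)\<bar> \<le> C * V"
      using c1 unfolding C_def distrib_right by (simp add: mult.commute[of V])
  qed
qed

text \<open>The average is close to a reference value, which is a mean over a cube whose side is
  bounded below in terms of \<open>b\<close>.\<close>

lemma kavg_bounded:
  assumes b: "0 < b"
  obtains C where "0 \<le> C"
    "\<And>f V x r. locint f \<Longrightarrow> norm_bd f V \<Longrightarrow> adm x r \<Longrightarrow> b \<le> r \<Longrightarrow> \<bar>kavg f x r\<bar> \<le> C * V"
proof (cases "b \<le> \<rho> / 2")
  \<comment> \<open>Admissible radii are at most \<open>\<rho> / 2\<close>, so the claim is vacuous
    here.\<close>
  case False
  then show thesis using that[of 0] by (auto simp: adm_def)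
next
  case True
  define k where "k = kc 1"
  have k: "0 < k" "k \<le> 1" using kc_bounds[of 1] by (auto simp: k_def)
  define D where "D = 2 * 14 / k"
  have D: "1 \<le> D" using k by (simp add: D_def field_simps)
  define c where "c = sig D * k"
  have c: "0 < c" "c \<le> 1/8"
    using sig_pos[OF D] k sig_le(2)[OF D] mult_mono[of "sig D" "1/8" k 1] by (auto simp: c_def)
  have "c * b \<le> 1/8 * (\<rho> / 2)" using c True b by (intro mult_mono) auto
  then have cb: "0 < c * b" "c * b < \<rho>" using c b rho by auto
  obtain C where C: "0 \<le> C"
    "\<And>f V p s. locint f \<Longrightarrow> norm_bd f V \<Longrightarrow> c * b \<le> s \<Longrightarrow> s < \<rho> \<Longrightarrow> ccube p s \<subseteq> \<Omega> \<Longrightarrow>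
       \<bar>avg f (ccube p s)\<bar> \<le> C * V"
    using avg_bounded[OF cb] by blast
  show thesis
  proof (rule that[of "ref_const 1 + C"])
    show "0 \<le> ref_const 1 + C" using C ref_const_nonneg[of 1] by simp
    fix f V x r assume f: "locint f" "norm_bd f V" and a: "adm x r" "b \<le> r"
    have r: "0 < r" "r \<le> \<rho> / 2" using a by (auto simp: adm_def)
    obtain p where p: "p \<in> deep x 14 k r" using corkscrew_deep[OF a(1), of 1] k_def by auto
    have "\<bar>kavg f x r - ref_avg f p 14 k r\<bar> \<le> ref_const 1 * V"
      unfolding k_def using f a(1) r p rho
      by (intro kavg_near_ref[where x = x] norm_bd_osc) (auto simp: k_def)
    moreover have "\<bar>ref_avg f p 14 k r\<bar> \<le> C * V"
      unfolding ref_avg_def D_def[symmetric] mult.assoc[symmetric] c_def[symmetric]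
    proof (rule C(2)[OF f])
      show "c * b \<le> c * r" using a c by simp
      have "c * r \<le> 1/8 * (\<rho> / 2)" using c r by (intro mult_mono) auto
      then show "c * r < \<rho>" using rho by simp
      have kr: "0 < k * r" using k r by simp
      have crp: "0 < c * r" using c r by simp
      have cr: "sig D * (k * r) = c * r" by (simp add: c_def)
      have "ccube p (c * r) \<subseteq> ccube p (2 * (sig D * (k * r)))"
        unfolding cr using crp by (intro ccube_mono) simp
      also have "\<dots> \<subseteq> ball p (k * r)" by (rule ccube_sig_subset[OF D kr])
      also have "\<dots> \<subseteq> \<Omega>" using p by (simp add: deep_def)
      finally show "ccube p (c * r) \<subseteq> \<Omega>" .
    qed
    ultimately show "\<bar>kavg f x r\<bar> \<le> (ref_const 1 + C) * V" by (simp add: distrib_right)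
  qed
qed

section \<open>Cubes near the boundary\<close>

text \<open>Used with \<open>t = rn * l\<close>, twice the circumradius of a cube of side
  \<open>l\<close>: if a cube is not near, all its points keep a distance of at least
  \<open>rn * l / 2\<close> from the complement of \<open>\<Omega>\<close> or from
  \<open>\<Omega>\<close>.\<close>

definition near :: "real ^ 'n \<Rightarrow> real \<Rightarrow> bool" where
  "near p t \<longleftrightarrow> cball p t \<inter> \<Omega> \<noteq> {} \<and> \<not> cball p t \<subseteq> \<Omega>"

lemma near_frontier:
  assumes "near p t" obtains z where "z \<in> frontier \<Omega>" "dist p z \<le> t"
proof -
  have "cball p t \<inter> frontier \<Omega> \<noteq> {}"
    using assms by (intro connected_Int_frontier connected_cball) (auto simp: near_def)
  then show thesis using that by auto
qed

lemma frontier_near: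
  assumes "z \<in> frontier \<Omega>" "dist p z < t" shows "near p t"
proof -
  have z: "z \<in> closure \<Omega>" "z \<notin> \<Omega>" using assms(1) open_dom by (auto simp: frontier_def interior_open)
  have "ball p t \<inter> \<Omega> \<noteq> {}"
    using z(1) assms(2) by (metis open_ball open_Int_closure_eq_empty disjoint_iff mem_ball)
  then obtain w where "w \<in> \<Omega>" "dist p w < t" by auto
  then have "w \<in> cball p t \<inter> \<Omega>" "z \<in> cball p t" using assms(2) by auto
  then show ?thesis using z(2) unfolding near_def by blast
qed

lemma near_adm:
  assumes "near p t" "0 < t" "t \<le> \<rho> / 2" shows "adm p t"
proof -
  obtain y z where "y \<in> \<Omega>" "dist p y \<le> t" "z \<notin> \<Omega>" "dist p z \<le> t"
    using assms(1) by (auto simp: near_def)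
  then show ?thesis using assms infdist_le2[of y \<Omega> p t] infdist_le2[of z "- \<Omega>" p t] by (auto simp: adm_def)
qed

text \<open>Points within \<open>rn * h\<close> of the centre of a cell that contains a corkscrew
  point are within \<open>3 / 2 * rn * h\<close> of that point, which has to stay below the radius
  \<open>\<epsilon> * l / 64\<close> of the corkscrew ball; \<open>3 / 200 < 1 / 64\<close> shows
  that 100 is large enough.\<close>

definition gridn :: nat where "gridn = nat \<lceil>100 * rn / \<epsilon>\<rceil>"

lemma gridn: "0 < gridn" "100 * rn \<le> \<epsilon> * gridn" "100 * rn \<le> gridn" "1 \<le> gridn"
proof -
  have p: "0 < 100 * rn / \<epsilon>" using eps rn_ge_1 by simp
  then show g: "0 < gridn" by (simp add: gridn_def)
  then show "1 \<le> gridn" by simp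
  have "100 * rn / \<epsilon> \<le> gridn" unfolding gridn_def using p by linarith
  then show e: "100 * rn \<le> \<epsilon> * gridn" using eps by (simp add: field_simps)
  have "\<epsilon> * real gridn \<le> 1 * real gridn" using eps by (intro mult_right_mono) auto
  then show "100 * rn \<le> gridn" using e by simp
qed

text \<open>The corkscrew condition at a boundary point near the centre produces a cell well inside
  \<open>\<Omega>\<close>; losing one cell in each generation is what makes the sums over all generations converge.\<close>

lemma grid_near_cells:
  assumes l: "0 < l" "l \<le> \<rho>"
  obtains C where "finite C" "card C \<le> gridn ^ CARD('n)" "ccube p l \<subseteq> (\<Union>c\<in>C. ccube c (l / gridn))"
    "\<And>c. c \<in> C \<Longrightarrow> ccube c (l / gridn) \<subseteq> ccube p l"
    "card {c\<in>C. near c (rn * (l / gridn))} \<le> gridn ^ CARD('n) - 1"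
proof -
  define h where "h = l / gridn"
  have h: "0 < h" using l gridn(1) by (simp add: h_def)
  have g: "100 * (rn * h) \<le> \<epsilon> * l" "100 * (rn * h) \<le> l"
    using mult_right_mono[OF gridn(2), of h] mult_right_mono[OF gridn(3), of h] h l gridn(1)
    by (auto simp: h_def)
  obtain C where C: "finite C" "card C \<le> gridn ^ CARD('n)" "ccube p l \<subseteq> (\<Union>c\<in>C. ccube c h)"
    "\<And>c. c \<in> C \<Longrightarrow> ccube c h \<subseteq> ccube p l"
    using ccube_grid[OF gridn(1) l(1)] unfolding h_def by metis
  have cell: "dist c x \<le> rn * h / 2" if "x \<in> ccube c h" for c x :: "real ^ 'n"
    using ccube_subset_cball_rn[of h c] that h by auto
  have "\<exists>c\<in>C. \<not> near c (rn * h)"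
  proof (rule ccontr)
    assume all: "\<not> (\<exists>c\<in>C. \<not> near c (rn * h))"
    have "p \<in> ccube p l" using l by (simp add: mem_ccube)
    then obtain c1 where c1: "c1 \<in> C" "p \<in> ccube c1 h" using C(3) by auto
    obtain z where z: "z \<in> frontier \<Omega>" "dist c1 z \<le> rn * h"
      using all c1 near_frontier by metis
    have "0 < rn * h" using h rn_ge_1 by simp
    then have "dist p z \<le> 2 * (rn * h)" using cell[OF c1(2)] z(2) dist_triangle[of p z c1]
      unfolding dist_commute[of p c1] by linarith
    then have pz: "dist p z \<le> l / 16" using g(2) l by linarith
    \<comment> \<open>At a frontier point the corkscrew radius is free. With \<open>l / 16\<close>
      the corkscrew point is at most \<open>l / 16 + 3 * l / 16\<close> from \<open>p\<close>, hence
      inside the cube.\<close>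
    have "infdist z \<Omega> = 0" using z(1) dom_nonempty by (simp add: frontier_def in_closure_iff_infdist_zero)
    then obtain q where q: "dist z q \<le> 3 * (l / 16)" "ball q (\<epsilon> / 4 * (l / 16)) \<subseteq> \<Omega>"
      using corkscrew[of z "l / 16"] l by auto
    have "dist p q \<le> l / 2" using pz q(1) dist_triangle[of p q z] l by linarith
    then have "q \<in> ccube p l" using cball_subset_ccube[of p l] by auto
    then obtain c2 where c2: "c2 \<in> C" "q \<in> ccube c2 h" using C(3) by auto
    have "cball c2 (rn * h) \<subseteq> ball q (\<epsilon> / 4 * (l / 16))"
    proof
      fix x assume "x \<in> cball c2 (rn * h)"
      then have "dist q x \<le> rn * h / 2 + rn * h" using cell[OF c2(2)] dist_triangle[of q x c2]
        unfolding dist_commute[of q c2] by (simp add: mult_ac)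
      moreover have "0 < \<epsilon> * l" using eps l by simp
      ultimately show "x \<in> ball q (\<epsilon> / 4 * (l / 16))" using g(1) by (simp add: mult_ac)
    qed
    then have "\<not> near c2 (rn * h)" using q(2) by (auto simp: near_def)
    then show False using all c2 by blast
  qed
  then obtain c where c: "c \<in> C" "\<not> near c (rn * h)" by blast
  have "card {c\<in>C. near c (rn * h)} \<le> card (C - {c})"
    using C(1) c by (intro card_mono) auto
  also have "\<dots> \<le> gridn ^ CARD('n) - 1" using C(1,2) c by simp
  finally show thesis using that[of C] C unfolding h_def by blast
qed

definition decay :: real where "decay = 1 - 1 / real gridn ^ CARD('n)"

lemma decay: "0 \<le> decay" "decay < 1"
  using gridn(1,4) by (auto simp: decay_def)

text \<open>The first argument of \<open>\<Phi>\<close> counts the remaining generations. With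
  \<open>G = gridn ^ n\<close>, the value \<open>A * G\<close> solves
  \<open>X = A + decay * X\<close>, so the claim contains the summed geometric series, and the start
  value \<open>A0\<close> decays. One application has \<open>A = 0\<close>, the other
  \<open>A0 = 0\<close>.\<close>

lemma grid_induct:
  fixes \<Phi> :: "nat \<Rightarrow> real ^ 'n \<Rightarrow> real \<Rightarrow> ennreal"
  assumes A: "0 \<le> A" "0 \<le> A0"
    and base: "\<And>p l. near p (rn * l) \<Longrightarrow> 0 < l \<Longrightarrow> l \<le> s0 \<Longrightarrow> \<Phi> 0 p l \<le> ennreal (A0 * l ^ CARD('n))"
    and step: "\<And>k p l. near p (rn * l) \<Longrightarrow> 0 < l \<Longrightarrow> l \<le> s0 \<Longrightarrow>
      \<exists>C. card C \<le> gridn ^ CARD('n) - 1 \<and> (\<forall>c\<in>C. near c (rn * (l / gridn))) \<and>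
        \<Phi> (Suc k) p l \<le> ennreal (A * l ^ CARD('n)) + (\<Sum>c\<in>C. \<Phi> k c (l / gridn))"
    and p: "near p (rn * l)" "0 < l" "l \<le> s0"
  shows "\<Phi> k p l \<le> ennreal ((A * real gridn ^ CARD('n) + decay ^ k * A0) * l ^ CARD('n))"
  using p
proof (induction k arbitrary: p l)
  case 0
  have "A0 * l ^ CARD('n) \<le> (A * real gridn ^ CARD('n) + decay ^ 0 * A0) * l ^ CARD('n)"
    using A 0 by (intro mult_right_mono) auto
  then show ?case using base[OF 0] by (meson ennreal_leI order_trans)
next
  case (Suc k)
  let ?G = "real gridn ^ CARD('n)"
  have G: "1 \<le> ?G" using gridn(4) by simp
  obtain C where C: "card C \<le> gridn ^ CARD('n) - 1" "\<forall>c\<in>C. near c (rn * (l / gridn))"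
    "\<Phi> (Suc k) p l \<le> ennreal (A * l ^ CARD('n)) + (\<Sum>c\<in>C. \<Phi> k c (l / gridn))"
    using step[OF Suc(2,3,4)] by blast
  define X where "X = (A * ?G + decay ^ k * A0) * (l / gridn) ^ CARD('n)"
  have X: "0 \<le> X" using A decay(1) Suc(3) by (simp add: X_def)
  have l': "0 < l / gridn" "l / gridn \<le> s0"
  proof -
    show "0 < l / gridn" using Suc(3) gridn(1) by simp
    have "l / gridn \<le> l / 1" using gridn(4) Suc(3) by (intro divide_left_mono) auto
    then show "l / gridn \<le> s0" using Suc(4) by simp
  qed
  have "(\<Sum>c\<in>C. \<Phi> k c (l / gridn)) \<le> (\<Sum>c\<in>C. ennreal X)"
    unfolding X_def using C(2) by (intro sum_mono Suc(1) l') blast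
  also have "\<dots> = ennreal (real (card C) * X)"
    using X by (simp add: ennreal_mult ennreal_of_nat_eq_real_of_nat)
  also have "\<dots> \<le> ennreal ((?G - 1) * X)"
  proof -
    have "real (card C) \<le> ?G - 1"
    proof -
      have "0 < gridn ^ CARD('n)" using gridn(1) by simp
      then have "card C + 1 \<le> gridn ^ CARD('n)" using C(1) by linarith
      then have "real (card C + 1) \<le> real (gridn ^ CARD('n))" by (simp only: of_nat_le_iff)
      then show ?thesis by simp
    qed
    then show ?thesis using X by (intro ennreal_leI mult_right_mono) auto
  qed
  finally have "\<Phi> (Suc k) p l \<le> ennreal (A * l ^ CARD('n)) + ennreal ((?G - 1) * X)"
    using C(3) by (meson add_left_mono order_trans)
  also have "\<dots> = ennreal (A * l ^ CARD('n) + (?G - 1) * X)"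
    using A G X Suc(3) by (simp add: ennreal_plus)
  also have "A * l ^ CARD('n) + (?G - 1) * X = (A * ?G + decay ^ Suc k * A0) * l ^ CARD('n)"
  proof -
    have "(?G - 1) * X = decay * (A * ?G + decay ^ k * A0) * l ^ CARD('n)"
      using gridn(1) by (simp add: X_def decay_def power_divide field_simps)
    moreover have "decay * (A * ?G) = A * ?G - A" using gridn(1) by (simp add: decay_def field_simps)
    ultimately have "(?G - 1) * X = (A * ?G - A + decay * (decay ^ k * A0)) * l ^ CARD('n)"
      by (simp only: distrib_left)
    then show ?thesis by (simp add: algebra_simps)
  qed
  finally show ?case .
qed

text \<open>Cells that are not near contain no frontier point, so there is no error term and the
  whole measure sits in the decaying term.\<close>

lemma null_frontier: "frontier \<Omega> \<in> null_sets lebesgue"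
proof -
  have "closed (frontier \<Omega>)" by simp
  then have fs: "frontier \<Omega> \<in> sets lebesgue" by simp
  have near_null: "ccube p l \<inter> frontier \<Omega> \<in> null_sets lebesgue"
    if p: "near p (rn * l)" "0 < l" "l \<le> \<rho>" for p l
  proof -
    \<comment> \<open>\<open>\<Phi>\<close> ignores the generation: one and the same measure is
      estimated with every power of \<open>decay\<close>.\<close>
    define \<Phi> where "\<Phi> = (\<lambda>(k::nat) p l. emeasure lebesgue (ccube p l \<inter> frontier \<Omega>))"
    have le: "\<Phi> k p l \<le> ennreal ((0 * real gridn ^ CARD('n) + decay ^ k * 1) * l ^ CARD('n))" for k
    proof (rule grid_induct[where ?s0.0 = \<rho>])
      fix p l assume l: "near p (rn * l)" "0 < l" "l \<le> \<rho>"
      show "\<Phi> 0 p l \<le> ennreal (1 * l ^ CARD('n))"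
        unfolding \<Phi>_def using l fs emeasure_mono[of "ccube p l \<inter> frontier \<Omega>" "ccube p l" lebesgue]
          emeasure_ccube[of l p] by simp
      fix k
      obtain C where C: "finite C" "card C \<le> gridn ^ CARD('n)" "ccube p l \<subseteq> (\<Union>c\<in>C. ccube c (l / gridn))"
        "\<And>c. c \<in> C \<Longrightarrow> ccube c (l / gridn) \<subseteq> ccube p l"
        "card {c\<in>C. near c (rn * (l / gridn))} \<le> gridn ^ CARD('n) - 1"
        using grid_near_cells[OF l(2,3), where p = p] by blast
      define C' where "C' = {c\<in>C. near c (rn * (l / gridn))}"
      have "ccube p l \<inter> frontier \<Omega> \<subseteq> (\<Union>c\<in>C'. ccube c (l / gridn) \<inter> frontier \<Omega>)"
      proof
        fix x assume x: "x \<in> ccube p l \<inter> frontier \<Omega>"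
        then obtain c where c: "c \<in> C" "x \<in> ccube c (l / gridn)" using C(3) by auto
        have h: "0 < rn * (l / gridn)" using l gridn(1) rn_ge_1 by simp
        have "dist c x \<le> rn * (l / gridn) / 2"
          using ccube_subset_cball_rn[of "l / gridn" c] c l by auto
        then have "dist c x < rn * (l / gridn)" by (rule less_of_le_half[OF h])
        then have "near c (rn * (l / gridn))" using x by (intro frontier_near[of x]) blast+
        then show "x \<in> (\<Union>c\<in>C'. ccube c (l / gridn) \<inter> frontier \<Omega>)" using c x by (auto simp: C'_def)
      qed
      then have "\<Phi> (Suc k) p l \<le> emeasure lebesgue (\<Union>c\<in>C'. ccube c (l / gridn) \<inter> frontier \<Omega>)"
        unfolding \<Phi>_def using C(1) fs by (intro emeasure_mono) (auto simp: C'_def intro!: sets.finite_UN)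
      also have "\<dots> \<le> (\<Sum>c\<in>C'. \<Phi> k c (l / gridn))"
        unfolding \<Phi>_def using C(1) fs by (intro emeasure_subadditive_finite) (auto simp: C'_def)
      finally show "\<exists>C. card C \<le> gridn ^ CARD('n) - 1 \<and> (\<forall>c\<in>C. near c (rn * (l / gridn))) \<and>
          \<Phi> (Suc k) p l \<le> ennreal (0 * l ^ CARD('n)) + (\<Sum>c\<in>C. \<Phi> k c (l / gridn))"
        using C(5) by (intro exI[of _ C']) (auto simp: C'_def)
    qed (use p in auto)
    have "(\<lambda>k. ennreal (decay ^ k * l ^ CARD('n))) \<longlonglongrightarrow> ennreal (0 * l ^ CARD('n))"
      using decay by (intro tendsto_ennrealI tendsto_mult_right LIMSEQ_realpow_zero) auto
    then have "emeasure lebesgue (ccube p l \<inter> frontier \<Omega>) \<le> ennreal (0 * l ^ CARD('n))"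
      using le by (intro LIMSEQ_le_const[of _ _ "emeasure lebesgue (ccube p l \<inter> frontier \<Omega>)"]) (auto simp: \<Phi>_def)
    then show ?thesis using sets.Int[OF ccube_sets fs] by (auto intro: null_setsI)
  qed
  obtain F where F: "F \<subseteq> (\<lambda>x. ball x (\<rho> / 2)) ` frontier \<Omega>" "countable F"
    "\<Union>F = \<Union>((\<lambda>x. ball x (\<rho> / 2)) ` frontier \<Omega>)"
    by (rule Lindelof[of "(\<lambda>x. ball x (\<rho> / 2)) ` frontier \<Omega>"]) auto
  have "(\<Union>B\<in>F. B \<inter> frontier \<Omega>) \<in> null_sets lebesgue"
  proof (rule null_sets_UN'[OF F(2)])
    fix B assume "B \<in> F"
    then obtain x where x: "B = ball x (\<rho> / 2)" "x \<in> frontier \<Omega>" using F(1) by auto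
    have "near x (rn * \<rho>)" using x(2) rho rn_ge_1 by (intro frontier_near[of x]) auto
    then have "ccube x \<rho> \<inter> frontier \<Omega> \<in> null_sets lebesgue" using rho by (intro near_null) auto
    moreover have "B \<inter> frontier \<Omega> \<subseteq> ccube x \<rho> \<inter> frontier \<Omega>" using x ball_subset_ccube[of x \<rho>] by auto
    moreover have "B \<inter> frontier \<Omega> \<in> sets lebesgue" using x fs by auto
    ultimately show "B \<inter> frontier \<Omega> \<in> null_sets lebesgue" by (metis null_sets_subset)
  qed
  moreover have "(\<Union>B\<in>F. B \<inter> frontier \<Omega>) = frontier \<Omega>"
  proof -
    have "frontier \<Omega> \<subseteq> \<Union>F" unfolding F(3) using rho by auto
    then show ?thesis by auto
  qed
  ultimately show ?thesis by simp
qed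

section \<open>The extension\<close>

text \<open>The cutoff varies between the distances \<open>\<rho> / 16\<close> and
  \<open>\<rho> / 8\<close>. Even at comparable points nearby, the distance is then still an
  admissible radius, at most \<open>\<rho> / 2\<close>.\<close>

definition r1 :: real where "r1 = \<rho> / 16"

lemma r1_pos: "0 < r1" using rho by (simp add: r1_def)

definition cut :: "real \<Rightarrow> real" where "cut t = max 0 (min 1 (2 - t / r1))"

lemma cut_bounds: "0 \<le> cut t" "cut t \<le> 1" by (auto simp: cut_def)

lemma cut_1: "t \<le> r1 \<Longrightarrow> cut t = 1" using r1_pos by (simp add: cut_def field_simps)

lemma cut_0: "2 * r1 \<le> t \<Longrightarrow> cut t = 0" using r1_pos by (simp add: cut_def field_simps)

lemma cut_lipschitz: "\<bar>cut s - cut t\<bar> \<le> \<bar>s - t\<bar> / r1"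
proof -
  have "\<bar>cut s - cut t\<bar> \<le> \<bar>s / r1 - t / r1\<bar>" by (simp add: cut_def max_def min_def abs_if)
  also have "\<dots> = \<bar>s - t\<bar> / r1" using r1_pos by (simp add: diff_divide_distrib[symmetric] abs_divide)
  finally show ?thesis .
qed

definition ext_part :: "(real ^ 'n \<Rightarrow> real) \<Rightarrow> real ^ 'n \<Rightarrow> real" where
  "ext_part f x = cut (infdist x \<Omega>) * kavg f x (infdist x \<Omega>)"

lemma infdist_pos_iff: "0 < infdist x \<Omega> \<longleftrightarrow> x \<notin> closure \<Omega>"
  using dom_nonempty infdist_nonneg[of x \<Omega>] by (auto simp: in_closure_iff_infdist_zero)

lemma ext_adm:
  assumes "0 < infdist x \<Omega>" "infdist x \<Omega> \<le> \<rho> / 2" shows "adm x (infdist x \<Omega>)"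
proof -
  have "x \<notin> \<Omega>" using assms(1) by auto
  then show ?thesis using assms by (auto simp: adm_def)
qed

text \<open>The change of the average contributes \<open>W\<close>, at the scale of the distance to
  \<open>\<Omega>\<close>; the change of the cutoff contributes \<open>V\<close>. The case
  distinction in the bound records that close to \<open>\<Omega>\<close> the cutoff is constant,
  which keeps the estimate local there.\<close>

lemma ext_part_lipschitz:
  obtains C where "0 \<le> C"
    "\<And>f V W q x y. locint f \<Longrightarrow> norm_bd f V \<Longrightarrow> osc_bd f (min (2 * infdist q \<Omega>) (\<rho> / 2)) W \<Longrightarrow>
       0 < infdist q \<Omega> \<Longrightarrow> dist q x \<le> infdist q \<Omega> / 2 \<Longrightarrow> dist q y \<le> infdist q \<Omega> / 2 \<Longrightarrow>
       \<bar>ext_part f x - ext_part f y\<bar>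
         \<le> C * (W / infdist q \<Omega> + (if infdist q \<Omega> \<le> r1 / 2 then 0 else V)) * dist x y"
proof -
  \<comment> \<open>Where the cutoff differs, one of the two points has distance above
    \<open>r1\<close> to \<open>\<Omega>\<close>; the distances of both are within a factor 3 of
    each other, so both exceed \<open>r1 / 3\<close>.\<close>
  obtain C0 where C0: "0 \<le> C0"
    "\<And>f V x r. locint f \<Longrightarrow> norm_bd f V \<Longrightarrow> adm x r \<Longrightarrow> r1 / 3 \<le> r \<Longrightarrow> \<bar>kavg f x r\<bar> \<le> C0 * V"
    using kavg_bounded[of "r1 / 3"] r1_pos by auto
  define C where "C = 4 * lip_const 3 + C0 / r1"
  have C: "0 \<le> C" "4 * lip_const 3 \<le> C" "C0 / r1 \<le> C"
    using C0(1) lip_const_nonneg[of 3] r1_pos by (auto simp: C_def)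
  show thesis
  proof (rule that[OF C(1)])
    fix f V W q x y
    assume f: "locint f" "norm_bd f V" "osc_bd f (min (2 * infdist q \<Omega>) (\<rho> / 2)) W"
      and q: "0 < infdist q \<Omega>" and xy: "dist q x \<le> infdist q \<Omega> / 2" "dist q y \<le> infdist q \<Omega> / 2"
    define dq where "dq = infdist q \<Omega>"
    define V' where "V' = (if dq \<le> r1 / 2 then 0 else V)"
    have V: "0 \<le> V" "0 \<le> V'" "V' \<le> V" using norm_bd_nonneg[OF f(2)] by (auto simp: V'_def)
    have W: "0 \<le> W" using f(3) by (rule osc_bd_nonneg)
    \<comment> \<open>\<open>kavg_lipschitz\<close> takes the larger radius first; symmetry settles
      the other order.\<close>
    have main: "\<bar>ext_part f x - ext_part f y\<bar> \<le> C * (W / dq + V') * dist x y"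
      if xy: "dist q x \<le> dq / 2" "dist q y \<le> dq / 2" and le: "infdist y \<Omega> \<le> infdist x \<Omega>" for x y
    proof -
      define dx where "dx = infdist x \<Omega>"
      define dy where "dy = infdist y \<Omega>"
      have d: "dq / 2 \<le> dx" "dx \<le> 3 * dq / 2" "dq / 2 \<le> dy" "dy \<le> 3 * dq / 2" "dx - dy \<le> dist x y" "dy \<le> dx"
        using infdist_triangle[of q \<Omega> x] infdist_triangle[of x \<Omega> q] infdist_triangle[of q \<Omega> y]
          infdist_triangle[of y \<Omega> q] infdist_triangle[of x \<Omega> y] xy le
        unfolding dx_def dy_def dq_def by (auto simp: dist_commute)
      have q0: "0 < dq" using q by (simp add: dq_def)
      have rhs: "0 \<le> C * (W / dq + V') * dist x y" using C W V q0 by simp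
      show ?thesis
      \<comment> \<open>Beyond \<open>4 * r1\<close> both points are at distance at least
        \<open>2 * r1\<close>, where the cutoff vanishes.\<close>
      proof (cases "dq \<le> 4 * r1")
        case False
        then have "cut dx = 0" "cut dy = 0" using d by (auto intro!: cut_0)
        then show ?thesis using rhs by (simp add: ext_part_def dx_def dy_def)
      next
        case True
        then have "dx \<le> \<rho> / 2" "dy \<le> \<rho> / 2" "2 * dq \<le> \<rho> / 2" using d rho by (auto simp: r1_def)
        then have a: "adm x dx" "adm y dy" using d q0 unfolding dx_def dy_def by (auto intro!: ext_adm)
        have W2: "osc_bd f dx W" using f(3) d \<open>2 * dq \<le> \<rho> / 2\<close> q0 by (auto simp: dq_def intro: osc_bd_mono)
        have xyd: "dist x y \<le> dq" using dist_triangle[of x y q] xy by (simp add: dist_commute)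
        have "\<bar>kavg f x dx - kavg f y dy\<bar> \<le> lip_const 3 * W * (dist x y + (dx - dy)) / dx"
          using d xyd q0 by (intro kavg_lipschitz[OF f(1) W2 _ a]) auto
        also have "\<dots> \<le> lip_const 3 * W * (dist x y + dist x y) / (dq / 2)"
          using d q0 W lip_const_nonneg[of 3] by (intro frac_le mult_left_mono) auto
        also have "\<dots> = 4 * lip_const 3 * (W / dq * dist x y)" by (simp add: field_simps)
        finally have 1: "\<bar>cut dx * (kavg f x dx - kavg f y dy)\<bar> \<le> 4 * lip_const 3 * (W / dq * dist x y)"
          unfolding abs_mult using cut_bounds[of dx] mult_right_mono[of "cut dx" 1 "\<bar>kavg f x dx - kavg f y dy\<bar>"]
          by simp
        have 2: "\<bar>(cut dx - cut dy) * kavg f y dy\<bar> \<le> C0 / r1 * (V' * dist x y)"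
        proof (cases "dx \<le> r1")
          case True
          then have "cut dx = cut dy" using d by (simp add: cut_1)
          then show ?thesis using C0(1) r1_pos V by simp
        next
          case False
          then have dy: "r1 / 3 \<le> dy" "V' = V" using d by (auto simp: V'_def)
          have "\<bar>cut dx - cut dy\<bar> \<le> dist x y / r1"
            using cut_lipschitz[of dx dy] d r1_pos by (simp add: divide_right_mono order_trans)
          then have "\<bar>(cut dx - cut dy) * kavg f y dy\<bar> \<le> dist x y / r1 * (C0 * V)"
            unfolding abs_mult using r1_pos by (intro mult_mono C0(2)[OF f(1,2) a(2) dy(1)]) auto
          then show ?thesis using dy by (simp add: mult_ac)
        qed
        have "ext_part f x - ext_part f y = cut dx * (kavg f x dx - kavg f y dy) + (cut dx - cut dy) * kavg f y dy"
          by (simp add: ext_part_def dx_def dy_def algebra_simps)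
        then have "\<bar>ext_part f x - ext_part f y\<bar> \<le> 4 * lip_const 3 * (W / dq * dist x y) + C0 / r1 * (V' * dist x y)"
          using 1 2 by linarith
        also have "\<dots> \<le> C * (W / dq * dist x y) + C * (V' * dist x y)"
          using C V W q0 by (intro add_mono mult_right_mono) auto
        finally show ?thesis by (simp add: algebra_simps)
      qed
    qed
    show "\<bar>ext_part f x - ext_part f y\<bar>
         \<le> C * (W / infdist q \<Omega> + (if infdist q \<Omega> \<le> r1 / 2 then 0 else V)) * dist x y"
      using main[of x y] main[of y x] xy unfolding dq_def[symmetric] V'_def[symmetric]
      by (cases "infdist y \<Omega> \<le> infdist x \<Omega>") (auto simp: dist_commute abs_minus_commute)
  qed
qed

lemma ext_part_continuous:
  assumes "locint f" "norm_bd f V"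
  shows "continuous_on (- closure \<Omega>) (ext_part f)"
proof (rule continuous_at_imp_continuous_on, rule ballI)
  fix q assume "q \<in> - closure \<Omega>"
  then have q: "0 < infdist q \<Omega>" by (simp add: infdist_pos_iff)
  obtain C where C: "0 \<le> C"
    "\<And>f V W q x y. locint f \<Longrightarrow> norm_bd f V \<Longrightarrow> osc_bd f (min (2 * infdist q \<Omega>) (\<rho> / 2)) W \<Longrightarrow>
       0 < infdist q \<Omega> \<Longrightarrow> dist q x \<le> infdist q \<Omega> / 2 \<Longrightarrow> dist q y \<le> infdist q \<Omega> / 2 \<Longrightarrow>
       \<bar>ext_part f x - ext_part f y\<bar>
         \<le> C * (W / infdist q \<Omega> + (if infdist q \<Omega> \<le> r1 / 2 then 0 else V)) * dist x y"
    using ext_part_lipschitz by blast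
  define L where "L = C * (V / infdist q \<Omega> + (if infdist q \<Omega> \<le> r1 / 2 then 0 else V))"
  have osc: "osc_bd f (min (2 * infdist q \<Omega>) (\<rho> / 2)) V" using rho by (intro norm_bd_osc[OF assms(2)]) auto
  have "L-lipschitz_on (cball q (infdist q \<Omega> / 2)) (ext_part f)"
  proof (rule lipschitz_onI)
    show "0 \<le> L" using C(1) q norm_bd_nonneg[OF assms(2)] by (simp add: L_def)
    fix x y assume "x \<in> cball q (infdist q \<Omega> / 2)" "y \<in> cball q (infdist q \<Omega> / 2)"
    then show "dist (ext_part f x) (ext_part f y) \<le> L * dist x y"
      unfolding L_def dist_real_def by (intro C(2) assms osc q) auto
  qed
  then have "continuous_on (cball q (infdist q \<Omega> / 2)) (ext_part f)" by (rule lipschitz_on_continuous_on)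
  then have "continuous_on (ball q (infdist q \<Omega> / 2)) (ext_part f)"
    by (rule continuous_on_subset) auto
  then show "isCont (ext_part f) q"
    using q by (simp add: continuous_on_eq_continuous_at)
qed

text \<open>On the boundary, a null set, the values only matter for functions whose kernel averages
  converge; \<open>L\<close> will be a linear extension of the limit to all real sequences.\<close>

definition ext_op :: "((nat \<Rightarrow> real) \<Rightarrow> real) \<Rightarrow> (real ^ 'n \<Rightarrow> real) \<Rightarrow> real ^ 'n \<Rightarrow> real" where
  "ext_op L f x = (if x \<in> \<Omega> then f x
     else if x \<in> closure \<Omega> then L (\<lambda>k. kavg f x (\<rho> / 2 / (real k + 1)))
     else ext_part f x)"

text \<open>Nothing is known about the values on the boundary, since \<open>L\<close> is arbitrary.
  Measurability rests on \<open>null_frontier\<close> and on the completeness of Lebesgue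
  measure.\<close>

lemma ext_op_measurable:
  assumes "locint f" "norm_bd f V"
  shows "ext_op L f \<in> borel_measurable lebesgue"
proof -
  define G where "G x = indicator \<Omega> x * f x + indicator (- closure \<Omega>) x *\<^sub>R ext_part f x" for x
  have "(\<lambda>x. indicator (- closure \<Omega>) x *\<^sub>R ext_part f x) \<in> borel_measurable borel"
    by (rule borel_measurable_continuous_on_indicator) (auto intro: ext_part_continuous[OF assms])
  then have "(\<lambda>x. indicator (- closure \<Omega>) x *\<^sub>R ext_part f x) \<in> borel_measurable lebesgue"
    by (intro measurable_completion) simp
  then have G: "G \<in> borel_measurable lebesgue"
    unfolding G_def using locint_measurable[OF assms(1)] by (intro borel_measurable_add)
  have ae: "AE x in lebesgue. x \<notin> frontier \<Omega>" using null_frontier by (rule AE_not_in)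
  have eq: "ext_op L f x = G x" if "x \<notin> frontier \<Omega>" for x
    using that closure_subset[of \<Omega>] open_dom
    by (auto simp: ext_op_def G_def frontier_def interior_open)
  show ?thesis
  proof (rule measurableI)
    fix A :: "real set" assume A: "A \<in> sets borel"
    have "AE x in lebesgue. x \<in> G -` A \<inter> space lebesgue \<longleftrightarrow> x \<in> ext_op L f -` A \<inter> space lebesgue"
      using ae by (rule AE_mp) (rule AE_I2, simp add: eq)
    then show "ext_op L f -` A \<inter> space lebesgue \<in> sets lebesgue"
      by (rule completion.in_sets_AE[OF _ measurable_sets[OF G A]]) simp
  qed simp
qed

text \<open>Truncating cubes to these sets makes the recursion over the generations end with an
  empty set instead of an integral not yet known to be finite.\<close>

definition far :: "real \<Rightarrow> (real ^ 'n) set" where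
  "far t = {x. ball x t \<inter> frontier \<Omega> = {}}"

lemma far_sets: "far t \<in> sets lebesgue"
proof -
  have "far t = (\<Inter>z\<in>frontier \<Omega>. {x. t \<le> dist x z})"
  proof (intro equalityI subsetI)
    fix x assume "x \<in> far t"
    then have "z \<notin> ball x t" if "z \<in> frontier \<Omega>" for z using that by (auto simp: far_def)
    then show "x \<in> (\<Inter>z\<in>frontier \<Omega>. {x. t \<le> dist x z})" by (auto simp: not_less)
  next
    fix x assume x: "x \<in> (\<Inter>z\<in>frontier \<Omega>. {x. t \<le> dist x z})"
    have "z \<notin> frontier \<Omega>" if "z \<in> ball x t" for z
    proof
      assume "z \<in> frontier \<Omega>"
      then have "t \<le> dist x z" using x by blast
      then show False using that by simp
    qed
    then show "x \<in> far t" unfolding far_def by blast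
  qed
  moreover have "closed (\<Inter>z\<in>frontier \<Omega>. {x. t \<le> dist x z})"
    by (intro closed_INT ballI closed_Collect_le continuous_intros)
  ultimately have "closed (far t)" by simp
  then show ?thesis by simp
qed

definition s0 :: real where "s0 = \<rho> / (32 * rn)"

lemma s0: "0 < s0" "rn * s0 = \<rho> / 32" "s0 \<le> \<rho> / 32"
proof -
  show "0 < s0" "rn * s0 = \<rho> / 32" using rho rn_ge_1 by (auto simp: s0_def)
  then show "s0 \<le> \<rho> / 32" using mult_right_mono[OF rn_ge_1, of s0] by linarith
qed

text \<open>The contributions of the part deep inside \<open>\<Omega>\<close> (its deviation and a
  shift of the reference value), of the exterior part, and of the shifts of reference value on the
  near cells.\<close>

definition near_const :: real where
  "near_const = (let R = ref_const (4 * gridn) in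
     deep_const 14 (kc (4 * gridn)) * (2 * rn) ^ CARD('n) + R * (56 * rn) ^ CARD('n) + 2 * R + 2 * R)"

lemma near_const_nonneg: "0 \<le> near_const"
  using ref_const_nonneg[of "4 * gridn"] deep_const_nonneg[of 14 "kc (4 * gridn)"] kc_bounds[of "4 * gridn"]
    gridn(4) rn_ge_1 by (simp add: near_const_def Let_def)

text \<open>One generation: inside \<open>\<Omega>\<close> and outside its closure, away from the
  boundary, the deviation is of order \<open>W\<close>. The near cells are passed on, each with its
  own reference value, and the truncation by \<open>t\<close> is the same on both sides.\<close>

lemma near_step:
  assumes f: "locint f" "norm_bd f V" "osc_bd f (2 * (rn * l)) W"
    and p: "near p (rn * l)" and l: "0 < l" "l \<le> s0"
  obtains C where "card C \<le> gridn ^ CARD('n) - 1" "\<forall>c\<in>C. near c (rn * (l / gridn))"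
    "\<And>t. dev (ext_op L f) (kavg f p (rn * l)) (ccube p l \<inter> far t)
      \<le> ennreal (near_const * W * l ^ CARD('n)) +
        (\<Sum>c\<in>C. dev (ext_op L f) (kavg f c (rn * (l / gridn))) (ccube c (l / gridn) \<inter> far t))"
proof -
  define M where "M = real gridn"
  have M: "1 \<le> M" using gridn(4) by (simp add: M_def)
  \<comment> \<open>The radii that occur range from \<open>r / (2 * M)\<close> to
    \<open>2 * r\<close>.\<close>
  define \<Theta> where "\<Theta> = 4 * M"
  have T: "1 \<le> \<Theta>" using M by (simp add: \<Theta>_def)
  define r where "r = rn * l"
  have r: "0 < r" "r \<le> \<rho> / 32" 
    using l rn_ge_1 mult_left_mono[OF l(2), of rn] unfolding s0(2) by (auto simp: r_def)
  define F where "F = ext_op L f"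
  have F: "F \<in> borel_measurable lebesgue" unfolding F_def by (rule ext_op_measurable[OF f(1,2)])
  have W: "0 \<le> W" using f(3) by (rule osc_bd_nonneg)
  have osc: "osc_bd f (2 * r) W" using f(3) by (simp add: r_def)
  have ap: "adm p r" using near_adm[OF p] r rho by (simp add: r_def)
  then have ap2: "adm p (2 * r)" using r rho by (auto simp: adm_def)
  obtain p0 where p0: "p0 \<in> deep p 14 (kc \<Theta>) (2 * r)" using corkscrew_deep[OF ap2 T] .
  define a where "a = ref_avg f p0 14 (kc \<Theta>) (2 * r)"
  define RC where "RC = ref_const \<Theta>"
  have RC: "0 \<le> RC" unfolding RC_def by (rule ref_const_nonneg[OF T])
  \<comment> \<open>The single value \<open>a\<close> mediates between \<open>b\<close>, the
    averages at exterior points and those at the centres of cells.\<close>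
  have kr: "\<bar>kavg f x r' - a\<bar> \<le> RC * W"
    if "adm x r'" "r' \<le> 2 * r" "r / (2 * M) \<le> r'" "dist p x \<le> 20 * r" for x r'
    unfolding a_def RC_def
  proof (rule kavg_near_ref[OF f(1) osc _ _ T p0 that(1,2)])
    show "2 * r \<le> \<Theta> * r'" using that(3) M by (simp add: \<Theta>_def field_simps)
  qed (use r rho that in auto)
  define b where "b = kavg f p r"
  have Mr: "r / (2 * M) \<le> r" "r / (2 * M) \<le> r / M" "r / M \<le> r"
    using r M by (auto simp: field_simps)
  have ba: "\<bar>b - a\<bar> \<le> RC * W" unfolding b_def using ap r Mr by (intro kr) auto
  define Q where "Q = ccube p l"
  define S1 where "S1 = deep p 14 (kc \<Theta>) (2 * r)"
  define S2 where "S2 = {x. r / (2 * M) \<le> infdist x \<Omega>}"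
  have S1: "S1 \<subseteq> \<Omega>" "S1 \<in> sets lebesgue"
    unfolding S1_def using deep_subset[OF kc_bounds(1)[OF T], of "2 * r"] r deep_measurable by auto
  have "closed S2" unfolding S2_def by (intro closed_Collect_le continuous_intros)
  then have S2: "S2 \<in> sets lebesgue" by simp
  have Qdist: "dist p x \<le> r / 2" if "x \<in> Q" for x
    using that ccube_subset_cball_rn[of l p] l by (auto simp: Q_def r_def)
  have lr: "l \<le> \<rho>" using l s0(3) rho by linarith
  obtain C where C: "finite C" "card C \<le> gridn ^ CARD('n)" "Q \<subseteq> (\<Union>c\<in>C. ccube c (l / gridn))"
    "\<And>c. c \<in> C \<Longrightarrow> ccube c (l / gridn) \<subseteq> Q"
    "card {c\<in>C. near c (rn * (l / gridn))} \<le> gridn ^ CARD('n) - 1"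
    using grid_near_cells[OF l(1) lr, where p = p] unfolding Q_def by blast
  define h where "h = l / gridn"
  have h: "0 < h" "rn * h = r / M" using l gridn(1) by (auto simp: h_def r_def M_def)
  define C' where "C' = {c\<in>C. near c (rn * h)}"
  have C': "finite C'" "card C' \<le> gridn ^ CARD('n)"
    using C(1,2) card_mono[OF C(1), of C'] by (auto simp: C'_def)
  \<comment> \<open>In a cell that is not near, the ball about the centre leaves every point a
    margin \<open>r / (2 * M)\<close>. This puts the point into \<open>S1\<close> if the ball lies
    in \<open>\<Omega>\<close>, and into \<open>S2\<close> if it misses
    \<open>\<Omega>\<close>.\<close>
  have cover: "Q \<subseteq> (Q \<inter> S1) \<union> (Q \<inter> S2) \<union> (\<Union>c\<in>C'. ccube c h)"
  proof
    fix x assume x: "x \<in> Q"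
    then obtain c where c: "c \<in> C" "x \<in> ccube c h" using C(3) by (auto simp: h_def)
    have cx: "dist c x \<le> r / M / 2" using ccube_subset_cball_rn[of h c] c h by auto
    have bx: "ball x (r / (2 * M)) \<subseteq> cball c (rn * h)"
    proof
      fix y assume "y \<in> ball x (r / (2 * M))"
      then show "y \<in> cball c (rn * h)" using cx dist_triangle[of c y x] by (simp add: h(2))
    qed
    show "x \<in> (Q \<inter> S1) \<union> (Q \<inter> S2) \<union> (\<Union>c\<in>C'. ccube c h)"
    proof (cases "near c (rn * h)")
      case True then show ?thesis using c by (auto simp: C'_def)
    next
      case False
      then consider "cball c (rn * h) \<subseteq> \<Omega>" | "cball c (rn * h) \<inter> \<Omega> = {}" by (auto simp: near_def)
      then show ?thesis
      proof cases
        case 1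
        have "kc \<Theta> * (2 * r) \<le> r / (2 * M)"
          using eps r M mult_right_mono[OF eps(2), of r] by (simp add: \<Theta>_def field_simps)
        then have "ball x (kc \<Theta> * (2 * r)) \<subseteq> \<Omega>" using bx 1 subset_ball by blast
        moreover have "dist p x \<le> 14 * (2 * r)" using Qdist[OF x] r by simp
        ultimately show ?thesis using x by (simp add: S1_def deep_def)
      next
        case 2
        have "r / (2 * M) \<le> infdist x \<Omega>"
          unfolding infdist_notempty[OF dom_nonempty]
        proof (rule cINF_greatest[OF dom_nonempty])
          fix y assume "y \<in> \<Omega>"
          then have "y \<notin> ball x (r / (2 * M))" using bx 2 by blast
          then show "r / (2 * M) \<le> dist x y" by simp
        qed
        then show ?thesis using x by (simp add: S2_def)
      qed
    qed
  qed
  have Q: "Q \<in> sets lebesgue" by (simp add: Q_def)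
  define A1 where "A1 = deep_const 14 (kc \<Theta>) * (2 * rn) ^ CARD('n) + RC * (56 * rn) ^ CARD('n)"
  have A1: "0 \<le> A1" using deep_const_nonneg[of 14 "kc \<Theta>"] kc_bounds[OF T] RC rn_ge_1 by (simp add: A1_def)
  have d1: "dev F b (Q \<inter> S1)
      \<le> ennreal (A1 * W * l ^ CARD('n))"
  proof -
    have "dev F b (Q \<inter> S1) \<le> dev F b S1" by (rule dev_mono) simp
    also have "dev F b S1 = dev f b S1"
      using S1 by (intro nn_integral_cong) (auto simp: F_def ext_op_def indicator_def)
    also have "\<dots> \<le> dev f a S1 + ennreal \<bar>a - b\<bar> * emeasure lebesgue S1"
      by (intro dev_shift dev_measurable_dom f S1)
    also have "\<dots> \<le> ennreal (deep_const 14 (kc \<Theta>) * W * (2 * r) ^ CARD('n)) + ennreal (RC * W) * ennreal ((56 * r) ^ CARD('n))"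
    proof (intro add_mono mult_mono ennreal_leI)
      show "dev f a S1 \<le> ennreal (deep_const 14 (kc \<Theta>) * W * (2 * r) ^ CARD('n))"
        unfolding a_def S1_def using r rho by (intro dev_deep_kc f osc T p0) auto
      have "S1 \<subseteq> ccube p (56 * r)" using cball_subset_ccube[of p "56 * r"] by (auto simp: S1_def deep_def)
      then have "emeasure lebesgue S1 \<le> emeasure lebesgue (ccube p (56 * r))" by (intro emeasure_mono) auto
      then show "emeasure lebesgue S1 \<le> ennreal ((56 * r) ^ CARD('n))"
        using emeasure_ccube[of "56 * r" p] r by simp
    qed (use ba in auto)
    also have "\<dots> = ennreal (deep_const 14 (kc \<Theta>) * W * (2 * r) ^ CARD('n) + RC * W * (56 * r) ^ CARD('n))"
      using deep_const_nonneg[of 14 "kc \<Theta>"] kc_bounds[OF T] W RC r by (simp add: ennreal_mult ennreal_plus)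
    also have "deep_const 14 (kc \<Theta>) * W * (2 * r) ^ CARD('n) + RC * W * (56 * r) ^ CARD('n)
       = A1 * W * l ^ CARD('n)"
      by (simp add: A1_def r_def power_mult_distrib algebra_simps)
    finally show ?thesis .
  qed
  have d2: "dev F b (Q \<inter> S2) \<le> ennreal (2 * RC * W * l ^ CARD('n))"
  proof (rule dev_le_const[where p = p])
    fix x assume x: "x \<in> Q \<inter> S2"
    define d where "d = infdist x \<Omega>"
    have "infdist x \<Omega> \<le> infdist p \<Omega> + dist x p" by (rule infdist_triangle)
    then have d: "r / (2 * M) \<le> d" "d \<le> 3 / 2 * r"
      using x Qdist[of x] ap by (auto simp: d_def S2_def adm_def dist_commute)
    have "0 < r / (2 * M)" using r M by simp
    then have d0: "0 < d" using d by simp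
    \<comment> \<open>So close to \<open>\<Omega>\<close> the cutoff equals 1, and the extension is
      a plain kernel average.\<close>
    have "d \<le> \<rho> / 2" "d \<le> r1" using d r rho by (auto simp: r1_def)
    then have ax: "adm x d" using ext_adm[of x] d0 by (simp add: d_def)
    have "x \<notin> closure \<Omega>" using d0 infdist_pos_iff by (simp add: d_def)
    then have "F x = kavg f x d"
      using closure_subset[of \<Omega>] \<open>d \<le> r1\<close> by (auto simp: F_def ext_op_def ext_part_def d_def cut_1)
    moreover have "\<bar>kavg f x d - a\<bar> \<le> RC * W" using ax d r Qdist[of x] x by (intro kr) auto
    ultimately show "\<bar>F x - b\<bar> \<le> 2 * RC * W" using ba by simp
  qed (use RC W l in \<open>auto simp: Q_def\<close>)
  have d3: "dev F b (ccube c h \<inter> far t) \<le> dev F (kavg f c (rn * h)) (ccube c h \<inter> far t) + ennreal (2 * RC * W * h ^ CARD('n))"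
    if c: "c \<in> C'" for c t
  proof -
    have ac: "adm c (rn * h)" using c near_adm[of c "rn * h"] r Mr M h rho by (auto simp: C'_def h(2))
    have "c \<in> ccube c h" using h by (simp add: mem_ccube)
    then have "c \<in> Q" using c C(4) by (auto simp: C'_def h_def)
    then have "\<bar>kavg f c (rn * h) - a\<bar> \<le> RC * W" using ac Qdist[of c] Mr r by (intro kr) (auto simp: h(2))
    then have cb: "\<bar>kavg f c (rn * h) - b\<bar> \<le> 2 * RC * W" using ba by simp
    have "dev F b (ccube c h \<inter> far t) \<le> dev F (kavg f c (rn * h)) (ccube c h \<inter> far t)
        + ennreal \<bar>kavg f c (rn * h) - b\<bar> * emeasure lebesgue (ccube c h \<inter> far t)"
    proof (rule dev_shift)
      show "(\<lambda>x. ennreal \<bar>F x - kavg f c (rn * h)\<bar> * indicator (ccube c h \<inter> far t) x) \<in> borel_measurable lebesgue"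
        using far_sets by (intro dev_integrand_measurable F) auto
    qed (use far_sets in auto)
    also have "\<dots> \<le> dev F (kavg f c (rn * h)) (ccube c h \<inter> far t) + ennreal (2 * RC * W) * ennreal (h ^ CARD('n))"
    proof (intro add_mono order_refl mult_mono ennreal_leI cb)
      show "emeasure lebesgue (ccube c h \<inter> far t) \<le> ennreal (h ^ CARD('n))"
        using emeasure_mono[of "ccube c h \<inter> far t" "ccube c h" lebesgue] emeasure_ccube[of h c] h by simp
    qed auto
    also have "ennreal (2 * RC * W) * ennreal (h ^ CARD('n)) = ennreal (2 * RC * W * h ^ CARD('n))"
      using RC W h by (simp add: ennreal_mult)
    finally show ?thesis .
  qed
  show thesis
  proof (rule that[of C'])
    show "card C' \<le> gridn ^ CARD('n) - 1" using C(5) by (simp add: C'_def h_def)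
    show "\<forall>c\<in>C'. near c (rn * (l / gridn))" by (simp add: C'_def h_def)
    fix t
    let ?T = "far t"
    have Tm: "?T \<in> sets lebesgue" by (rule far_sets)
    have U: "(\<Union>c\<in>C'. ccube c h \<inter> ?T) \<in> sets lebesgue" using C'(1) Tm by (intro sets.finite_UN) auto
    have "dev F b (Q \<inter> ?T) \<le> dev F b ((Q \<inter> S1) \<union> (Q \<inter> S2) \<union> (\<Union>c\<in>C'. ccube c h \<inter> ?T))"
      using cover by (intro dev_mono) auto
    also have "\<dots> \<le> dev F b ((Q \<inter> S1) \<union> (Q \<inter> S2)) + dev F b (\<Union>c\<in>C'. ccube c h \<inter> ?T)"
      by (intro dev_Un F U sets.Un sets.Int Q S1 S2)
    also have "\<dots> \<le> (dev F b (Q \<inter> S1) + dev F b (Q \<inter> S2)) + (\<Sum>c\<in>C'. dev F b (ccube c h \<inter> ?T))"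
      using Q S1 S2 Tm C' F by (intro add_mono dev_Un nn_integral_finite_cover dev_integrand_measurable) auto
    also have "\<dots> \<le> (ennreal (A1 * W * l ^ CARD('n))
        + ennreal (2 * RC * W * l ^ CARD('n)))
        + (\<Sum>c\<in>C'. dev F (kavg f c (rn * h)) (ccube c h \<inter> ?T) + ennreal (2 * RC * W * h ^ CARD('n)))"
      by (intro add_mono d1 d2 sum_mono d3)
    also have "(\<Sum>c\<in>C'. dev F (kavg f c (rn * h)) (ccube c h \<inter> ?T) + ennreal (2 * RC * W * h ^ CARD('n)))
      \<le> (\<Sum>c\<in>C'. dev F (kavg f c (rn * h)) (ccube c h \<inter> ?T)) + ennreal (2 * RC * W * l ^ CARD('n))"
    proof -
      have "(\<Sum>c\<in>C'. ennreal (2 * RC * W * h ^ CARD('n))) = ennreal (real (card C') * (2 * RC * W * h ^ CARD('n)))"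
        using RC W h by (simp add: ennreal_mult ennreal_of_nat_eq_real_of_nat)
      also have "\<dots> \<le> ennreal (real (gridn ^ CARD('n)) * (2 * RC * W * h ^ CARD('n)))"
        using C'(2) RC W h by (intro ennreal_leI mult_right_mono) (auto simp del: of_nat_power)
      also have "real (gridn ^ CARD('n)) * (2 * RC * W * h ^ CARD('n)) = 2 * RC * W * l ^ CARD('n)"
        using gridn(1) by (simp add: h_def power_divide)
      finally show ?thesis by (simp add: sum.distrib add_left_mono)
    qed
    finally have "dev F b (Q \<inter> ?T) \<le> (ennreal (A1 * W * l ^ CARD('n))
        + ennreal (2 * RC * W * l ^ CARD('n)) + ennreal (2 * RC * W * l ^ CARD('n)))
        + (\<Sum>c\<in>C'. dev F (kavg f c (rn * h)) (ccube c h \<inter> ?T))"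
      by (simp add: ac_simps add_left_mono)
    also have "ennreal (A1 * W * l ^ CARD('n))
        + ennreal (2 * RC * W * l ^ CARD('n)) + ennreal (2 * RC * W * l ^ CARD('n))
        = ennreal (near_const * W * l ^ CARD('n))"
    proof -
      have "0 \<le> A1 * W * l ^ CARD('n)" using A1 W l by simp
      moreover have "0 \<le> 2 * RC * W * l ^ CARD('n)" using RC W l by simp
      moreover have "A1 * W * l ^ CARD('n) + 2 * RC * W * l ^ CARD('n) + 2 * RC * W * l ^ CARD('n) = near_const * W * l ^ CARD('n)"
        unfolding A1_def near_const_def Let_def RC_def \<Theta>_def M_def by (simp add: algebra_simps)
      ultimately show ?thesis by (metis ennreal_plus add_nonneg_nonneg)
    qed
    finally show "dev (ext_op L f) (kavg f p (rn * l)) (ccube p l \<inter> far t)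
      \<le> ennreal (near_const * W * l ^ CARD('n)) +
        (\<Sum>c\<in>C'. dev (ext_op L f) (kavg f c (rn * (l / gridn))) (ccube c (l / gridn) \<inter> far t))"
      unfolding F_def b_def Q_def r_def h_def .
  qed
qed

text \<open>The bound for the truncated cubes is uniform in the number \<open>k\<close> of
  generations. As \<open>k\<close> grows the truncations exhaust the cube up to the frontier, which
  is null, and monotone convergence applies.\<close>

lemma near_dev:
  assumes f: "locint f" "norm_bd f V" "osc_bd f (2 * (rn * l)) W"
    and p: "near p (rn * l)" and l: "0 < l" "l \<le> s0"
  shows "dev (ext_op L f) (kavg f p (rn * l)) (ccube p l)
    \<le> ennreal (near_const * real gridn ^ CARD('n) * W * l ^ CARD('n))"
proof -
  define F where "F = ext_op L f"
  have F: "F \<in> borel_measurable lebesgue" unfolding F_def by (rule ext_op_measurable[OF f(1,2)])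
  have W: "0 \<le> W" using f(3) by (rule osc_bd_nonneg)
  \<comment> \<open>Twice the radius \<open>rn * l / gridn ^ k\<close> that belongs to the cells
    after \<open>k\<close> generations.\<close>
  let ?t = "\<lambda>k l. 2 * (rn * l) / real gridn ^ k"
  define \<Phi> where "\<Phi> = (\<lambda>k p l. dev F (kavg f p (rn * l)) (ccube p l \<inter> far (?t k l)))"
  have bound: "\<Phi> k p l \<le> ennreal ((near_const * W * real gridn ^ CARD('n) + decay ^ k * 0) * l ^ CARD('n))" for k
  proof (rule grid_induct[where ?s0.0 = l])
    fix p' l' assume p': "near p' (rn * l')" and l': "0 < l'" "l' \<le> l"
    \<comment> \<open>A near cube lies within \<open>3 / 2 * (rn * l')\<close> of a frontier point,
      so nothing of it survives the truncation and the recursion starts at 0.\<close>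
    have "ccube p' l' \<inter> far (?t 0 l') = {}"
    proof (rule ccontr)
      assume "ccube p' l' \<inter> far (?t 0 l') \<noteq> {}"
      then obtain x where x: "x \<in> ccube p' l'" "ball x (2 * (rn * l')) \<inter> frontier \<Omega> = {}" by (auto simp: far_def)
      obtain z where z: "z \<in> frontier \<Omega>" "dist p' z \<le> rn * l'" using near_frontier[OF p'] .
      have "dist p' x \<le> rn * l' / 2" using ccube_subset_cball_rn[of l' p'] x l' by auto
      moreover have "0 < rn * l'" using l' rn_ge_1 by simp
      ultimately have "dist x z < 2 * (rn * l')" using z(2) dist_triangle[of x z p']
        unfolding dist_commute[of x p'] by linarith
      then show False using x z by auto
    qed
    then show "\<Phi> 0 p' l' \<le> ennreal (0 * l' ^ CARD('n))" by (simp add: \<Phi>_def)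
    fix k
    have "2 * (rn * l') \<le> 2 * (rn * l)" using l' rn_ge_1 by simp
    then have osc: "osc_bd f (2 * (rn * l')) W" by (rule osc_bd_mono[OF f(3)])
    have ls: "l' \<le> s0" using l l' by simp
    obtain C where C: "card C \<le> gridn ^ CARD('n) - 1" "\<forall>c\<in>C. near c (rn * (l' / gridn))"
      "\<And>t. dev F (kavg f p' (rn * l')) (ccube p' l' \<inter> far t)
        \<le> ennreal (near_const * W * l' ^ CARD('n)) +
          (\<Sum>c\<in>C. dev F (kavg f c (rn * (l' / gridn))) (ccube c (l' / gridn) \<inter> far t))"
      using near_step[OF f(1,2) osc p' l'(1) ls, of L] unfolding F_def by blast
    \<comment> \<open>A cell with one generation fewer has the same truncation distance.\<close>
    have "?t (Suc k) l' = ?t k (l' / gridn)" using gridn(1) by (simp add: field_simps)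
    then show "\<exists>C. card C \<le> gridn ^ CARD('n) - 1 \<and> (\<forall>c\<in>C. near c (rn * (l' / gridn))) \<and>
        \<Phi> (Suc k) p' l' \<le> ennreal (near_const * W * l' ^ CARD('n)) + (\<Sum>c\<in>C. \<Phi> k c (l' / gridn))"
      using C unfolding \<Phi>_def by (intro exI[of _ C]) metis
  qed (use near_const_nonneg W p l in auto)
  define g where "g k x = ennreal \<bar>F x - kavg f p (rn * l)\<bar> * indicator (ccube p l \<inter> far (?t k l)) x" for k x
  have rl: "0 < 2 * (rn * l)" using l rn_ge_1 by simp
  have t_mono: "?t (Suc k) l \<le> ?t k l" for k
  proof -
    have "?t (Suc k) l = ?t k l / real gridn" using gridn(1) by (simp add: field_simps)
    also have "\<dots> \<le> ?t k l / 1" using rl gridn(1,4) by (intro divide_left_mono) auto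
    finally show ?thesis by simp
  qed
  have inc: "incseq g"
  proof (rule incseq_SucI, rule le_funI)
    fix k x
    have "far (?t k l) \<subseteq> far (?t (Suc k) l)"
      unfolding far_def using subset_ball[OF t_mono] by blast
    then show "g k x \<le> g (Suc k) x" unfolding g_def by (intro mult_left_mono) (auto simp: indicator_def)
  qed
  have gm: "g k \<in> borel_measurable lebesgue" for k
    unfolding g_def using far_sets by (intro dev_integrand_measurable F) auto
  have "AE x in lebesgue. x \<notin> frontier \<Omega>" using null_frontier by (rule AE_not_in)
  then have "dev F (kavg f p (rn * l)) (ccube p l) \<le> (\<integral>\<^sup>+x. (SUP k. g k x) \<partial>lebesgue)"
  proof (intro nn_integral_mono_AE, eventually_elim)
    fix x assume x: "x \<notin> frontier \<Omega>"
    show "ennreal \<bar>F x - kavg f p (rn * l)\<bar> * indicator (ccube p l) x \<le> (SUP k. g k x)"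
    proof (cases "x \<in> ccube p l")
      case True
      have "open (- frontier \<Omega>)" by (simp add: open_Compl)
      then obtain e where e: "0 < e" "ball x e \<subseteq> - frontier \<Omega>" using x openE by blast
      have "1 < real gridn" using gridn(3) rn_ge_1 by simp
      then have "(\<lambda>k. ?t k l) \<longlonglongrightarrow> 0" by (rule LIMSEQ_divide_realpow_zero)
      then have "eventually (\<lambda>k. ?t k l < e) sequentially" using e(1) by (rule order_tendstoD(2))
      then obtain k where k: "?t k l < e" by (auto simp: eventually_sequentially)
      then have "ball x (?t k l) \<subseteq> - frontier \<Omega>" using e(2) subset_ball[of "?t k l" e x] by simp
      then have "x \<in> far (?t k l)" unfolding far_def by blast
      then have "ennreal \<bar>F x - kavg f p (rn * l)\<bar> * indicator (ccube p l) x = g k x"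
        using True by (simp add: g_def)
      also have "\<dots> \<le> (SUP k. g k x)" by (rule SUP_upper) simp
      finally show ?thesis .
    qed simp
  qed
  also have "\<dots> = (SUP k. \<integral>\<^sup>+x. g k x \<partial>lebesgue)" by (rule nn_integral_monotone_convergence_SUP[OF inc gm])
  also have "\<dots> \<le> ennreal (near_const * real gridn ^ CARD('n) * W * l ^ CARD('n))"
    using bound unfolding \<Phi>_def g_def by (intro SUP_least) (simp add: mult_ac)
  finally show ?thesis by (simp add: F_def)
qed

section \<open>Bounds for the extension\<close>

lemma ext_op_outside: "0 < infdist x \<Omega> \<Longrightarrow> ext_op L f x = ext_part f x"
  using infdist_pos_iff[of x] closure_subset[of \<Omega>] by (auto simp: ext_op_def)

lemma dev_ext_op_inside: "S \<subseteq> \<Omega> \<Longrightarrow> dev (ext_op L f) a S = dev f a S"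
  by (intro nn_integral_cong) (auto simp: ext_op_def indicator_def)

lemma infdist_ge_of_disjoint:
  assumes "cball p t \<inter> \<Omega> = {}" shows "t \<le> infdist p \<Omega>"
  unfolding infdist_notempty[OF dom_nonempty]
proof (rule cINF_greatest[OF dom_nonempty])
  fix y assume "y \<in> \<Omega>"
  then have "y \<notin> cball p t" using assms by blast
  then show "t \<le> dist p y" by simp
qed

lemma ccube_subset_cball_half: "0 \<le> l \<Longrightarrow> x \<in> ccube (p :: real ^ 'n) l \<Longrightarrow> dist p x \<le> rn * l / 2"
  using ccube_subset_cball_rn[of l p] by auto

lemma cube_cases:
  assumes "0 < l"
  obtains "near p (rn * l)" | "ccube p l \<subseteq> \<Omega>" | "rn * l \<le> infdist p \<Omega>"
proof -
  consider "near p (rn * l)" | "cball p (rn * l) \<subseteq> \<Omega>" | "cball p (rn * l) \<inter> \<Omega> = {}"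
    by (auto simp: near_def)
  then show thesis
  proof cases
    case 2
    have "0 < rn * l" using assms rn_ge_1 by simp
    then have "ccube p l \<subseteq> cball p (rn * l)" using ccube_subset_cball_half[of l _ p] assms by fastforce
    then show ?thesis using that 2 by blast
  qed (use that infdist_ge_of_disjoint in blast)+
qed

text \<open>The scale \<open>\<eta>\<close> separates two regimes. Where the oscillation is taken at
  sides up to \<open>2 * \<eta>\<close> it is bounded by \<open>W\<close>; at distance above
  \<open>\<eta>\<close> from \<open>\<Omega>\<close> only \<open>V\<close> is available, but the
  extension is Lipschitz there and the small side is gained. Boundedness fixes
  \<open>\<eta>\<close>; for vanishing oscillation it is chosen before \<open>l\<close>.\<close>

lemma ext_small:
  obtains C where "0 \<le> C"
    "\<And>f V W \<eta> p l L. locint f \<Longrightarrow> norm_bd f V \<Longrightarrow> 0 < \<eta> \<Longrightarrow> \<eta> \<le> r1 / 2 \<Longrightarrow> osc_bd f (2 * \<eta>) W \<Longrightarrow>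
      0 < l \<Longrightarrow> rn * l \<le> \<eta> \<Longrightarrow>
      set_integrable lebesgue (ccube p l) (ext_op L f) \<and>
      mean_osc (ext_op L f) (ccube p l) \<le> C * (W + V * (1 / \<eta> + 1) * (rn * l))"
proof -
  obtain C0 where C0: "0 \<le> C0"
    "\<And>f V W q x y. locint f \<Longrightarrow> norm_bd f V \<Longrightarrow> osc_bd f (min (2 * infdist q \<Omega>) (\<rho> / 2)) W \<Longrightarrow>
       0 < infdist q \<Omega> \<Longrightarrow> dist q x \<le> infdist q \<Omega> / 2 \<Longrightarrow> dist q y \<le> infdist q \<Omega> / 2 \<Longrightarrow>
       \<bar>ext_part f x - ext_part f y\<bar>
         \<le> C0 * (W / infdist q \<Omega> + (if infdist q \<Omega> \<le> r1 / 2 then 0 else V)) * dist x y"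
    using ext_part_lipschitz by blast
  define K where "K = near_const * real gridn ^ CARD('n) + 1 + C0"
  have K: "0 \<le> K" "near_const * real gridn ^ CARD('n) \<le> K" "1 \<le> K" "C0 \<le> K"
    using near_const_nonneg C0(1) by (auto simp: K_def)
  show thesis
  proof (rule that[of "2 * K"])
    show "0 \<le> 2 * K" using K by simp
    fix f V W \<eta> p l L
    assume f: "locint f" "norm_bd f V" and e: "0 < \<eta>" "\<eta> \<le> r1 / 2" and osc: "osc_bd f (2 * \<eta>) W"
      and l: "0 < l" "rn * l \<le> \<eta>"
    define F where "F = ext_op L f"
    have F: "F \<in> borel_measurable lebesgue" unfolding F_def by (rule ext_op_measurable[OF f])
    define X where "X = W + V * (1 / \<eta> + 1) * (rn * l)"
    have W: "0 \<le> W" using osc by (rule osc_bd_nonneg)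
    have V: "0 \<le> V" using f(2) by (rule norm_bd_nonneg)
    have rl: "0 < rn * l" "l \<le> rn * l" using l rn_ge_1 by auto
    have X: "W \<le> X" "V * (1 / \<eta> + 1) * (rn * l) \<le> X" "0 \<le> X" using W V e rl by (auto simp: X_def)
    have ls: "l \<le> s0"
    proof -
      have "rn * l \<le> rn * s0" using l e unfolding s0(2) by (simp add: r1_def)
      then show ?thesis using rn_ge_1 by simp
    qed
    have Wl: "K' * W * l ^ CARD('n) \<le> K * X * l ^ CARD('n)" if "0 \<le> K'" "K' \<le> K" for K'
      using that W X K l by (intro mult_right_mono mult_mono) auto
    have "\<exists>a. dev F a (ccube p l) \<le> ennreal (K * X * l ^ CARD('n))"
      using l(1)
    proof (rule cube_cases[of l p])
      assume n: "near p (rn * l)"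
      have "2 * (rn * l) \<le> 2 * \<eta>" using l by simp
      then have "osc_bd f (2 * (rn * l)) W" by (rule osc_bd_mono[OF osc])
      from near_dev[OF f this n l(1) ls, of L] show ?thesis
        unfolding F_def using Wl[of "near_const * real gridn ^ CARD('n)"] K near_const_nonneg
        by (meson ennreal_leI order_trans mult_nonneg_nonneg of_nat_0_le_iff zero_le_power)
    next
      assume s: "ccube p l \<subseteq> \<Omega>"
      have "dev f (avg f (ccube p l)) (ccube p l) \<le> ennreal (W * l ^ CARD('n))"
        by (intro dev_ccube[OF f(1) osc] s) (use l rl e in linarith)+
      also have "\<dots> \<le> ennreal (K * X * l ^ CARD('n))" using Wl[of 1] K by (intro ennreal_leI) simp
      finally have "dev F (avg f (ccube p l)) (ccube p l) \<le> ennreal (K * X * l ^ CARD('n))"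
        unfolding F_def dev_ext_op_inside[OF s] .
      then show ?thesis by blast
    next
      assume d: "rn * l \<le> infdist p \<Omega>"
      define dp where "dp = infdist p \<Omega>"
      have dp: "0 < dp" "rn * l \<le> dp" using d rl by (auto simp: dp_def)
      have "dev F (F p) (ccube p l) \<le> ennreal ((K * X) * l ^ CARD('n))"
      proof (rule dev_le_const)
        fix x assume x: "x \<in> ccube p l"
        have px: "dist p x \<le> rn * l / 2" using ccube_subset_cball_half[OF _ x] l by simp
        have "infdist p \<Omega> \<le> infdist x \<Omega> + dist p x" by (rule infdist_triangle)
        then have "0 < infdist x \<Omega>" using px dp by (simp add: dp_def)
        then have FF: "F x = ext_part f x" "F p = ext_part f p"
          using ext_op_outside dp by (auto simp: F_def dp_def)
        have xd: "dist p x \<le> infdist p \<Omega> / 2" "dist p p \<le> infdist p \<Omega> / 2" using px dp by (auto simp: dp_def)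
        show "\<bar>F x - F p\<bar> \<le> K * X"
        \<comment> \<open>In the first case \<open>dp \<le> r1 / 2\<close>, so the cutoff
          contributes nothing, and \<open>dist x p \<le> dp\<close> cancels the denominator.\<close>
        proof (cases "dp \<le> \<eta>")
          case True
          have o: "osc_bd f (min (2 * infdist p \<Omega>) (\<rho> / 2)) W"
            using True by (intro osc_bd_mono[OF osc]) (auto simp: dp_def)
          have "\<bar>F x - F p\<bar> \<le> C0 * (W / dp + 0) * dist x p"
            using C0(2)[OF f o _ xd] dp True e by (simp add: FF dp_def)
          also have "\<dots> \<le> C0 * (W / dp + 0) * dp"
            using C0(1) W dp px by (intro mult_left_mono) (auto simp: dist_commute)
          also have "\<dots> = C0 * W" using dp by simp
          also have "\<dots> \<le> K * X" using C0(1) K W X by (intro mult_mono) auto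
          finally show ?thesis .
        next
          case False
          have o: "osc_bd f (min (2 * infdist p \<Omega>) (\<rho> / 2)) V" using rho by (intro norm_bd_osc[OF f(2)]) auto
          have "\<bar>F x - F p\<bar> \<le> C0 * (V / dp + (if dp \<le> r1 / 2 then 0 else V)) * dist x p"
            using C0(2)[OF f o _ xd] dp by (simp add: FF dp_def)
          also have "\<dots> \<le> C0 * (V / \<eta> + V) * (rn * l)"
            using C0(1) V False e px dp rl by (intro mult_mono add_mono mult_left_mono divide_left_mono) (auto simp: dist_commute)
          also have "\<dots> = C0 * (V * (1 / \<eta> + 1) * (rn * l))" by (simp add: algebra_simps)
          also have "\<dots> \<le> K * X" using C0(1) K V e rl X by (intro mult_mono) auto
          finally show ?thesis .
        qed
      qed (use K X l in auto)
      then show ?thesis by blast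
    qed
    then obtain a where a: "dev F a (ccube p l) \<le> ennreal (K * X * l ^ CARD('n))" by blast
    have i: "set_integrable lebesgue (ccube p l) F" using set_integrable_of_dev[OF F ccube_lmeasurable a] .
    have "mean_osc F (ccube p l) \<le> 2 * (K * X * l ^ CARD('n)) / measure lebesgue (ccube p l)"
      using K X l by (intro mean_osc_le_of_dev[OF i ccube_lmeasurable _ a]) (auto simp: measure_ccube)
    also have "\<dots> = 2 * K * X" using l by (simp add: measure_ccube)
    finally show "set_integrable lebesgue (ccube p l) (ext_op L f) \<and>
      mean_osc (ext_op L f) (ccube p l) \<le> 2 * K * (W + V * (1 / \<eta> + 1) * (rn * l))"
      using i by (simp add: F_def X_def)
  qed
qed

text \<open>At a fixed scale the reference values themselves are bounded by the norm, so 0 can take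
  their place.\<close>

lemma ext_mid:
  assumes s1: "0 < s1" "s1 \<le> s0"
  obtains C where "0 \<le> C"
    "\<And>f V p l L. locint f \<Longrightarrow> norm_bd f V \<Longrightarrow> s1 / 2 \<le> l \<Longrightarrow> l \<le> s1 \<Longrightarrow>
      dev (ext_op L f) 0 (ccube p l) \<le> ennreal (C * V * l ^ CARD('n))"
proof -
  have rs: "0 < rn * s1 / 4" "0 < rn * s1 / 2" using s1 rn_ge_1 by auto
  obtain C1 where C1: "0 \<le> C1"
    "\<And>f V x r. locint f \<Longrightarrow> norm_bd f V \<Longrightarrow> adm x r \<Longrightarrow> rn * s1 / 4 \<le> r \<Longrightarrow> \<bar>kavg f x r\<bar> \<le> C1 * V"
    using kavg_bounded[OF rs(1)] by blast
  have "s1 / 2 < \<rho>" using s1 s0(3) rho by simp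
  then obtain C2 where C2: "0 \<le> C2"
    "\<And>f V p s. locint f \<Longrightarrow> norm_bd f V \<Longrightarrow> s1 / 2 \<le> s \<Longrightarrow> s < \<rho> \<Longrightarrow> ccube p s \<subseteq> \<Omega> \<Longrightarrow>
       \<bar>avg f (ccube p s)\<bar> \<le> C2 * V"
    using avg_bounded[of "s1 / 2"] s1 by (metis half_gt_zero)
  define N where "N = near_const * real gridn ^ CARD('n)"
  have N: "0 \<le> N" using near_const_nonneg by (simp add: N_def)
  define C where "C = N + 1 + C1 + C2"
  have C: "0 \<le> C" using N C1 C2 by (simp add: C_def)
  show thesis
  proof (rule that[OF C])
    fix f V p l L
    assume f: "locint f" "norm_bd f V" and l: "s1 / 2 \<le> l" "l \<le> s1"
    have V: "0 \<le> V" using f(2) by (rule norm_bd_nonneg)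
    have l0: "0 < l" "l \<le> s0" using l s1 by auto
    have rl: "rn * l \<le> \<rho> / 32" "rn * s1 / 2 \<le> rn * l" "0 < rn * l"
      using mult_left_mono[OF l0(2), of rn] mult_left_mono[OF l(1), of rn] rn_ge_1 l0 unfolding s0(2) by auto
    define F where "F = ext_op L f"
    have F: "F \<in> borel_measurable lebesgue" unfolding F_def by (rule ext_op_measurable[OF f])
    have sh: "dev F 0 (ccube p l) \<le> ennreal (C * V * l ^ CARD('n))"
      if "dev F a (ccube p l) \<le> ennreal (A * V * l ^ CARD('n))" "\<bar>a\<bar> \<le> B * V" "0 \<le> A" "0 \<le> B" "A + B \<le> C" for a A B
    proof -
      have "dev F 0 (ccube p l) \<le> dev F a (ccube p l) + ennreal \<bar>a - 0\<bar> * emeasure lebesgue (ccube p l)"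
        by (intro dev_shift dev_integrand_measurable F) auto
      also have "\<dots> \<le> ennreal (A * V * l ^ CARD('n)) + ennreal (B * V) * ennreal (l ^ CARD('n))"
        unfolding emeasure_ccube[OF less_imp_le[OF l0(1)]]
        using that by (intro add_mono mult_mono ennreal_leI) auto
      also have "\<dots> = ennreal ((A + B) * (V * l ^ CARD('n)))"
        using that V l0 by (simp add: ennreal_mult[symmetric] ennreal_plus[symmetric] algebra_simps del: ennreal_plus)
      also have "\<dots> \<le> ennreal (C * (V * l ^ CARD('n)))"
        using that V l0 by (intro ennreal_leI mult_right_mono) auto
      finally show ?thesis by (simp add: mult.assoc)
    qed
    have "dev F 0 (ccube p l) \<le> ennreal (C * V * l ^ CARD('n))"
      using l0(1)
    proof (rule cube_cases[of l p])
      assume n: "near p (rn * l)"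
      have osc: "osc_bd f (2 * (rn * l)) V" using rl rho by (intro norm_bd_osc[OF f(2)]) auto
      have "adm p (rn * l)" using rl rho by (intro near_adm[OF n]) auto
      then have "\<bar>kavg f p (rn * l)\<bar> \<le> C1 * V" using rl rs by (intro C1(2)[OF f]) auto
      moreover have "dev F (kavg f p (rn * l)) (ccube p l) \<le> ennreal (N * V * l ^ CARD('n))"
        unfolding F_def N_def by (rule near_dev[OF f osc n l0])
      ultimately show ?thesis using N C1(1) C2(1) by (intro sh[of "kavg f p (rn * l)" N C1]) (auto simp: C_def)
    next
      assume s: "ccube p l \<subseteq> \<Omega>"
      have lr: "l < \<rho>" using l0 s0(3) rho by simp
      have "dev F (avg f (ccube p l)) (ccube p l) \<le> ennreal (1 * V * l ^ CARD('n))"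
        unfolding F_def dev_ext_op_inside[OF s] using dev_ccube[OF f(1) norm_bd_osc[OF f(2) lr] l0(1) order_refl s] by simp
      moreover have "\<bar>avg f (ccube p l)\<bar> \<le> C2 * V" using l lr by (intro C2(2)[OF f] s) auto
      ultimately show ?thesis using N C1(1) C2(1) by (intro sh[of "avg f (ccube p l)" 1 C2]) (auto simp: C_def)
    next
      assume d: "rn * l \<le> infdist p \<Omega>"
      have "dev F 0 (ccube p l) \<le> ennreal ((C1 * V) * l ^ CARD('n))"
      proof (rule dev_le_const)
        fix x assume x: "x \<in> ccube p l"
        define dx where "dx = infdist x \<Omega>"
        have px: "dist p x \<le> rn * l / 2" using ccube_subset_cball_half[OF _ x] l0 by simp
        have "infdist p \<Omega> \<le> infdist x \<Omega> + dist p x" by (rule infdist_triangle)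
        then have dx: "rn * s1 / 4 \<le> dx" "0 < dx" using px d rl rs by (auto simp: dx_def)
        have Fx: "F x = cut dx * kavg f x dx" using ext_op_outside[of x] dx by (simp add: F_def ext_part_def dx_def)
        show "\<bar>F x - 0\<bar> \<le> C1 * V"
        proof (cases "dx \<le> \<rho> / 2")
          case True
          then have "\<bar>kavg f x dx\<bar> \<le> C1 * V" using dx ext_adm[of x] by (intro C1(2)[OF f]) (auto simp: dx_def)
          moreover have "cut dx * \<bar>kavg f x dx\<bar> \<le> 1 * \<bar>kavg f x dx\<bar>" using cut_bounds by (intro mult_right_mono) auto
          ultimately show ?thesis using cut_bounds[of dx] by (simp add: Fx abs_mult)
        next
          case False
          then have "cut dx = 0" using rho by (intro cut_0) (simp add: r1_def)
          then show ?thesis using C1(1) V by (simp add: Fx)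
        qed
      qed (use C1 V l0 in auto)
      then show ?thesis using N C1(1) C2(1) by (intro sh[of 0 C1 0]) (auto simp: C_def)
    qed
    then show "dev (ext_op L f) 0 (ccube p l) \<le> ennreal (C * V * l ^ CARD('n))" by (simp add: F_def)
  qed
qed

text \<open>A large cube is cut into cells of one fixed scale. Deviations from 0 add up over the
  cells without any comparison between them.\<close>

lemma ext_large:
  assumes s1: "0 < s1" "s1 \<le> s0"
  obtains C where "0 \<le> C"
    "\<And>f V p l L. locint f \<Longrightarrow> norm_bd f V \<Longrightarrow> s1 \<le> l \<Longrightarrow>
      dev (ext_op L f) 0 (ccube p l) \<le> ennreal (C * V * l ^ CARD('n))"
proof -
  obtain C where C: "0 \<le> C"
    "\<And>f V p l L. locint f \<Longrightarrow> norm_bd f V \<Longrightarrow> s1 / 2 \<le> l \<Longrightarrow> l \<le> s1 \<Longrightarrow>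
      dev (ext_op L f) 0 (ccube p l) \<le> ennreal (C * V * l ^ CARD('n))"
    using ext_mid[OF s1] by blast
  show thesis
  proof (rule that[OF C(1)])
    fix f V L and p :: "real ^ 'n" and l
    assume f: "locint f" "norm_bd f V" and l: "s1 \<le> l"
    have V: "0 \<le> V" using f(2) by (rule norm_bd_nonneg)
    define F where "F = ext_op L f"
    have F: "F \<in> borel_measurable lebesgue" unfolding F_def by (rule ext_op_measurable[OF f])
    have l0: "0 < l" using l s1 by simp
    \<comment> \<open>As \<open>l / s1 \<ge> 1\<close>, rounding up at most doubles it, so the cells
      have side between \<open>s1 / 2\<close> and \<open>s1\<close>.\<close>
    define M where "M = nat \<lceil>l / s1\<rceil>"
    have q: "1 \<le> l / s1" using l s1 by simp
    have M: "0 < M" "l / s1 \<le> M" "real M \<le> 2 * (l / s1)" using q unfolding M_def by linarith+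
    define h where "h = l / M"
    have h: "0 < h" "s1 / 2 \<le> h" "h \<le> s1"
      using M l0 s1 by (auto simp: h_def field_simps)
    obtain D where D: "finite D" "card D \<le> M ^ CARD('n)" "ccube p l \<subseteq> (\<Union>c\<in>D. ccube c h)"
    proof (rule ccube_grid[OF M(1) l0, of p, folded h_def])
      fix D assume "finite D" "card D \<le> M ^ CARD('n)" "ccube p l \<subseteq> (\<Union>c\<in>D. ccube c h)"
      then show thesis by (rule that)
    qed
    have "dev F 0 (ccube p l) \<le> (\<Sum>c\<in>D. dev F 0 (ccube c h))"
      using D F by (intro nn_integral_finite_cover dev_integrand_measurable) auto
    also have "\<dots> \<le> (\<Sum>c\<in>D. ennreal (C * V * h ^ CARD('n)))"
      unfolding F_def by (intro sum_mono C(2)[OF f] h)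
    also have "\<dots> = ennreal (real (card D) * (C * V * h ^ CARD('n)))"
      using C V h by (simp add: ennreal_mult ennreal_of_nat_eq_real_of_nat)
    also have "\<dots> \<le> ennreal (real (M ^ CARD('n)) * (C * V * h ^ CARD('n)))"
      using D(2) C V h by (intro ennreal_leI mult_right_mono) (auto simp del: of_nat_power)
    also have "real (M ^ CARD('n)) * (C * V * h ^ CARD('n)) = C * V * l ^ CARD('n)"
      using M(1) by (simp add: h_def power_divide)
    finally show "dev (ext_op L f) 0 (ccube p l) \<le> ennreal (C * V * l ^ CARD('n))" by (simp add: F_def)
  qed
qed

section \<open>Boundedness in the mean oscillation norm\<close>

lemma norm_bd_of_bmo_norm:
  assumes "bmo_norm \<rho> \<Omega> f \<le> ennreal V" "0 \<le> V" shows "norm_bd f V"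
  unfolding norm_bd_def
proof (intro conjI allI impI assms(2))
  fix p :: "real ^ 'n" and s
  assume s: "0 < s" "s < \<rho>" "ccube p s \<subseteq> \<Omega>"
  have "(p - (\<chi> i. s / 2), s) \<in> {(a, l). (a, l) \<in> cubes_in \<Omega> \<and> l < \<rho>}"
    using s by (simp add: cubes_in_def ccube_def)
  then have "ennreal (mean_osc f (ccube p s)) \<le> osc_modulus \<Omega> f \<rho>"
    unfolding osc_modulus_def ccube_def by (rule SUP_upper2) simp
  also have "\<dots> \<le> bmo_norm \<rho> \<Omega> f" unfolding bmo_norm_def by simp
  also have "\<dots> \<le> ennreal V" by (rule assms)
  finally show "mean_osc f (ccube p s) \<le> V" using assms(2) by (simp add: ennreal_le_iff)
next
  fix p :: "real ^ 'n" and s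
  assume s: "\<rho> \<le> s" "ccube p s \<subseteq> \<Omega>"
  have "(p - (\<chi> i. s / 2), s) \<in> {(a, l). (a, l) \<in> cubes_in \<Omega> \<and> \<rho> \<le> l}"
    using s rho by (simp add: cubes_in_def ccube_def)
  then have "ennreal (avg (\<lambda>x. \<bar>f x\<bar>) (ccube p s)) \<le> (SUP (a, l) \<in> {(a, l). (a, l) \<in> cubes_in \<Omega> \<and> \<rho> \<le> l}.
        ennreal (avg (\<lambda>x. \<bar>f x\<bar>) (cube a l)))"
    unfolding ccube_def by (rule SUP_upper2) simp
  also have "\<dots> \<le> bmo_norm \<rho> \<Omega> f" unfolding bmo_norm_def by simp
  also have "\<dots> \<le> ennreal V" by (rule assms)
  finally show "avg (\<lambda>x. \<bar>f x\<bar>) (ccube p s) \<le> V" using assms(2) by (simp add: ennreal_le_iff)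
qed

lemma bmoD:
  assumes "f \<in> bmo \<rho> \<Omega>"
  shows "locint f" "norm_bd f (enn2real (bmo_norm \<rho> \<Omega> f))"
    "bmo_norm \<rho> \<Omega> f = ennreal (enn2real (bmo_norm \<rho> \<Omega> f))"
proof -
  show "locint f" using assms by (simp add: bmo_def locint_def)
  show e: "bmo_norm \<rho> \<Omega> f = ennreal (enn2real (bmo_norm \<rho> \<Omega> f))" using assms by (simp add: bmo_def)
  show "norm_bd f (enn2real (bmo_norm \<rho> \<Omega> f))" using e by (intro norm_bd_of_bmo_norm) auto
qed

lemma ext_bmo:
  obtains C where "0 \<le> C" "\<And>f V L. locint f \<Longrightarrow> norm_bd f V \<Longrightarrow>
    (\<forall>(a, l) \<in> cubes_in UNIV. set_integrable lebesgue (cube a l) (ext_op L f)) \<and>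
    bmo_norm 1 UNIV (ext_op L f) \<le> ennreal (C * V)"
proof -
  \<comment> \<open>Cubes of side at least 1, the scale of the target norm, must count as
    large.\<close>
  define s1 where "s1 = min 1 s0"
  have s1: "0 < s1" "s1 \<le> s0" "s1 \<le> 1" using s0 by (auto simp: s1_def)
  obtain C1 where C1: "0 \<le> C1"
    "\<And>f V p l L. locint f \<Longrightarrow> norm_bd f V \<Longrightarrow> s1 \<le> l \<Longrightarrow>
      dev (ext_op L f) 0 (ccube p l) \<le> ennreal (C1 * V * l ^ CARD('n))"
    using ext_large[OF s1(1,2)] by blast
  obtain C2 where C2: "0 \<le> C2"
    "\<And>f V W \<eta> p l L. locint f \<Longrightarrow> norm_bd f V \<Longrightarrow> 0 < \<eta> \<Longrightarrow> \<eta> \<le> r1 / 2 \<Longrightarrow> osc_bd f (2 * \<eta>) W \<Longrightarrow>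
      0 < l \<Longrightarrow> rn * l \<le> \<eta> \<Longrightarrow>
      set_integrable lebesgue (ccube p l) (ext_op L f) \<and>
      mean_osc (ext_op L f) (ccube p l) \<le> C2 * (W + V * (1 / \<eta> + 1) * (rn * l))"
    using ext_small by blast
  \<comment> \<open>Since \<open>r1 / 2 = rn * s0\<close>, the condition
    \<open>rn * l \<le> \<eta>\<close> becomes \<open>l \<le> s0\<close>; as
    \<open>s1 \<le> s0\<close>, small and large cubes together are all cubes.\<close>
  define \<eta> where "\<eta> = r1 / 2"
  have e: "0 < \<eta>" "\<eta> \<le> r1 / 2" "\<eta> = rn * s0" using r1_pos by (auto simp: \<eta>_def r1_def s0(2))
  define C3 where "C3 = C2 * (1 + (1 / \<eta> + 1) * \<eta>) + 2 * C1"
  have C3: "0 \<le> C3" using C1 C2 e by (simp add: C3_def)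
  show thesis
  proof (rule that[of "C3 + C1"])
    show "0 \<le> C3 + C1" using C3 C1 by simp
    fix f V L assume f: "locint f" "norm_bd f V"
    have V: "0 \<le> V" using f(2) by (rule norm_bd_nonneg)
    define F where "F = ext_op L f"
    have F: "F \<in> borel_measurable lebesgue" unfolding F_def by (rule ext_op_measurable[OF f])
    have large: "set_integrable lebesgue (ccube p l) F"
      "mean_osc F (ccube p l) \<le> C3 * V" "avg (\<lambda>x. \<bar>F x\<bar>) (ccube p l) \<le> C1 * V" if l: "s1 \<le> l" for p l
    proof -
      have l0: "0 < l" using l s1 by simp
      have d: "dev F 0 (ccube p l) \<le> ennreal (C1 * V * l ^ CARD('n))" unfolding F_def by (rule C1(2)[OF f l])
      show i: "set_integrable lebesgue (ccube p l) F" using set_integrable_of_dev[OF F ccube_lmeasurable d] .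
      have "mean_osc F (ccube p l) \<le> 2 * (C1 * V * l ^ CARD('n)) / measure lebesgue (ccube p l)"
        using C1 V l0 by (intro mean_osc_le_of_dev[OF i ccube_lmeasurable _ d]) (auto simp: measure_ccube)
      also have "\<dots> = 2 * C1 * V" using l0 by (simp add: measure_ccube)
      also have "\<dots> \<le> C3 * V" using V C2 e by (intro mult_right_mono) (auto simp: C3_def)
      finally show "mean_osc F (ccube p l) \<le> C3 * V" .
      have "ennreal (LINT x:ccube p l|lebesgue. \<bar>F x - 0\<bar>) \<le> ennreal (C1 * V * l ^ CARD('n))"
        using d unfolding dev_eq_LINT[OF i ccube_lmeasurable] .
      then have "(LINT x:ccube p l|lebesgue. \<bar>F x\<bar>) \<le> C1 * V * l ^ CARD('n)"
        using C1 V l0 by (simp add: ennreal_le_iff)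
      then show "avg (\<lambda>x. \<bar>F x\<bar>) (ccube p l) \<le> C1 * V"
        using l0 by (simp add: avg_def measure_ccube field_simps)
    qed
    have small: "set_integrable lebesgue (ccube p l) F" "mean_osc F (ccube p l) \<le> C3 * V" if l: "0 < l" "l \<le> s0" for p l
    proof -
      have rl: "rn * l \<le> \<eta>" "0 \<le> rn * l" using mult_left_mono[OF l(2), of rn] rn_ge_1 l by (auto simp: e(3))
      have osc: "osc_bd f (2 * \<eta>) V" using e rho by (intro norm_bd_osc[OF f(2)]) (simp add: r1_def)
      have *: "set_integrable lebesgue (ccube p l) F \<and> mean_osc F (ccube p l) \<le> C2 * (V + V * (1 / \<eta> + 1) * (rn * l))"
        unfolding F_def by (rule C2(2)[OF f e(1,2) osc l(1) rl(1)])
      then show "set_integrable lebesgue (ccube p l) F" by simp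
      have "C2 * (V + V * (1 / \<eta> + 1) * (rn * l)) \<le> C2 * (V + V * (1 / \<eta> + 1) * \<eta>)"
        using C2 V e rl by (intro mult_left_mono add_left_mono) auto
      also have "\<dots> = C2 * (1 + (1 / \<eta> + 1) * \<eta>) * V" by (simp add: algebra_simps)
      also have "\<dots> \<le> C3 * V" using V C1 by (intro mult_right_mono) (auto simp: C3_def)
      finally show "mean_osc F (ccube p l) \<le> C3 * V" using * by simp
    qed
    have int: "set_integrable lebesgue (ccube p l) F" and osc: "mean_osc F (ccube p l) \<le> C3 * V" if "0 < l" for p l
      using small[of l p] large[of l p] that s1 by (cases "l \<le> s0"; fastforce)+
    have "bmo_norm 1 UNIV F \<le> ennreal (C3 * V) + ennreal (C1 * V)"
      unfolding bmo_norm_def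
    proof (rule add_mono)
      show "osc_modulus UNIV F 1 \<le> ennreal (C3 * V)"
        unfolding osc_modulus_def
        by (rule SUP_least) (auto simp: cubes_in_def cube_eq_ccube intro!: ennreal_leI osc)
      show "(SUP (a, l)\<in>{(a, l). (a, l) \<in> cubes_in UNIV \<and> 1 \<le> l}. ennreal (avg (\<lambda>x. \<bar>F x\<bar>) (cube a l))) \<le> ennreal (C1 * V)"
        using s1 by (intro SUP_least) (auto simp: cubes_in_def cube_eq_ccube intro!: ennreal_leI large(3))
    qed
    also have "\<dots> = ennreal ((C3 + C1) * V)" using C3 C1 V by (simp add: ennreal_plus distrib_right)
    finally show "(\<forall>(a, l) \<in> cubes_in UNIV. set_integrable lebesgue (cube a l) (ext_op L f)) \<and>
      bmo_norm 1 UNIV (ext_op L f) \<le> ennreal ((C3 + C1) * V)"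
      using int by (auto simp: F_def cubes_in_def cube_eq_ccube)
  qed
qed

section \<open>Vanishing mean oscillation\<close>

text \<open>The tolerance determines \<open>W\<close>, then the oscillation of \<open>f\<close>
  determines \<open>\<eta>\<close>, and only then the side is made small enough for the term with
  \<open>V\<close>.\<close>

lemma ext_vmo:
  assumes f: "locint f" "norm_bd f V" and v: "(osc_modulus \<Omega> f \<longlongrightarrow> 0) (at_right 0)"
  shows "(osc_modulus UNIV (ext_op L f) \<longlongrightarrow> 0) (at_right 0)"
proof -
  obtain C where C: "0 \<le> C"
    "\<And>f V W \<eta> p l L. locint f \<Longrightarrow> norm_bd f V \<Longrightarrow> 0 < \<eta> \<Longrightarrow> \<eta> \<le> r1 / 2 \<Longrightarrow> osc_bd f (2 * \<eta>) W \<Longrightarrow>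
      0 < l \<Longrightarrow> rn * l \<le> \<eta> \<Longrightarrow>
      set_integrable lebesgue (ccube p l) (ext_op L f) \<and>
      mean_osc (ext_op L f) (ccube p l) \<le> C * (W + V * (1 / \<eta> + 1) * (rn * l))"
    using ext_small by blast
  have V: "0 \<le> V" using f(2) by (rule norm_bd_nonneg)
  define F where "F = ext_op L f"
  have main: "\<exists>b>0. \<forall>t. t < b \<longrightarrow> osc_modulus UNIV F t \<le> ennreal e" if e: "0 < e" for e :: real
  proof -
    define W where "W = e / (2 * (C + 1))"
    have W: "0 < W" "C * W \<le> e / 2" using e C(1) by (auto simp: W_def field_simps)
    have "eventually (\<lambda>t. osc_modulus \<Omega> f t < ennreal W) (at_right 0)"
      using v W(1) by (intro order_tendstoD(2)[of _ 0]) simp_all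
    then obtain b where b: "0 < b" "\<And>t. 0 < t \<Longrightarrow> t < b \<Longrightarrow> osc_modulus \<Omega> f t < ennreal W"
      by (auto simp: eventually_at_right_field)
    define \<eta> where "\<eta> = min (b / 4) (r1 / 2)"
    have eta: "0 < \<eta>" "\<eta> \<le> r1 / 2" "\<eta> \<le> b / 4" using b(1) r1_pos by (auto simp: \<eta>_def)
    have osc: "osc_bd f (2 * \<eta>) W"
      unfolding osc_bd_def
    proof (intro conjI allI impI)
      fix p s assume s: "0 < s" "s \<le> 2 * \<eta>" "ccube p s \<subseteq> \<Omega>"
      \<comment> \<open>\<open>3 * b / 4\<close> lies strictly between the largest side
        \<open>2 * \<eta> \<le> b / 2\<close> and \<open>b\<close>, as the strict inequality in
        \<open>osc_modulus\<close> demands.\<close>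
      have "(p - (\<chi> i. s / 2), s) \<in> {(a, l). (a, l) \<in> cubes_in \<Omega> \<and> l < 3 * b / 4}"
        using s eta b(1) by (simp add: cubes_in_def ccube_def)
      then have "ennreal (mean_osc f (ccube p s)) \<le> osc_modulus \<Omega> f (3 * b / 4)"
        unfolding osc_modulus_def ccube_def by (rule SUP_upper2) simp
      also have "\<dots> \<le> ennreal W" using b by (intro less_imp_le) auto
      finally show "mean_osc f (ccube p s) \<le> W" using W by (simp add: ennreal_le_iff)
    qed (use W in simp)
    define B where "B = C * (V * (1 / \<eta> + 1)) * rn"
    have B: "0 \<le> B" using C(1) V eta rn_ge_1 by (simp add: B_def)
    \<comment> \<open>The first bound keeps cubes below the scale \<open>\<eta>\<close>; the second
      makes \<open>B * l\<close> at most \<open>e / 2\<close>, where \<open>B + 1\<close> avoids a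
      zero denominator.\<close>
    define t1 where "t1 = min (\<eta> / rn) (e / (2 * (B + 1)))"
    have t1: "0 < t1" using eta e B rn_ge_1 by (simp add: t1_def)
    have "osc_modulus UNIV F t \<le> ennreal e" if t: "t < t1" for t
      unfolding osc_modulus_def
    proof (rule SUP_least, clarsimp simp: cubes_in_def)
      fix a :: "real ^ 'n" and l assume l: "l < t" "0 < l"
      have "l \<le> \<eta> / rn" using l t by (simp add: t1_def)
      then have "rn * l \<le> rn * (\<eta> / rn)" using rn_ge_1 by (intro mult_left_mono) auto
      then have rl: "rn * l \<le> \<eta>" using rn_ge_1 by simp
      have "mean_osc F (cube a l) \<le> C * (W + V * (1 / \<eta> + 1) * (rn * l))"
        unfolding F_def cube_eq_ccube using C(2)[OF f eta(1,2) osc l(2) rl] by blast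
      also have "\<dots> = C * W + B * l" by (simp add: B_def algebra_simps)
      also have "B * l \<le> (B + 1) * (e / (2 * (B + 1)))" using B l t by (intro mult_mono) (auto simp: t1_def)
      also have "\<dots> = e / 2" using B by (simp add: field_simps)
      finally show "ennreal (mean_osc F (cube a l)) \<le> ennreal e" using W by (intro ennreal_leI) simp
    qed
    then show ?thesis using t1 by blast
  qed
  show ?thesis
    unfolding F_def[symmetric]
  proof (rule order_tendstoI)
    fix a :: ennreal assume "0 < a"
    then obtain e where e: "0 < e" "ennreal e < a"
      using dense[of 0 a] by (metis ennreal_cases ennreal_less_zero_iff less_top_ennreal not_less top_greatest order.strict_trans2)
    obtain b where "0 < b" "\<forall>t. t < b \<longrightarrow> osc_modulus UNIV F t \<le> ennreal e" using main[OF e(1)] by blast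
    then show "eventually (\<lambda>t. osc_modulus UNIV F t < a) (at_right 0)"
      unfolding eventually_at_right_field using e(2) by (intro exI[of _ b]) (auto intro: le_less_trans)
  qed (simp add: not_less_zero)
qed

section \<open>Linearity\<close>

abbreviation bdry_rad :: "nat \<Rightarrow> real" where "bdry_rad k \<equiv> \<rho> / 2 / (real k + 1)"

lemma bdry_rad: "0 < bdry_rad k" "bdry_rad k \<le> \<rho> / 2"
proof -
  show "0 < bdry_rad k" using rho by simp
  have "\<rho> / 2 / (real k + 1) \<le> \<rho> / 2 / 1" using rho by (intro divide_left_mono) auto
  then show "bdry_rad k \<le> \<rho> / 2" by simp
qed

lemma bdry_rad_tendsto: "bdry_rad \<longlonglongrightarrow> 0"
  using LIMSEQ_Suc[OF lim_const_over_n[of "\<rho> / 2"]] by (simp add: add.commute)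

lemma bdry_adm:
  assumes "x \<in> closure \<Omega>" "x \<notin> \<Omega>" shows "adm x (bdry_rad k)"
proof -
  have "infdist x \<Omega> = 0" using assms(1) dom_nonempty by (simp add: in_closure_iff_infdist_zero)
  then show ?thesis using assms(2) bdry_rad[of k] by (auto simp: adm_def)
qed

lemma kern_mult_integrable:
  assumes "locint f" "norm_bd f V" "adm x r"
  shows "integrable lebesgue (\<lambda>y. kern x r y * f y)"
proof -
  have r: "0 < r" "r \<le> \<rho> / 2" using assms(3) by (auto simp: adm_def)
  obtain p where p: "p \<in> deep x 14 (kc 1) r" using corkscrew_deep[OF assms(3), of 1] by auto
  have osc: "osc_bd f r V" using r rho by (intro norm_bd_osc[OF assms(2)]) simp
  have "integrable lebesgue (\<lambda>y. kern x r y * (f y - ref_avg f p 14 (kc 1) r))"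
    using r by (intro kern_weighted(1)[OF assms(1) osc r _ p assms(3)]) auto
  then show ?thesis by (rule kavg_minus(2)[OF assms(3)])
qed

lemma kavg_add:
  assumes "locint f" "norm_bd f V" "locint g" "norm_bd g V'" "adm x r"
  shows "kavg (\<lambda>x. f x + g x) x r = kavg f x r + kavg g x r"
  using kern_mult_integrable[OF assms(1,2,5)] kern_mult_integrable[OF assms(3,4,5)]
  by (simp add: kavg_def distrib_left add_divide_distrib)

lemma kavg_cmult: "kavg (\<lambda>x. c * f x) x r = c * kavg f x r"
  by (simp add: kavg_def mult.left_commute[of _ c])

lemma kavg_cong:
  assumes "0 < r" "\<And>y. y \<in> \<Omega> \<Longrightarrow> f y = g y" shows "kavg f x r = kavg g x r"
proof -
  have "(\<lambda>y. kern x r y * f y) = (\<lambda>y. kern x r y * g y)"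
    using kern_zero_outside[OF assms(1)] assms(2) by (metis mult_zero_left)
  then show ?thesis by (simp add: kavg_def)
qed

lemma ext_part_add:
  assumes "locint f" "norm_bd f V" "locint g" "norm_bd g V'" "0 < infdist x \<Omega>"
  shows "ext_part (\<lambda>x. f x + g x) x = ext_part f x + ext_part g x"
proof (cases "infdist x \<Omega> \<le> \<rho> / 2")
  case True
  then show ?thesis
    using kavg_add[OF assms(1-4) ext_adm[OF assms(5)]] by (simp add: ext_part_def distrib_left)
next
  case False
  then have "cut (infdist x \<Omega>) = 0" using rho by (intro cut_0) (simp add: r1_def)
  then show ?thesis by (simp add: ext_part_def)
qed

lemma infdist_pos_of: "x \<notin> closure \<Omega> \<Longrightarrow> 0 < infdist x \<Omega>"
  by (simp add: infdist_pos_iff)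

text \<open>Additivity of \<open>L\<close> on all sequences, convergent or not, is what settles the
  boundary points.\<close>

lemma ext_op_add:
  assumes "locint f" "norm_bd f V" "locint g" "norm_bd g V'"
    and L: "\<And>u v. L (\<lambda>k. u k + v k) = L u + L v"
  shows "ext_op L (\<lambda>x. f x + g x) = (\<lambda>x. ext_op L f x + ext_op L g x)"
proof
  fix x
  show "ext_op L (\<lambda>x. f x + g x) x = ext_op L f x + ext_op L g x"
  proof (cases "x \<in> closure \<Omega> \<and> x \<notin> \<Omega>")
    case True
    then have "kavg (\<lambda>x. f x + g x) x (bdry_rad k) = kavg f x (bdry_rad k) + kavg g x (bdry_rad k)" for k
      by (intro kavg_add[OF assms(1-4)] bdry_adm) auto
    then show ?thesis using True by (simp add: ext_op_def L)
  next
    case False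
    then show ?thesis using ext_part_add[OF assms(1-4)] infdist_pos_of[of x]
      by (auto simp: ext_op_def)
  qed
qed

lemma ext_op_cmult:
  assumes L: "\<And>c u. L (\<lambda>k. c * u k) = c * L u"
  shows "ext_op L (\<lambda>x. c * f x) = (\<lambda>x. c * ext_op L f x)"
  by (rule ext) (simp add: ext_op_def L kavg_cmult ext_part_def)

lemma ext_op_cong:
  assumes "\<And>y. y \<in> \<Omega> \<Longrightarrow> f y = g y" shows "ext_op L f = ext_op L g"
proof
  fix x
  show "ext_op L f x = ext_op L g x"
    using kavg_cong[OF bdry_rad(1) assms] kavg_cong[OF infdist_pos_of assms] assms
    by (auto simp: ext_op_def ext_part_def)
qed

section \<open>Bounded functions\<close>

lemma norm_bd_of_bounded:
  assumes f: "locint f" and B: "\<And>x. x \<in> \<Omega> \<Longrightarrow> \<bar>f x\<bar> \<le> B" "0 \<le> B"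
  shows "norm_bd f (2 * B)"
proof -
  have d: "dev f 0 (ccube p s) \<le> ennreal (B * s ^ CARD('n))" if "0 < s" "ccube p s \<subseteq> \<Omega>" for p s
    using that B by (intro dev_le_const[of _ _ _ _ p]) auto
  show ?thesis
    unfolding norm_bd_def
  proof (intro conjI allI impI)
    fix p s assume s: "0 < s" "s < \<rho>" "ccube p s \<subseteq> \<Omega>"
    have "mean_osc f (ccube p s) \<le> 2 * (B * s ^ CARD('n)) / measure lebesgue (ccube p s)"
      using s B by (intro mean_osc_le_of_dev[OF locintD[OF f s(1,3)] ccube_lmeasurable _ d[OF s(1,3)]])
        (auto simp: measure_ccube)
    then show "mean_osc f (ccube p s) \<le> 2 * B" using s by (simp add: measure_ccube)
  next
    fix p s assume s: "\<rho> \<le> s" "ccube p s \<subseteq> \<Omega>"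
    have s0: "0 < s" using s rho by simp
    have "ennreal (LINT x:ccube p s|lebesgue. \<bar>f x - 0\<bar>) \<le> ennreal (B * s ^ CARD('n))"
      using d[OF s0 s(2)] unfolding dev_eq_LINT[OF locintD[OF f s0 s(2)] ccube_lmeasurable] .
    then have "(LINT x:ccube p s|lebesgue. \<bar>f x\<bar>) \<le> B * s ^ CARD('n)" using B s0 by (simp add: ennreal_le_iff)
    then have "avg (\<lambda>x. \<bar>f x\<bar>) (ccube p s) \<le> B" using s0 by (simp add: avg_def measure_ccube field_simps)
    then show "avg (\<lambda>x. \<bar>f x\<bar>) (ccube p s) \<le> 2 * B" using B by simp
  qed (use B in simp)
qed

lemma locint_continuous:
  assumes "continuous_on \<Omega> f" shows "locint f"
proof -
  have "set_integrable lebesgue (cube a l) f" if "cube a l \<subseteq> \<Omega>" for a l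
    unfolding cube_def using continuous_on_subset[OF assms that]
    by (intro absolutely_integrable_continuous) (simp add: cube_def)
  then show ?thesis by (auto simp: locint_def cubes_in_def)
qed

lemma ext_part_bounded:
  assumes f: "locint f" and B: "\<And>x. x \<in> \<Omega> \<Longrightarrow> \<bar>f x\<bar> \<le> B" "0 \<le> B" and x: "0 < infdist x \<Omega>"
  shows "\<bar>ext_part f x\<bar> \<le> B"
proof (cases "infdist x \<Omega> \<le> \<rho> / 2")
  case True
  have "\<bar>kavg f x (infdist x \<Omega>) - 0\<bar> \<le> B" using B by (intro kavg_mean[OF f ext_adm[OF x True]]) simp
  moreover have "cut (infdist x \<Omega>) * \<bar>kavg f x (infdist x \<Omega>)\<bar> \<le> 1 * \<bar>kavg f x (infdist x \<Omega>)\<bar>"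
    using cut_bounds by (intro mult_right_mono) auto
  ultimately show ?thesis using cut_bounds[of "infdist x \<Omega>"] by (simp add: ext_part_def abs_mult)
next
  case False
  then have "cut (infdist x \<Omega>) = 0" using rho by (intro cut_0) (simp add: r1_def)
  then show ?thesis using B by (simp add: ext_part_def)
qed

section \<open>Continuous functions with compact support\<close>

lemma cc_bounded:
  assumes "g \<in> cont_compact_support \<Omega>"
  obtains B where "0 \<le> B" "\<And>x. x \<in> \<Omega> \<Longrightarrow> \<bar>g x\<bar> \<le> B"
proof -
  obtain K where K: "continuous_on \<Omega> g" "compact K" "K \<subseteq> \<Omega>" "\<forall>x\<in>\<Omega> - K. g x = 0"
    using assms by (auto simp: cont_compact_support_def)
  have "bounded (g ` K)"
    using K by (intro compact_imp_bounded compact_continuous_image continuous_on_subset[OF K(1)])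
  then obtain B where B: "0 < B" "\<And>x. x \<in> K \<Longrightarrow> \<bar>g x\<bar> \<le> B"
    by (auto simp: bounded_pos)
  show thesis
  proof (rule that[of B])
    fix x assume "x \<in> \<Omega>"
    then show "\<bar>g x\<bar> \<le> B" using B K(4) by (cases "x \<in> K") auto
  qed (use B in simp)
qed

text \<open>The kernel at an exterior point close to \<open>\<Omega>\<close> does not reach the support of \<open>g\<close>, so the
  extension vanishes near the boundary.\<close>

lemma ext_cc:
  assumes g: "g \<in> cont_compact_support \<Omega>"
    and L: "\<And>u l. u \<longlonglongrightarrow> l \<Longrightarrow> L u = l"
  shows "ext_op L g \<in> cont_compact_support UNIV"
proof -
  obtain K where K: "continuous_on \<Omega> g" "compact K" "K \<subseteq> \<Omega>" "\<forall>x\<in>\<Omega> - K. g x = 0"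
    using g by (auto simp: cont_compact_support_def)
  have li: "locint g" using K(1) by (rule locint_continuous)
  obtain B where B: "0 \<le> B" "\<And>x. x \<in> \<Omega> \<Longrightarrow> \<bar>g x\<bar> \<le> B" using cc_bounded[OF g] by blast
  have nb: "norm_bd g (2 * B)" using B by (intro norm_bd_of_bounded li) auto
  define F where "F = ext_op L g"
  have "closed (- \<Omega>)" using open_dom by (rule closed_Compl)
  moreover have "K \<inter> - \<Omega> = {}" using K(3) by blast
  ultimately have "\<exists>d>0. \<forall>x\<in>K. \<forall>y\<in>- \<Omega>. d \<le> dist x y" by (rule separate_compact_closed[OF K(2)])
  then obtain d where d: "0 < d" "\<And>x y. x \<in> K \<Longrightarrow> y \<in> - \<Omega> \<Longrightarrow> d \<le> dist x y" by blast
  have kz: "kavg g x r = 0" if "0 < r" "\<And>y. y \<in> K \<Longrightarrow> 4 * r \<le> dist x y" for x r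
  proof -
    have "kern x r y * g y = 0" for y
    proof (cases "kern x r y = 0")
      case False
      then have "y \<in> \<Omega>" "dist x y < 4 * r" using kern_zero_outside[OF that(1)] kern_support(1) by blast+
      then show ?thesis using that(2)[of y] K(4) by force
    qed simp
    then have "(\<lambda>y. kern x r y * g y) = (\<lambda>y. 0)" by (rule ext)
    then show ?thesis by (simp add: kavg_def)
  qed
  have bz: "F x = 0" if x: "x \<in> closure \<Omega>" "x \<notin> \<Omega>" for x
  proof -
    have "eventually (\<lambda>k. bdry_rad k < d / 4) sequentially"
      using bdry_rad_tendsto d(1) by (intro order_tendstoD(2)) auto
    then have "eventually (\<lambda>k. kavg g x (bdry_rad k) = 0) sequentially"
    proof eventually_elim
      case (elim k)
      show ?case
      proof (rule kz[OF bdry_rad(1)])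
        fix y assume "y \<in> K"
        then have "d \<le> dist x y" using d(2)[of y x] x by (simp add: dist_commute)
        then show "4 * bdry_rad k \<le> dist x y" using elim by linarith
      qed
    qed
    then have "(\<lambda>k. kavg g x (bdry_rad k)) \<longlonglongrightarrow> 0" by (rule tendsto_eventually)
    then show ?thesis using x L by (simp add: F_def ext_op_def)
  qed
  have nz: "F x = 0" if x: "0 < infdist x \<Omega>" "infdist x \<Omega> \<le> d / 4" for x
  proof -
    have "x \<notin> \<Omega>" using x(1) by auto
    have "kavg g x (infdist x \<Omega>) = 0"
    proof (rule kz[OF x(1)])
      fix y assume "y \<in> K"
      then have "d \<le> dist x y" using d(2)[of y x] \<open>x \<notin> \<Omega>\<close> by (simp add: dist_commute)
      then show "4 * infdist x \<Omega> \<le> dist x y" using x(2) by linarith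
    qed
    then show ?thesis using ext_op_outside[OF x(1)] by (simp add: F_def ext_part_def)
  qed
  have cont: "isCont F x" for x
  proof -
    consider "x \<in> \<Omega>" | "x \<notin> closure \<Omega>" | "x \<in> closure \<Omega>" "x \<notin> \<Omega>" by blast
    then show ?thesis
    proof cases
      case 1
      have "isCont g x" using K(1) 1 open_dom by (simp add: continuous_on_eq_continuous_at)
      moreover have "eventually (\<lambda>y. F y = g y) (nhds x)"
        using eventually_nhds_in_open[OF open_dom 1] by eventually_elim (simp add: F_def ext_op_def)
      ultimately show ?thesis using isCont_cong by blast
    next
      case 2
      have o: "open (- closure \<Omega>)" by (simp add: open_Compl)
      have "isCont (ext_part g) x"
        using ext_part_continuous[OF li nb] 2 o by (simp add: continuous_on_eq_continuous_at)
      moreover have "eventually (\<lambda>y. F y = ext_part g y) (nhds x)"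
        using eventually_nhds_in_open[OF o, of x] 2
        by (auto elim!: eventually_mono simp: F_def ext_op_outside infdist_pos_iff)
      ultimately show ?thesis using isCont_cong by blast
    next
      case 3
      have i0: "infdist x \<Omega> = 0" using 3(1) dom_nonempty by (simp add: in_closure_iff_infdist_zero)
      \<comment> \<open>Around a boundary point all branches of the definition vanish:
        \<open>K\<close> is at distance at least \<open>d\<close>, and exterior points are closer to
        \<open>\<Omega>\<close> than \<open>d / 4\<close>.\<close>
      have "F y = 0" if y: "y \<in> ball x (d / 4)" for y
      proof -
        consider "y \<in> \<Omega>" | "y \<notin> closure \<Omega>" | "y \<in> closure \<Omega>" "y \<notin> \<Omega>" by blast
        then show ?thesis
        proof cases
          case 1
          have "y \<notin> K"
          proof
            assume "y \<in> K"
            then have "d \<le> dist y x" using d(2) 3(2) by auto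
            then show False using y d(1) by (simp add: dist_commute)
          qed
          then show ?thesis using 1 K(4) by (simp add: F_def ext_op_def)
        next
          case 2
          have "infdist y \<Omega> \<le> d / 4" using infdist_triangle[of y \<Omega> x] i0 y by (simp add: dist_commute)
          then show ?thesis using nz[OF infdist_pos_of[OF 2]] by simp
        qed (rule bz)
      qed
      then have "eventually (\<lambda>y. F y = 0) (nhds x)"
        using eventually_nhds_in_open[of "ball x (d / 4)" x] d(1) by (auto elim!: eventually_mono)
      then show ?thesis using isCont_cong[of F "\<lambda>_. 0" x] by simp
    qed
  qed
  obtain R where R: "\<And>y. y \<in> K \<Longrightarrow> norm y \<le> R"
    using compact_imp_bounded[OF K(2)] by (auto simp: bounded_iff)
  \<comment> \<open>The cutoff vanishes from distance \<open>2 * r1\<close> on, and a kernel of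
    smaller radius reaches less than \<open>8 * r1\<close>.\<close>
  have supp: "F x = 0" if x: "x \<notin> cball 0 (R + 8 * r1)" for x
  proof -
    have far: "8 * r1 \<le> dist x y" if "y \<in> K" for y
      using R[OF that] x norm_triangle_sub[of x y] by (simp add: dist_norm)
    consider "x \<in> \<Omega>" | "x \<notin> closure \<Omega>" | "x \<in> closure \<Omega>" "x \<notin> \<Omega>" by blast
    then show ?thesis
    proof cases
      case 1
      have "x \<notin> K" using R[of x] x r1_pos by auto
      then show ?thesis using 1 K(4) by (simp add: F_def ext_op_def)
    next
      case 2
      note p = infdist_pos_of[OF 2]
      show ?thesis
      proof (cases "2 * r1 \<le> infdist x \<Omega>")
        case True
        then show ?thesis using ext_op_outside[OF p] cut_0[OF True] by (simp add: F_def ext_part_def)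
      next
        case False
        have "kavg g x (infdist x \<Omega>) = 0"
        proof (rule kz[OF p])
          fix y assume "y \<in> K"
          then show "4 * infdist x \<Omega> \<le> dist x y" using far[of y] False by linarith
        qed
        then show ?thesis using ext_op_outside[OF p] by (simp add: F_def ext_part_def)
      qed
    qed (rule bz)
  qed
  have "continuous_on UNIV F" using cont by (simp add: continuous_on_eq_continuous_at)
  then show ?thesis
    unfolding F_def[symmetric] cont_compact_support_def using supp
    by (auto intro!: exI[of _ "cball 0 (R + 8 * r1)"])
qed

section \<open>Bounded Lipschitz functions\<close>

lemma osc_bd_lipschitz:
  assumes f: "locint f" and lip: "\<And>x y. x \<in> \<Omega> \<Longrightarrow> y \<in> \<Omega> \<Longrightarrow> \<bar>f x - f y\<bar> \<le> \<Lambda> * dist x y" "0 \<le> \<Lambda>" and t: "0 \<le> t"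
  shows "osc_bd f t (\<Lambda> * rn * t)"
  unfolding osc_bd_def
proof (intro conjI allI impI)
  show "0 \<le> \<Lambda> * rn * t" using lip(2) t rn_ge_1 by simp
  fix p s assume s: "0 < s" "s \<le> t" "ccube p s \<subseteq> \<Omega>"
  have p: "p \<in> ccube p s" using s by (simp add: mem_ccube)
  have "dev f (f p) (ccube p s) \<le> ennreal ((\<Lambda> * (rn * s / 2)) * s ^ CARD('n))"
  proof (rule dev_le_const)
    fix x assume x: "x \<in> ccube p s"
    have "\<bar>f x - f p\<bar> \<le> \<Lambda> * dist x p" using x p s by (intro lip) auto
    also have "\<dots> \<le> \<Lambda> * (rn * s / 2)"
      using ccube_subset_cball_half[OF _ x] s lip(2) by (intro mult_left_mono) (auto simp: dist_commute)
    finally show "\<bar>f x - f p\<bar> \<le> \<Lambda> * (rn * s / 2)" .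
  qed (use lip rn_ge_1 s in auto)
  then have "mean_osc f (ccube p s) \<le> 2 * (\<Lambda> * (rn * s / 2) * s ^ CARD('n)) / measure lebesgue (ccube p s)"
    using s lip rn_ge_1
    by (intro mean_osc_le_of_dev[OF locintD[OF f s(1,3)] ccube_lmeasurable]) (auto simp: measure_ccube)
  also have "\<dots> = \<Lambda> * rn * s" using s by (simp add: measure_ccube)
  also have "\<dots> \<le> \<Lambda> * rn * t" using s lip(2) rn_ge_1 by (intro mult_left_mono) auto
  finally show "mean_osc f (ccube p s) \<le> \<Lambda> * rn * t" .
qed

text \<open>Exterior points close to each other relative to their distance from
  \<open>\<Omega>\<close> fall under \<open>ext_part_lipschitz\<close>, with oscillation
  proportional to that distance. All other pairs are compared through points of
  \<open>\<Omega>\<close>.\<close>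

lemma ext_lip:
  obtains C where "1 \<le> C" "\<And>f \<Lambda> S L. \<lbrakk>\<And>x y. x \<in> \<Omega> \<Longrightarrow> y \<in> \<Omega> \<Longrightarrow> \<bar>f x - f y\<bar> \<le> \<Lambda> * dist x y; 0 \<le> \<Lambda>;
      \<And>x. x \<in> \<Omega> \<Longrightarrow> \<bar>f x\<bar> \<le> S; 0 \<le> S; \<And>u l. u \<longlonglongrightarrow> l \<Longrightarrow> L u = l\<rbrakk> \<Longrightarrow>
    (\<forall>x. \<bar>ext_op L f x\<bar> \<le> S) \<and> (\<forall>x y. \<bar>ext_op L f x - ext_op L f y\<bar> \<le> C * (S + \<Lambda>) * dist x y)"
proof -
  obtain C0 where C0: "0 \<le> C0"
    "\<And>f V W q x y. locint f \<Longrightarrow> norm_bd f V \<Longrightarrow> osc_bd f (min (2 * infdist q \<Omega>) (\<rho> / 2)) W \<Longrightarrow>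
       0 < infdist q \<Omega> \<Longrightarrow> dist q x \<le> infdist q \<Omega> / 2 \<Longrightarrow> dist q y \<le> infdist q \<Omega> / 2 \<Longrightarrow>
       \<bar>ext_part f x - ext_part f y\<bar>
         \<le> C0 * (W / infdist q \<Omega> + (if infdist q \<Omega> \<le> r1 / 2 then 0 else V)) * dist x y"
    using ext_part_lipschitz by blast
  \<comment> \<open>\<open>37\<close> and \<open>12 / r1\<close> are the coefficients of
    \<open>6 * D + 7 * \<Lambda>\<close> for \<open>D = 5 * \<Lambda> + 2 * S / r1\<close>; the last
    summand comes from \<open>ext_part_lipschitz\<close> with
    \<open>W / infdist x \<Omega> = 2 * rn * \<Lambda>\<close> and \<open>V = 2 * S\<close>.\<close>
  define C where "C = 37 + 12 / r1 + C0 * (2 * rn + 2)"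
  have C: "37 \<le> C" "12 / r1 \<le> C" "C0 * (2 * rn) \<le> C" "C0 * 2 \<le> C"
    using C0(1) r1_pos rn_ge_1 mult_nonneg_nonneg[of C0 rn] by (auto simp: C_def distrib_left)
  show thesis
  proof (rule that[of C])
    show "1 \<le> C" using C(1) by simp
    fix f :: "real ^ 'n \<Rightarrow> real" and \<Lambda> S :: real and L :: "(nat \<Rightarrow> real) \<Rightarrow> real"
    assume lip: "\<And>x y. x \<in> \<Omega> \<Longrightarrow> y \<in> \<Omega> \<Longrightarrow> \<bar>f x - f y\<bar> \<le> \<Lambda> * dist x y" "0 \<le> \<Lambda>"
      and S: "\<And>x. x \<in> \<Omega> \<Longrightarrow> \<bar>f x\<bar> \<le> S" "0 \<le> S" and L: "\<And>u l. u \<longlonglongrightarrow> l \<Longrightarrow> L u = l"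
    have "\<Lambda>-lipschitz_on \<Omega> f" using lip by (intro lipschitz_onI) (auto simp: dist_real_def)
    then have "continuous_on \<Omega> f" by (rule lipschitz_on_continuous_on)
    then have f: "locint f" by (rule locint_continuous)
    have nb: "norm_bd f (2 * S)" using S by (intro norm_bd_of_bounded f) auto
    define F where "F = ext_op L f"
    have mean: "\<bar>kavg f x r - f z\<bar> \<le> \<Lambda> * (4 * r + dist x z)" if a: "adm x r" and z: "z \<in> \<Omega>" for x r z
    proof (rule kavg_mean[OF f a])
      fix y assume y: "y \<in> \<Omega>" "dist x y < 4 * r"
      have "\<bar>f y - f z\<bar> \<le> \<Lambda> * dist y z" by (rule lip(1)[OF y(1) z])
      also have "\<dots> \<le> \<Lambda> * (4 * r + dist x z)"
        using y(2) dist_triangle[of y z x] lip(2) by (intro mult_left_mono) (auto simp: dist_commute)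
      finally show "\<bar>f y - f z\<bar> \<le> \<Lambda> * (4 * r + dist x z)" .
    qed
    have bdry: "(\<lambda>k. kavg f x (bdry_rad k)) \<longlonglongrightarrow> F x" if x: "x \<in> closure \<Omega>" "x \<notin> \<Omega>" for x
    proof -
      define u where "u = (\<lambda>k. kavg f x (bdry_rad k))"
      have "Cauchy u"
      proof (rule metric_CauchyI)
        fix e :: real assume e: "0 < e"
        \<comment> \<open>Two averages are each within \<open>5 * \<Lambda> * e'\<close> of
          \<open>f z\<close>; \<open>\<Lambda> + 1\<close> covers the case
          \<open>\<Lambda> = 0\<close>.\<close>
        define e' where "e' = e / (16 * (\<Lambda> + 1))"
        have e': "0 < e'" "\<Lambda> * (10 * e') < e"
        proof -
          show p: "0 < e'" using e lip(2) by (simp add: e'_def)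
          have "\<Lambda> * (10 * e') \<le> (\<Lambda> + 1) * (10 * e')" using p by (intro mult_right_mono) auto
          also have "\<dots> = 10 / 16 * e" using lip(2) by (simp add: e'_def field_simps)
          finally show "\<Lambda> * (10 * e') < e" using e by simp
        qed
        obtain z where z: "z \<in> \<Omega>" "dist z x < e'" using x(1) e'(1) unfolding closure_approachable by blast
        have "eventually (\<lambda>k. bdry_rad k < e') sequentially"
          using bdry_rad_tendsto e'(1) by (intro order_tendstoD(2)) auto
        then obtain M where M: "\<And>k. M \<le> k \<Longrightarrow> bdry_rad k < e'" unfolding eventually_sequentially by blast
        have near: "\<bar>u k - f z\<bar> \<le> \<Lambda> * (5 * e')" if "M \<le> k" for k
        proof -
          have "\<bar>u k - f z\<bar> \<le> \<Lambda> * (4 * bdry_rad k + dist x z)"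
            unfolding u_def by (rule mean[OF bdry_adm[OF x] z(1)])
          also have "\<dots> \<le> \<Lambda> * (5 * e')"
            using M[OF that] z(2) lip(2) by (intro mult_left_mono) (auto simp: dist_commute)
          finally show ?thesis .
        qed
        show "\<exists>M. \<forall>m\<ge>M. \<forall>n\<ge>M. dist (u m) (u n) < e"
        proof (intro exI[of _ M] allI impI)
          fix m n assume "M \<le> m" "M \<le> n"
          then have "\<bar>u m - f z\<bar> \<le> \<Lambda> * (5 * e')" "\<bar>u n - f z\<bar> \<le> \<Lambda> * (5 * e')" using near by auto
          then have "\<bar>u m - u n\<bar> \<le> \<Lambda> * (10 * e')" by linarith
          then show "dist (u m) (u n) < e" using e'(2) by (simp add: dist_real_def)
        qed
      qed
      then obtain l where l: "u \<longlonglongrightarrow> l" using Cauchy_convergent unfolding convergent_def by blast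
      then have "F x = l" using L[OF l] x by (simp add: F_def ext_op_def u_def)
      then show ?thesis using l by (simp add: u_def)
    qed
    have bound: "\<bar>F x\<bar> \<le> S" for x
    proof -
      consider "x \<in> \<Omega>" | "x \<notin> closure \<Omega>" | "x \<in> closure \<Omega>" "x \<notin> \<Omega>" by blast
      then show ?thesis
      proof cases
        case 1 then show ?thesis using S by (simp add: F_def ext_op_def)
      next
        case 2
        then show ?thesis
          using ext_part_bounded[OF f S infdist_pos_of[OF 2]] ext_op_outside[OF infdist_pos_of[OF 2]] by (simp add: F_def)
      next
        case 3
        have "\<bar>kavg f x (bdry_rad k)\<bar> \<le> S" for k
          using kavg_mean[OF f bdry_adm[OF 3], where a = 0 and B = S] S by simp
        then show ?thesis by (intro LIMSEQ_le_const2[OF tendsto_rabs[OF bdry[OF 3]]]) auto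
      qed
    qed
    \<comment> \<open>Up to distance \<open>r1\<close> the average deviates by at most
      \<open>\<Lambda>\<close> times five times the distance; beyond it the sup bound
      \<open>2 * S\<close> is at most \<open>2 * S / r1\<close> times the distance.\<close>
    define D where "D = 5 * \<Lambda> + 2 * S / r1"
    have D: "0 \<le> D" "\<Lambda> \<le> D" using lip(2) S(2) r1_pos by (auto simp: D_def)
    have cross: "\<bar>F x - F z\<bar> \<le> D * dist x z" if x: "x \<notin> \<Omega>" and z: "z \<in> \<Omega>" for x z
    proof -
      have Fz: "F z = f z" using z by (simp add: F_def ext_op_def)
      show ?thesis
      proof (cases "x \<in> closure \<Omega>")
        case True
        have "(\<lambda>k. \<bar>kavg f x (bdry_rad k) - f z\<bar>) \<longlonglongrightarrow> \<bar>F x - f z\<bar>"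
          by (intro tendsto_intros bdry True x)
        moreover have "(\<lambda>k. \<Lambda> * (4 * bdry_rad k + dist x z)) \<longlonglongrightarrow> \<Lambda> * (4 * 0 + dist x z)"
          by (intro tendsto_intros bdry_rad_tendsto)
        ultimately have "\<bar>F x - f z\<bar> \<le> \<Lambda> * (4 * 0 + dist x z)"
          using mean[OF bdry_adm[OF True x] z] by (intro LIMSEQ_le) auto
        also have "\<dots> \<le> D * dist x z" using D by (simp add: mult_right_mono)
        finally show ?thesis by (simp add: Fz)
      next
        case False
        define d where "d = infdist x \<Omega>"
        have d: "0 < d" "d \<le> dist x z" using infdist_pos_of[OF False] infdist_le[OF z] by (auto simp: d_def)
        show ?thesis
        proof (cases "d \<le> r1")
          case True
          then have "d \<le> \<rho> / 2" using rho by (simp add: r1_def)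
          then have a: "adm x d" using ext_adm[of x] d by (simp add: d_def)
          have "F x = kavg f x d" using ext_op_outside[of x] d True by (simp add: F_def ext_part_def d_def cut_1)
          then have "\<bar>F x - F z\<bar> \<le> \<Lambda> * (4 * d + dist x z)" using mean[OF a z] by (simp add: Fz)
          also have "\<dots> \<le> \<Lambda> * (5 * dist x z)" using d lip(2) by (intro mult_left_mono) auto
          also have "\<dots> = 5 * \<Lambda> * dist x z" by simp
          also have "\<dots> \<le> D * dist x z" using S(2) r1_pos by (intro mult_right_mono) (auto simp: D_def)
          finally show ?thesis .
        next
          case False
          have "\<bar>F x - F z\<bar> \<le> 2 * S" using bound[of x] bound[of z] by linarith
          also have "\<dots> = 2 * S / r1 * r1" using r1_pos by simp
          also have "\<dots> \<le> 2 * S / r1 * dist x z" using False d S(2) r1_pos by (intro mult_left_mono) auto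
          also have "\<dots> \<le> D * dist x z" using lip(2) by (intro mult_right_mono) (auto simp: D_def)
          finally show ?thesis .
        qed
      qed
    qed
    have DC: "6 * D + 7 * \<Lambda> \<le> C * (S + \<Lambda>)"
    proof -
      have "6 * D + 7 * \<Lambda> = 37 * \<Lambda> + 12 / r1 * S" by (simp add: D_def)
      also have "\<dots> \<le> C * \<Lambda> + C * S" using C lip(2) S(2) by (intro add_mono mult_right_mono) auto
      finally show ?thesis by (simp add: distrib_left)
    qed
    have out: "\<bar>F x - F y\<bar> \<le> C * (S + \<Lambda>) * dist x y"
      if x: "x \<notin> \<Omega>" "y \<notin> \<Omega>" and le: "infdist y \<Omega> \<le> infdist x \<Omega>" for x y
    proof (cases "x = y")
      case False
      show ?thesis
      proof (cases "dist x y \<le> infdist x \<Omega> / 2")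
        case True
        have "0 < dist x y" using False by simp
        then have dx: "0 < infdist x \<Omega>" using True by linarith
        have "infdist x \<Omega> \<le> infdist y \<Omega> + dist x y" by (rule infdist_triangle)
        then have dy: "0 < infdist y \<Omega>" using True dx by linarith
        have o: "osc_bd f (min (2 * infdist x \<Omega>) (\<rho> / 2)) (\<Lambda> * rn * (2 * infdist x \<Omega>))"
          using dx by (intro osc_bd_mono[OF osc_bd_lipschitz[OF f lip]]) auto
        have "\<bar>F x - F y\<bar> \<le> C0 * (\<Lambda> * rn * (2 * infdist x \<Omega>) / infdist x \<Omega>
            + (if infdist x \<Omega> \<le> r1 / 2 then 0 else 2 * S)) * dist x y"
          unfolding F_def ext_op_outside[OF dx] ext_op_outside[OF dy]
          using True dx by (intro C0(2)[OF f nb o dx]) auto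
        also have "\<dots> \<le> C0 * (\<Lambda> * rn * 2 + 2 * S) * dist x y"
          using C0(1) S(2) dx by (intro mult_right_mono mult_left_mono add_mono) auto
        also have "\<dots> = (C0 * (2 * rn) * \<Lambda> + C0 * 2 * S) * dist x y" by (simp add: algebra_simps)
        also have "\<dots> \<le> (C * \<Lambda> + C * S) * dist x y"
          using C lip(2) S(2) by (intro mult_right_mono add_mono) auto
        finally show ?thesis by (simp add: distrib_left add.commute)
      next
        case far: False
        have xy: "0 < dist x y" using False by simp
        \<comment> \<open>Here the distances to \<open>\<Omega>\<close> are below
          \<open>2 * dist x y\<close>. With slack \<open>dist x y\<close> for the infimum, the
          detours have length at most \<open>3 * dist x y\<close>.\<close>
        obtain x' where x': "x' \<in> \<Omega>" "dist x x' < infdist x \<Omega> + dist x y"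
          using infdist_dom_attained[of x "infdist x \<Omega> + dist x y"] xy by auto
        obtain y' where y': "y' \<in> \<Omega>" "dist y y' < infdist y \<Omega> + dist x y"
          using infdist_dom_attained[of y "infdist y \<Omega> + dist x y"] xy by auto
        have d: "dist x x' \<le> 3 * dist x y" "dist y y' \<le> 3 * dist x y"
          using x' y' far le by auto
        have "dist x' y' \<le> dist x' x + dist x y + dist y y'"
          using dist_triangle[of x' y' x] dist_triangle[of x y' y] by linarith
        then have d3: "dist x' y' \<le> 7 * dist x y" using d by (simp add: dist_commute)
        have "\<bar>F x - F x'\<bar> \<le> D * (3 * dist x y)"
          using cross[OF x(1) x'(1)] d(1) D(1) by (meson mult_left_mono order_trans)
        moreover have "\<bar>F y - F y'\<bar> \<le> D * (3 * dist x y)"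
          using cross[OF x(2) y'(1)] d(2) D(1) by (meson mult_left_mono order_trans)
        moreover have "\<bar>F x' - F y'\<bar> \<le> \<Lambda> * (7 * dist x y)"
          using lip(1)[OF x'(1) y'(1)] mult_left_mono[OF d3 lip(2)] x' y' by (simp add: F_def ext_op_def)
        ultimately have "\<bar>F x - F y\<bar> \<le> D * (3 * dist x y) + \<Lambda> * (7 * dist x y) + D * (3 * dist x y)" by linarith
        also have "\<dots> = (6 * D + 7 * \<Lambda>) * dist x y" by (simp add: algebra_simps)
        also have "\<dots> \<le> C * (S + \<Lambda>) * dist x y" using DC by (intro mult_right_mono) auto
        finally show ?thesis .
      qed
    qed simp
    have all: "\<bar>F x - F y\<bar> \<le> C * (S + \<Lambda>) * dist x y" for x y
    proof -
      have le: "D * dist x y \<le> C * (S + \<Lambda>) * dist x y" "\<Lambda> * dist x y \<le> C * (S + \<Lambda>) * dist x y"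
        using DC D lip(2) by (auto intro!: mult_right_mono)
      consider "x \<in> \<Omega>" "y \<in> \<Omega>" | "x \<in> \<Omega>" "y \<notin> \<Omega>" | "x \<notin> \<Omega>" "y \<in> \<Omega>" | "x \<notin> \<Omega>" "y \<notin> \<Omega>" by blast
      then show ?thesis
      proof cases
        case 1
        then show ?thesis using lip(1)[of x y] le(2) by (simp add: F_def ext_op_def)
      next
        case 2
        then show ?thesis using cross[of y x] le(1) by (simp add: dist_commute abs_minus_commute)
      next
        case 3
        then show ?thesis using cross[of x y] le(1) by simp
      next
        case 4
        then show ?thesis using out[of x y] out[of y x]
          by (cases "infdist y \<Omega> \<le> infdist x \<Omega>") (auto simp: dist_commute abs_minus_commute)
      qed
    qed
    show "(\<forall>x. \<bar>ext_op L f x\<bar> \<le> S) \<and> (\<forall>x y. \<bar>ext_op L f x - ext_op L f y\<bar> \<le> C * (S + \<Lambda>) * dist x y)"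
      using bound all by (simp add: F_def)
  qed
qed

section \<open>The extension theorem\<close>

lemma extension_theorem:
  "\<exists>T. linear_extension_operator \<Omega> (bmo \<rho> \<Omega>) T \<and>
     bounded_map T (bmo \<rho> \<Omega>) (bmo_norm \<rho> \<Omega>) (bmo 1 UNIV) (bmo_norm 1 UNIV) \<and>
     bounded_map T (vmo \<rho> \<Omega>) (bmo_norm \<rho> \<Omega>) (vmo 1 UNIV) (bmo_norm 1 UNIV) \<and>
     bounded_map T (cmo \<rho> \<Omega>) (bmo_norm \<rho> \<Omega>) (cmo 1 UNIV) (bmo_norm 1 UNIV) \<and>
     bounded_map T (Lip_b \<Omega>) (Lip_b_norm \<Omega>) (Lip_b UNIV) (Lip_b_norm UNIV)"
proof -
  obtain L :: "(nat \<Rightarrow> real) \<Rightarrow> real" where L: "\<And>u v. L (\<lambda>k. u k + v k) = L u + L v"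
    "\<And>c u. L (\<lambda>k. c * u k) = c * L u" "\<And>u l. u \<longlonglongrightarrow> l \<Longrightarrow> L u = l"
  proof (rule linear_limit)
    fix L :: "(nat \<Rightarrow> real) \<Rightarrow> real"
    assume "\<And>u v. L (\<lambda>k. u k + v k) = L u + L v" "\<And>c u. L (\<lambda>k. c * u k) = c * L u" "\<And>u l. u \<longlonglongrightarrow> l \<Longrightarrow> L u = l"
    then show thesis by (rule that)
  qed
  define T where "T = ext_op L"
  obtain C where C: "0 \<le> C" "\<And>f V L. locint f \<Longrightarrow> norm_bd f V \<Longrightarrow>
    (\<forall>(a, l) \<in> cubes_in UNIV. set_integrable lebesgue (cube a l) (ext_op L f)) \<and>
    bmo_norm 1 UNIV (ext_op L f) \<le> ennreal (C * V)"
    using ext_bmo by blast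
  have Tbmo: "T f \<in> bmo 1 UNIV \<and> bmo_norm 1 UNIV (T f) \<le> ennreal C * bmo_norm \<rho> \<Omega> f" if f: "f \<in> bmo \<rho> \<Omega>" for f
  proof -
    define V where "V = enn2real (bmo_norm \<rho> \<Omega> f)"
    note b = bmoD[OF f, folded V_def]
    have V: "0 \<le> V" by (simp add: V_def)
    note c = C(2)[OF b(1,2), of L, folded T_def]
    have "bmo_norm 1 UNIV (T f) < \<infinity>" using c le_less_trans[OF _ ennreal_less_top] by auto
    then show ?thesis using c C(1) V by (simp add: bmo_def b(3) ennreal_mult)
  qed
  have le: "linear_extension_operator \<Omega> (bmo \<rho> \<Omega>) T"
    unfolding linear_extension_operator_def T_def
  proof (intro conjI ballI allI impI)
    fix f g :: "real ^ 'n \<Rightarrow> real" assume "\<forall>x\<in>\<Omega>. f x = g x"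
    then show "ext_op L f = ext_op L g" by (intro ext_op_cong) auto
  next
    fix f g :: "real ^ 'n \<Rightarrow> real" assume "f \<in> bmo \<rho> \<Omega>" "g \<in> bmo \<rho> \<Omega>"
    then show "ext_op L (\<lambda>x. f x + g x) = (\<lambda>x. ext_op L f x + ext_op L g x)"
      using bmoD L(1) by (intro ext_op_add) blast+
  next
    fix f :: "real ^ 'n \<Rightarrow> real" and c show "ext_op L (\<lambda>x. c * f x) = (\<lambda>x. c * ext_op L f x)" by (rule ext_op_cmult[OF L(2)])
  next
    fix f :: "real ^ 'n \<Rightarrow> real" and x assume "x \<in> \<Omega>" then show "ext_op L f x = f x" by (simp add: ext_op_def)
  qed
  have Tvmo: "T f \<in> vmo 1 UNIV" if "f \<in> vmo \<rho> \<Omega>" for f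
  proof -
    have f: "f \<in> bmo \<rho> \<Omega>" "(osc_modulus \<Omega> f \<longlongrightarrow> 0) (at_right 0)" using that by (auto simp: vmo_def)
    show ?thesis using Tbmo[OF f(1)] ext_vmo[OF bmoD(1,2)[OF f(1)] f(2), of L] by (simp add: vmo_def T_def)
  qed
  have Tcmo: "T f \<in> cmo 1 UNIV" if "f \<in> cmo \<rho> \<Omega>" for f
  proof -
    have f: "f \<in> bmo \<rho> \<Omega>" using that by (simp add: cmo_def)
    have "\<exists>h\<in>cont_compact_support UNIV. bmo_norm 1 UNIV (\<lambda>x. T f x - h x) < e" if e: "0 < e" for e :: ennreal
    proof -
      \<comment> \<open>\<open>e\<close> may be infinite, so a positive real number below it is
        taken.\<close>
      obtain e0 :: real where e0: "0 < e0" "ennreal e0 \<le> e"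
      proof (cases e)
        case (real r) then show thesis using that[of r] e by auto
      next
        case top then show thesis using that[of 1] by simp
      qed
      \<comment> \<open>The \<open>+ 1\<close> covers \<open>C = 0\<close> and makes the final
        inequality strict.\<close>
      define e' where "e' = e0 / (C + 1)"
      have e': "0 < e'" "C * e' < e0" using e0 C(1) by (auto simp: e'_def field_simps)
      obtain g where g: "g \<in> cont_compact_support \<Omega>" "bmo_norm \<rho> \<Omega> (\<lambda>x. f x - g x) < ennreal e'"
      proof -
        have "0 < ennreal e'" using e'(1) by simp
        then show thesis using \<open>f \<in> cmo \<rho> \<Omega>\<close> that unfolding cmo_def by blast
      qed
      have lg: "locint g" using g(1) by (intro locint_continuous) (simp add: cont_compact_support_def)
      obtain B where B: "0 \<le> B" "\<And>x. x \<in> \<Omega> \<Longrightarrow> \<bar>g x\<bar> \<le> B" using cc_bounded[OF g(1)] by blast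
      have ng: "norm_bd g (2 * B)" using B by (intro norm_bd_of_bounded lg) auto
      \<comment> \<open>Linearity is available for sums and multiples, so the difference is written
        as \<open>f + (- 1) * g\<close>.\<close>
      have mg: "locint (\<lambda>x. - 1 * g x)" "norm_bd (\<lambda>x. - 1 * g x) (2 * B)"
      proof -
        show l: "locint (\<lambda>x. - 1 * g x)" using g(1)
          by (intro locint_continuous continuous_intros) (simp add: cont_compact_support_def)
        show "norm_bd (\<lambda>x. - 1 * g x) (2 * B)" using B by (intro norm_bd_of_bounded l) auto
      qed
      have lfg: "locint (\<lambda>x. f x - g x)"
        using bmoD(1)[OF f] lg unfolding locint_def by (auto intro!: set_integral_diff(1))
      have nfg: "norm_bd (\<lambda>x. f x - g x) e'" using g(2) e'(1) by (intro norm_bd_of_bmo_norm) auto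
      have "T (\<lambda>x. f x + - 1 * g x) = (\<lambda>x. T f x + T (\<lambda>x. - 1 * g x) x)"
        unfolding T_def by (rule ext_op_add[OF bmoD(1,2)[OF f] mg L(1)])
      also have "T (\<lambda>x. - 1 * g x) = (\<lambda>x. - 1 * T g x)" unfolding T_def by (rule ext_op_cmult[OF L(2)])
      finally have eq: "T (\<lambda>x. f x - g x) = (\<lambda>x. T f x - T g x)" by simp
      have "bmo_norm 1 UNIV (\<lambda>x. T f x - T g x) \<le> ennreal (C * e')"
        unfolding eq[symmetric] using C(2)[OF lfg nfg, of L] by (simp add: T_def)
      also have "\<dots> < ennreal e0" using e' C(1) by (simp add: ennreal_less_iff)
      finally have "bmo_norm 1 UNIV (\<lambda>x. T f x - T g x) < e" using e0(2) by (rule less_le_trans)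
      moreover have "T g \<in> cont_compact_support UNIV" unfolding T_def by (rule ext_cc[OF g(1) L(3)])
      ultimately show ?thesis by blast
    qed
    then show ?thesis using Tbmo[OF f] by (simp add: cmo_def)
  qed
  obtain C' where C': "1 \<le> C'" "\<And>f \<Lambda> S L. \<lbrakk>\<And>x y. x \<in> \<Omega> \<Longrightarrow> y \<in> \<Omega> \<Longrightarrow> \<bar>f x - f y\<bar> \<le> \<Lambda> * dist x y; 0 \<le> \<Lambda>;
      \<And>x. x \<in> \<Omega> \<Longrightarrow> \<bar>f x\<bar> \<le> S; 0 \<le> S; \<And>u l. u \<longlonglongrightarrow> l \<Longrightarrow> L u = l\<rbrakk> \<Longrightarrow>
    (\<forall>x. \<bar>ext_op L f x\<bar> \<le> S) \<and> (\<forall>x y. \<bar>ext_op L f x - ext_op L f y\<bar> \<le> C' * (S + \<Lambda>) * dist x y)"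
    using ext_lip by blast
  have TLip: "T f \<in> Lip_b UNIV \<and> Lip_b_norm UNIV (T f) \<le> ennreal (1 + C') * Lip_b_norm \<Omega> f"
    if f: "f \<in> Lip_b \<Omega>" for f
  proof -
    define S' where "S' = (SUP x\<in>\<Omega>. ennreal \<bar>f x\<bar>)"
    define \<Lambda>' where "\<Lambda>' = (SUP (x, y) \<in> {(x, y). x \<in> \<Omega> \<and> y \<in> \<Omega> \<and> x \<noteq> y}. ennreal (\<bar>f x - f y\<bar> / norm (x - y)))"
    obtain B where B: "\<And>x. x \<in> \<Omega> \<Longrightarrow> \<bar>f x\<bar> \<le> B" using f by (auto simp: Lip_b_def bounded_iff)
    obtain M where M: "M-lipschitz_on \<Omega> f" using f by (auto simp: Lip_b_def)
    have "S' \<le> ennreal B" unfolding S'_def by (intro SUP_least ennreal_leI B)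
    then have "S' < \<infinity>" using le_less_trans[OF _ ennreal_less_top] by simp
    then have S: "S' = ennreal (enn2real S')" by simp
    have "\<Lambda>' \<le> ennreal M" unfolding \<Lambda>'_def
    proof (rule SUP_least, clarify)
      fix x y assume "x \<in> \<Omega>" "y \<in> \<Omega>" "x \<noteq> y"
      then show "ennreal (\<bar>f x - f y\<bar> / norm (x - y)) \<le> ennreal M"
        using lipschitz_onD[OF M, of x y] by (intro ennreal_leI) (simp add: dist_real_def dist_norm field_simps)
    qed
    then have "\<Lambda>' < \<infinity>" using le_less_trans[OF _ ennreal_less_top] by simp
    then have \<Lambda>: "\<Lambda>' = ennreal (enn2real \<Lambda>')" by simp
    define S1 where "S1 = enn2real S'"
    define \<Lambda>1 where "\<Lambda>1 = enn2real \<Lambda>'"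
    have nn: "0 \<le> S1" "0 \<le> \<Lambda>1" by (auto simp: S1_def \<Lambda>1_def)
    have b: "\<bar>f x\<bar> \<le> S1" if "x \<in> \<Omega>" for x
    proof -
      have "ennreal \<bar>f x\<bar> \<le> S'" unfolding S'_def using that by (intro SUP_upper)
      then show ?thesis using S nn by (metis S1_def ennreal_le_iff)
    qed
    have l: "\<bar>f x - f y\<bar> \<le> \<Lambda>1 * dist x y" if "x \<in> \<Omega>" "y \<in> \<Omega>" for x y
    proof (cases "x = y")
      case False
      have "ennreal (\<bar>f x - f y\<bar> / norm (x - y)) \<le> \<Lambda>'"
        unfolding \<Lambda>'_def using that False by (intro SUP_upper2[of "(x, y)"]) auto
      then have "\<bar>f x - f y\<bar> / norm (x - y) \<le> \<Lambda>1" using \<Lambda> nn by (metis \<Lambda>1_def ennreal_le_iff)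
      then show ?thesis using False by (simp add: dist_norm field_simps)
    qed simp
    have TF: "\<bar>T f x\<bar> \<le> S1" "\<bar>T f x - T f y\<bar> \<le> C' * (S1 + \<Lambda>1) * dist x y" for x y
      using C'(2)[OF l nn(2) b nn(1) L(3)] unfolding T_def by auto
    have cn: "0 \<le> C' * (S1 + \<Lambda>1)" using C'(1) nn by simp
    have "T f \<in> Lip_b UNIV"
      unfolding Lip_b_def
    proof (intro CollectI conjI)
      show "bounded (range (T f))" using TF(1) by (auto simp: bounded_iff)
      show "\<exists>L. L-lipschitz_on UNIV (T f)"
        using TF(2) cn by (intro exI[of _ "C' * (S1 + \<Lambda>1)"] lipschitz_onI) (auto simp: dist_real_def)
    qed
    moreover have "Lip_b_norm UNIV (T f) \<le> ennreal (1 + C') * Lip_b_norm \<Omega> f"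
    proof -
      have "Lip_b_norm UNIV (T f) \<le> ennreal S1 + ennreal (C' * (S1 + \<Lambda>1))"
        unfolding Lip_b_norm_def
      proof (rule add_mono)
        show "(SUP x. ennreal \<bar>T f x\<bar>) \<le> ennreal S1" by (intro SUP_least ennreal_leI TF)
        show "(SUP (x, y)\<in>{(x, y). x \<in> UNIV \<and> y \<in> UNIV \<and> x \<noteq> y}. ennreal (\<bar>T f x - T f y\<bar> / norm (x - y)))
            \<le> ennreal (C' * (S1 + \<Lambda>1))"
        proof (rule SUP_least, clarify)
          fix x y :: "real ^ 'n" assume "x \<noteq> y"
          then show "ennreal (\<bar>T f x - T f y\<bar> / norm (x - y)) \<le> ennreal (C' * (S1 + \<Lambda>1))"
            using TF(2)[of x y] by (intro ennreal_leI) (simp add: dist_norm field_simps)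
        qed
      qed
      also have "\<dots> = ennreal (S1 + C' * (S1 + \<Lambda>1))" using nn cn by simp
      also have "\<dots> \<le> ennreal ((1 + C') * (S1 + \<Lambda>1))" using nn by (intro ennreal_leI) (simp add: algebra_simps)
      also have "\<dots> = ennreal (1 + C') * ennreal (S1 + \<Lambda>1)" using C'(1) nn by (intro ennreal_mult) auto
      also have "ennreal (S1 + \<Lambda>1) = Lip_b_norm \<Omega> f"
        unfolding Lip_b_norm_def S'_def[symmetric] \<Lambda>'_def[symmetric] using S \<Lambda> nn
        by (simp add: S1_def \<Lambda>1_def ennreal_plus)
      finally show ?thesis .
    qed
    ultimately show ?thesis by simp
  qed
  show ?thesis
  proof (intro exI[of _ T] conjI le)
    show "bounded_map T (bmo \<rho> \<Omega>) (bmo_norm \<rho> \<Omega>) (bmo 1 UNIV) (bmo_norm 1 UNIV)"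
      using Tbmo unfolding bounded_map_def by blast
    show "bounded_map T (vmo \<rho> \<Omega>) (bmo_norm \<rho> \<Omega>) (vmo 1 UNIV) (bmo_norm 1 UNIV)"
      using Tvmo Tbmo unfolding bounded_map_def by (fastforce simp: vmo_def)
    show "bounded_map T (cmo \<rho> \<Omega>) (bmo_norm \<rho> \<Omega>) (cmo 1 UNIV) (bmo_norm 1 UNIV)"
      using Tcmo Tbmo unfolding bounded_map_def by (fastforce simp: cmo_def)
    show "bounded_map T (Lip_b \<Omega>) (Lip_b_norm \<Omega>) (Lip_b UNIV) (Lip_b_norm UNIV)"
      using TLip unfolding bounded_map_def by blast
  qed
qed

end

text \<open>The empty set satisfies the definition of the domains but contains no cube, so it falls
  outside the locale; the zero operator serves.\<close>

lemma empty_extension: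
  fixes X :: "(real ^ 'n \<Rightarrow> real) set" and N
  defines "T \<equiv> \<lambda>(f :: real ^ 'n \<Rightarrow> real) (x :: real ^ 'n). 0 :: real"
  shows "linear_extension_operator {} X T"
  "bounded_map T X N (bmo 1 UNIV) (bmo_norm 1 UNIV)"
  "bounded_map T X N (vmo 1 UNIV) (bmo_norm 1 UNIV)"
  "bounded_map T X N (cmo 1 UNIV) (bmo_norm 1 UNIV)"
  "bounded_map T X N (Lip_b UNIV) (Lip_b_norm UNIV)"
proof -
  let ?z = "\<lambda>x :: real ^ 'n. 0 :: real"
  have a: "avg ?z Q = 0" for Q by (simp add: avg_def set_lebesgue_integral_def)
  have o: "mean_osc ?z Q = 0" for Q by (simp add: mean_osc_def a)
  have om: "osc_modulus UNIV ?z t = 0" for t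
    unfolding osc_modulus_def by (simp add: o case_prod_unfold bot_ennreal[symmetric])
  have n: "bmo_norm 1 UNIV ?z = 0"
    unfolding bmo_norm_def by (simp add: om a case_prod_unfold bot_ennreal[symmetric])
  have b: "?z \<in> bmo 1 UNIV" by (simp add: bmo_def n set_integrable_def)
  have "(osc_modulus UNIV ?z \<longlongrightarrow> 0) (at_right 0)" by (rule tendsto_eventually) (simp add: om)
  with b have v: "?z \<in> vmo 1 UNIV" by (simp add: vmo_def)
  have "?z \<in> cont_compact_support UNIV"
    unfolding cont_compact_support_def by (auto intro!: exI[of _ "{}"])
  then have c: "?z \<in> cmo 1 UNIV"
    using b n unfolding cmo_def by (auto intro!: bexI[of _ ?z])
  have l: "?z \<in> Lip_b UNIV" unfolding Lip_b_def by (auto intro!: exI[of _ 0] lipschitz_onI)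
  have ln: "Lip_b_norm UNIV ?z = 0"
    unfolding Lip_b_norm_def by (simp add: case_prod_unfold bot_ennreal[symmetric])
  show "linear_extension_operator {} X T" by (simp add: linear_extension_operator_def T_def)
  show "bounded_map T X N (bmo 1 UNIV) (bmo_norm 1 UNIV)"
    "bounded_map T X N (vmo 1 UNIV) (bmo_norm 1 UNIV)"
    "bounded_map T X N (cmo 1 UNIV) (bmo_norm 1 UNIV)"
    "bounded_map T X N (Lip_b UNIV) (Lip_b_norm UNIV)"
    using b v c l by (auto simp: bounded_map_def n ln T_def)
qed

text \<open>The large cube is essential. If a nonempty \<open>\<Omega>\<close> contains no cube of
  side at least \<open>\<rho>\<close>, as for a small ball and large \<open>\<delta>\<close>, then
  the constant 1 has norm 0 in bmo of \<open>\<Omega>\<close>, while every extension of it has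
  positive norm on the whole space; so no bounded operator exists.\<close>

theorem theorem2:
  fixes \<Omega> :: "(real ^ 'n) set" and \<epsilon> \<delta> \<rho> :: real
  defines "\<rho> \<equiv> bmo_scale CARD('n) \<epsilon> \<delta>"
  assumes "0 < \<epsilon>" "\<epsilon> \<le> 1" "0 < \<delta>"
    and "eps_delta_domain \<epsilon> \<delta> \<Omega>"
    and nondegenerate: "\<Omega> \<noteq> {} \<Longrightarrow> \<exists>(a, l) \<in> cubes_in \<Omega>. \<rho> \<le> l"
  shows "\<exists>T. linear_extension_operator \<Omega> (bmo \<rho> \<Omega>) T \<and>
           bounded_map T (bmo \<rho> \<Omega>) (bmo_norm \<rho> \<Omega>) (bmo 1 UNIV) (bmo_norm 1 UNIV) \<and>
           bounded_map T (vmo \<rho> \<Omega>) (bmo_norm \<rho> \<Omega>) (vmo 1 UNIV) (bmo_norm 1 UNIV) \<and>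
           bounded_map T (cmo \<rho> \<Omega>) (bmo_norm \<rho> \<Omega>) (cmo 1 UNIV) (bmo_norm 1 UNIV) \<and>
           bounded_map T (Lip_b \<Omega>) (Lip_b_norm \<Omega>) (Lip_b UNIV) (Lip_b_norm UNIV)"
proof (cases "\<Omega> = {}")
  case True
  show ?thesis unfolding True by (intro exI[of _ "\<lambda>f x. 0"] conjI empty_extension)
next
  case False
  let ?n = "real CARD('n)"
  have n: "1 \<le> ?n" by simp
  have "\<rho> = \<epsilon>\<^sup>2 * \<delta> / (320 * ?n * (1 + sqrt ?n * \<epsilon>))" by (simp add: \<rho>_def bmo_scale_def)
  moreover have den: "0 < 320 * ?n * (1 + sqrt ?n * \<epsilon>)"
    using assms(2) n by (intro mult_pos_pos add_pos_nonneg) auto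
  ultimately have rho: "0 < \<rho>" "\<rho> * (320 * ?n * (1 + sqrt ?n * \<epsilon>)) = \<epsilon>\<^sup>2 * \<delta>" using assms(2,4) by auto
  interpret loc_uniform \<Omega> \<epsilon> \<delta> \<rho> "sqrt CARD('n)"
  proof
    \<comment> \<open>The exact scale enters through
      \<open>sqrt n \<le> n * (1 + sqrt n * \<epsilon>)\<close> and
      \<open>\<epsilon>^2 \<le> \<epsilon>\<close>.\<close>
    have "?n * 1 \<le> ?n * (1 + sqrt ?n * \<epsilon>)" using assms(2) n by (intro mult_left_mono) auto
    moreover have "sqrt ?n \<le> ?n" by (rule real_le_lsqrt) (auto simp: power2_eq_square)
    ultimately have h: "sqrt ?n \<le> ?n * (1 + sqrt ?n * \<epsilon>)" by linarith
    have "320 * \<rho> * sqrt ?n \<le> 320 * \<rho> * (?n * (1 + sqrt ?n * \<epsilon>))"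
      by (rule mult_left_mono[OF h]) (use rho(1) in simp)
    also have "\<dots> = \<epsilon>\<^sup>2 * \<delta>" using rho(2) by (simp add: mult_ac)
    also have "\<dots> \<le> \<epsilon> * \<delta>" using assms(2-4) by (simp add: power2_eq_square mult_right_mono)
    finally show "sqrt ?n * \<rho> \<le> \<epsilon> * \<delta> / 320" by (simp add: mult_ac)
  qed (use assms rho False in auto)
  show ?thesis by (rule extension_theorem)
qed

end
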